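(* Fix $\kappa>1$ and OBABO parameters $h,\gamma>0$ with $h<2/\sqrt\kappa$, and set $r=e^{-\gamma h/2}$, $\beta=e^{-\gamma h}$, $s=h^2(1+\beta)/2$. Let $d\in\{1,2\}$, let $m\ge2$ be an integer, and let $U\in\mathcal U_\kappa^d$. Suppose: (a) there exist an $m$-periodic sequence $(x_j^\circ)_{j\in\mathbb Z}$ in $\mathbb R^d$ with $x_0^\circ,\dots,x_{m-1}^\circ$ distinct, an $m$-periodic sequence $(H_j)_{j\in\mathbb Z}$ of symmetric $d\times d$ matrices, and $r_0>0$ such that, for every $j\in\mathbb Z$, $$x_{j+1}^\circ=(1+\beta)x_j^\circ-\beta x_{j-1}^\circ-s\nabla U(x_j^\circ),\qquad \nabla U(x_j^\circ+u)=\nabla U(x_j^\circ)+H_ju\quad\text{for all }u\in\mathbb R^d,\ |u|\le r_0;$$ (b) the matrices $\mathsf A_j=\begin{pmatrix}(1+\beta)\mathrm{Id}_d-sH_j&-\beta\,\mathrm{Id}_d\\\mathrm{Id}_d&0\end{pmatrix}$ satisfy $\rho(\mathsf A_{m-1}\cdots\mathsf A_0)<1$; (c) there are $\lambda_\ast\in[1,\kappa]$ and $b_\ast>0$ with $\nabla U(x)=\lambda_\ast x+w(x)$ and $\sup_x|w(x)|\le b_\ast$. Then, for $U_R(x)=R^2U(x/R)$ and $Q_R=Q_{h,\gamma}^{U_R}$, there are constants $c_0,C_0>0$, independent of $R$, such that $Q_R$ has a unique invariant law $\pi_R$ and, for every $R\ge1$ and every $j\in\mathbb Z$, at least one of the two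 initial states $z_R^{(j)},z_R^{(j+1)}\in\mathbb R^{2d}$, where $$z_R^{(i)}=\left(Rx_i^\circ,\ r\Bigl(\frac{R(x_i^\circ-x_{i-1}^\circ)}h-\frac h2\nabla U_R(Rx_i^\circ)\Bigr)\right),$$ denoted by $z_R$, satisfies $$W_2(\delta_{z_R},\pi_R)\le C_0(1+R)\qquad\text{and}\qquad \|\delta_{z_R}Q_R^n-\pi_R\|_{\mathrm{TV}}\ge\frac38\quad\text{for all integers }0\le n\le\Bigl\lfloor\frac1{16}e^{c_0R^2}\Bigr\rfloor .$$
   Context: OBABO chain. For a differentiable $U:\mathbb R^d\to\mathbb R$ and $h,\gamma>0$, put $r=e^{-\gamma h/2}$, $\beta=r^2=e^{-\gamma h}$, $\sigma=(1-\beta)^{1/2}$. One OBABO step maps $(x,v)\in\mathbb R^d\times\mathbb R^d$ to $(x^+,v^+)$ by $v^{(a)}=rv+\sigma\xi^{(1)}$, $v^{(b)}=v^{(a)}-\frac h2\nabla U(x)$, $x^+=x+hv^{(b)}$, $v^{(c)}=v^{(b)}-\frac h2\nabla U(x^+)$, $v^+=rv^{(c)}+\sigma\xi^{(2)}$, where $\xi^{(1)},\xi^{(2)}$ are independent $\mathcal N(0,\mathrm{Id}_d)$. Iterating with i.i.d. copies of $(\xi^{(1)},\xi^{(2)})$ defines a Markov chain with transition kernel $Q_{h,\gamma}^U$. $\mathcal U_\kappa^d=\{U\in C^\infty(\mathbb R^d): \mathrm{Id}_d\preceq\nabla^2U(x)\preceq\kappa\,\mathrm{Id}_d\text{ for every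 }x\}$; $\rho(\cdot)$ is the spectral radius; $\|\nu-\widetilde\nu\|_{\mathrm{TV}}=\sup_A|\nu(A)-\widetilde\nu(A)|$; $W_2$ is the Euclidean $2$-Wasserstein distance; $\delta_z$ is the Dirac mass at $z$. *)

theory Defs
  imports "HOL-Probability.Probability"
begin

section \<open>Smooth potentials\<close>

text \<open>\<^term>\<open>Ck k f\<close>: class \<open>C^k\<close> on the whole space, through iterated directional
  derivatives.\<close>

primrec Ck :: "nat \<Rightarrow> ('a::euclidean_space \<Rightarrow> real) \<Rightarrow> bool" where
  "Ck 0 f \<longleftrightarrow> continuous_on UNIV f"
| "Ck (Suc k) f \<longleftrightarrow> (\<forall>x. f differentiable (at x)) \<and> (\<forall>v. Ck k (\<lambda>x. frechet_derivative f (at x) v))"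

definition C_infinity :: "('a::euclidean_space \<Rightarrow> real) \<Rightarrow> bool" where
  "C_infinity f \<longleftrightarrow> (\<forall>k. Ck k f)"

definition grad :: "('a::real_inner \<Rightarrow> real) \<Rightarrow> 'a \<Rightarrow> 'a" where
  "grad f x = (THE D. GDERIV f x :> D)"

definition hessian :: "(real^'d \<Rightarrow> real) \<Rightarrow> real^'d \<Rightarrow> real^'d^'d" where
  "hessian f x = jacobian (grad f) (at x)"

definition loewner_le :: "real^'d^'d \<Rightarrow> real^'d^'d \<Rightarrow> bool" where
  "loewner_le A B \<longleftrightarrow> transpose (B - A) = B - A \<and> (\<forall>v. 0 \<le> v \<bullet> ((B - A) *v v))"

definition potentials :: "real \<Rightarrow> (real^'d \<Rightarrow> real) set" where
  "potentials \<kappa> = {U. C_infinity U \<and>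
     (\<forall>x. loewner_le (mat 1) (hessian U x) \<and> loewner_le (hessian U x) (\<kappa> *\<^sub>R mat 1))}"

definition rescale :: "real \<Rightarrow> ('a::real_vector \<Rightarrow> real) \<Rightarrow> 'a \<Rightarrow> real" where
  "rescale R U x = R\<^sup>2 * U (x /\<^sub>R R)"

section \<open>Matrices\<close>

definition block_matrix ::
    "real^'d^'d \<Rightarrow> real^'d^'d \<Rightarrow> real^'d^'d \<Rightarrow> real^'d^'d \<Rightarrow> real^('d+'d)^('d+'d)" where
  "block_matrix A B C D = (\<chi> i j. case i of
       Inl a \<Rightarrow> (case j of Inl b \<Rightarrow> A $ a $ b | Inr b \<Rightarrow> B $ a $ b)
     | Inr a \<Rightarrow> (case j of Inl b \<Rightarrow> C $ a $ b | Inr b \<Rightarrow> D $ a $ b))"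

text \<open>\<^term>\<open>matrix_chain A m\<close> is \<open>A (m - 1) ** \<dots> ** A 0\<close>, later factors on the left.\<close>

primrec matrix_chain :: "(int \<Rightarrow> real^'n^'n) \<Rightarrow> nat \<Rightarrow> real^'n^'n" where
  "matrix_chain A 0 = mat 1"
| "matrix_chain A (Suc m) = A (int m) ** matrix_chain A m"

text \<open>Spectral radius of a real matrix: supremum of the moduli of its complex eigenvalues
  (a finite nonempty set, so the supremum is the maximum).\<close>

definition spectral_radius :: "real^'n^'n \<Rightarrow> real" where
  "spectral_radius A =
     Sup {cmod \<mu> |\<mu>. \<exists>v::complex^'n. v \<noteq> 0 \<and> map_matrix complex_of_real A *v v = \<mu> *s v}"

section \<open>The OBABO chain\<close>

text \<open>The law \<open>N(0, Id)\<close>: independent standard normal coordinates.\<close>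

definition std_gaussian :: "'a::euclidean_space measure" where
  "std_gaussian = density lborel (\<lambda>x. ennreal (\<Prod>b\<in>Basis. std_normal_density (x \<bullet> b)))"

definition obabo_step ::
    "real \<Rightarrow> real \<Rightarrow> ('a::euclidean_space \<Rightarrow> real) \<Rightarrow> 'a \<times> 'a \<Rightarrow> 'a \<times> 'a \<Rightarrow> 'a \<times> 'a" where
  "obabo_step h \<gamma> U = (\<lambda>(x, v) (\<xi>\<^sub>1, \<xi>\<^sub>2).
     let r = exp (- \<gamma> * h / 2);
         \<beta> = r\<^sup>2;
         \<sigma> = sqrt (1 - \<beta>);
         v\<^sub>a = r *\<^sub>R v + \<sigma> *\<^sub>R \<xi>\<^sub>1;
         v\<^sub>b = v\<^sub>a - (h / 2) *\<^sub>R grad U x;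
         x' = x + h *\<^sub>R v\<^sub>b;
         v\<^sub>c = v\<^sub>b - (h / 2) *\<^sub>R grad U x'
     in (x', r *\<^sub>R v\<^sub>c + \<sigma> *\<^sub>R \<xi>\<^sub>2))"

definition obabo_kernel ::
    "real \<Rightarrow> real \<Rightarrow> ('a::euclidean_space \<Rightarrow> real) \<Rightarrow> 'a \<times> 'a \<Rightarrow> ('a \<times> 'a) measure" where
  "obabo_kernel h \<gamma> U z = distr (std_gaussian \<Otimes>\<^sub>M std_gaussian) borel (obabo_step h \<gamma> U z)"

text \<open>The law \<open>\<nu> Q^n\<close> of the chain after \<open>n\<close> steps from the initial law \<open>\<nu>\<close>.\<close>

definition law_after :: "('z \<Rightarrow> 'z measure) \<Rightarrow> nat \<Rightarrow> 'z measure \<Rightarrow> 'z measure" where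
  "law_after Q n \<nu> = ((\<lambda>\<mu>. \<mu> \<bind> Q) ^^ n) \<nu>"

definition invariant_law :: "('z::topological_space \<Rightarrow> 'z measure) \<Rightarrow> 'z measure \<Rightarrow> bool" where
  "invariant_law Q \<pi> \<longleftrightarrow> prob_space \<pi> \<and> sets \<pi> = sets borel \<and> \<pi> \<bind> Q = \<pi>"

section \<open>Distances between Borel probability measures\<close>

definition tv_dist :: "'z::topological_space measure \<Rightarrow> 'z measure \<Rightarrow> real" where
  "tv_dist \<mu> \<nu> = (SUP A\<in>sets borel. \<bar>measure \<mu> A - measure \<nu> A\<bar>)"

definition couplings :: "'z::topological_space measure \<Rightarrow> 'z measure \<Rightarrow> ('z \<times> 'z) measure set" where
  "couplings \<mu> \<nu> = {\<Gamma>. prob_space \<Gamma> \<and> sets \<Gamma> = sets (borel \<Otimes>\<^sub>M borel) \<and>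
     distr \<Gamma> borel fst = \<mu> \<and> distr \<Gamma> borel snd = \<nu>}"

text \<open>On a product \<open>'a \<times> 'a\<close> of Euclidean spaces, \<^const>\<open>dist\<close> is the Euclidean distance.
  The value is infinite when no coupling has finite quadratic cost.\<close>

definition W2 :: "'z::metric_space measure \<Rightarrow> 'z measure \<Rightarrow> ennreal" where
  "W2 \<mu> \<nu> =
     (let c = (INF \<Gamma>\<in>couplings \<mu> \<nu>. \<integral>\<^sup>+ p. ennreal ((dist (fst p) (snd p))\<^sup>2) \<partial>\<Gamma>)
      in if c = \<infinity> then \<infinity> else ennreal (sqrt (enn2real c)))"

end

theory Submission
  imports Defs "HOL-Computational_Algebra.Fundamental_Theorem_Algebra"
begin

text \<open>Write \<open>y = x - (h/r) v - (h\<^sup>2/2) \<nabla>U(x)\<close> for the position from which the state \<open>(x, v)\<close>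
would have been reached by a step with vanishing second noise vector. In the coordinates \<open>(x, y)\<close> one OBABO step is
\<open>(x, y) \<mapsto> ((1 + \<beta>) x - \<beta> y - s \<nabla>U(x), x)\<close> followed by the addition of
\<open>(h \<sigma> \<xi>\<^sub>1, - (h \<sigma> / r) \<xi>\<^sub>2)\<close>: the noise is additive, Gaussian and non-degenerate. Both halves of
the theorem are read off from this form (\<open>step_position\<close>, \<open>step_prev\<close>).

Invariant law. Since \<open>\<nabla>U_R(x) = \<lambda> x + O(R)\<close>, the step is a bounded perturbation of the linear
recursion with characteristic polynomial \<open>\<mu>\<^sup>2 - (1 + \<beta> - s \<lambda>) \<mu> + \<beta>\<close>. The condition
\<open>h\<^sup>2 \<lambda> < 4\<close> puts both of its roots inside the unit disc, so in a suitable norm the recursion contracts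
and the squared norm is a Lyapunov function. Together with the minorisation that additive Gaussian noise
gives on bounded sets, this yields existence and uniqueness: an invariant law must be a multiple of the
expected occupation measure between two regenerations (\<open>harris_invariant_law\<close>). The drift inequality
bounds the second moment by a constant times \<open>1 + R\<^sup>2\<close> (\<open>invariant_law_second_moment\<close>), and the
coupling of a Dirac mass with the invariant law turns this into the Wasserstein bound.

Slow mixing. After division by \<open>R\<close> the drift no longer depends on \<open>R\<close>, and the noise has size
\<open>1/R\<close>. Near the periodic orbit the dynamics is exactly affine and, by hypothesis (b), stable. In
phase-dependent norms \<open>N\<^sub>k\<close> that decrease along the linearised flow (\<open>adapted_norms_two_step\<close>), the
chain started on the orbit at phase \<open>j\<close> stays in a tube of radius \<open>\<rho>\<close> around the orbit unless some noise
vector has norm above \<open>t R\<close>, an event of probability \<open>p\<close> at most \<open>K exp (- \<alpha> R\<^sup>2)\<close>. The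
chain is therefore predictable for about \<open>exp (c R\<^sup>2)\<close> steps. Two chains started at consecutive phases
remain in disjoint tubes. If both of them were within distance \<open>3/8\<close> of the invariant law at admissible
times, the invariant law would charge each of two tubes with more than one half, and transporting that mass
along the tubes to a common time gives two disjoint sets of total mass above one
(\<open>one_of_two_starts_is_far\<close>).\<close>

section \<open>Orbits of a linear map without eigenvalues outside the open unit disc\<close>

text \<open>Summing the hypothesis over \<open>k < n\<close> bounds the partial sums of \<open>a\<close> by themselves with the factor \<open>q < 1\<close>.\<close>

lemma summable_perturbed_contraction:
  fixes a e :: "nat \<Rightarrow> real"
  assumes a: "\<And>k. 0 \<le> a k" and e: "\<And>k. 0 \<le> e k" and "summable e" and q: "0 \<le> q" "q < 1"
    and step: "\<And>k. a (Suc k) \<le> q * a k + e k"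
  shows "summable a"
proof (rule summableI_nonneg_bounded)
  fix n
  have "(1 - q) * (\<Sum>k<n. a k) \<le> a 0 + suminf e"
  proof -
    have "(\<Sum>k<n. a k) \<le> (\<Sum>k<Suc n. a k)" using a by simp
    also have "\<dots> = a 0 + (\<Sum>k<n. a (Suc k))" by (rule sum.lessThan_Suc_shift)
    also have "(\<Sum>k<n. a (Suc k)) \<le> (\<Sum>k<n. q * a k + e k)" by (intro sum_mono step)
    also have "\<dots> = q * (\<Sum>k<n. a k) + (\<Sum>k<n. e k)" by (simp add: sum.distrib sum_distrib_left)
    also have "(\<Sum>k<n. e k) \<le> suminf e" by (intro sum_le_suminf assms) (auto simp: e)
    finally show ?thesis by (simp add: algebra_simps)
  qed
  then show "(\<Sum>k<n. a k) \<le> (a 0 + suminf e) / (1 - q)"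
    using q by (simp add: field_simps)
qed (rule a)

text \<open>The vector \<open>p(A) v\<close>, evaluated by Horner's scheme.\<close>

definition op_poly :: "complex^'n^'n \<Rightarrow> complex poly \<Rightarrow> complex^'n \<Rightarrow> complex^'n" where
  "op_poly A p v = fold_coeffs (\<lambda>c w. c *s v + A *v w) p 0"

lemma op_poly_0 [simp]: "op_poly A 0 v = 0"
  by (simp add: op_poly_def)

lemma op_poly_pCons [simp]: "op_poly A (pCons c p) v = c *s v + A *v op_poly A p v"
  by (cases "p = 0 \<and> c = 0") (auto simp: op_poly_def)

lemma op_poly_add: "op_poly A (p + q) v = op_poly A p v + op_poly A q v"
  by (induction p q rule: poly_induct2)
    (auto simp: matrix_vector_right_distrib vec.scale_left_distrib)

lemma op_poly_smult: "op_poly A (smult c p) v = c *s op_poly A p v"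
  by (induction p) (auto simp: vector_scalar_commute vec.scale_right_distrib)

lemma op_poly_monom: "op_poly A (monom c n) v = c *s (((*v) A) ^^ n) v"
  by (induction n) (auto simp: monom_0 monom_Suc vector_scalar_commute)

lemma op_poly_linear_factor:
  "op_poly A ([:-\<mu>, 1:] * q) v = A *v op_poly A q v - \<mu> *s op_poly A q v"
proof -
  have "[:-\<mu>, 1:] * q = smult (-\<mu>) q + pCons 0 q" by (simp add: mult_pCons_left)
  then show ?thesis by (simp only: op_poly_add op_poly_smult op_poly_pCons)
      (simp add: vec.scale_minus_left)
qed

lemma op_poly_commute:
  "op_poly A q (A *v v - \<mu> *s v) = A *v op_poly A q v - \<mu> *s op_poly A q v"
proof (induction q)
  case (pCons c q)
  have "op_poly A (pCons c q) (A *v v - \<mu> *s v)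
      = c *s (A *v v - \<mu> *s v) + A *v (A *v op_poly A q v - \<mu> *s op_poly A q v)"
    using pCons by simp
  then show ?case
    by (simp add: matrix_vector_right_distrib matrix_vector_mult_diff_distrib
      vector_scalar_commute vec.scale_right_distrib vec.scale_right_diff_distrib mult.commute)
qed simp

text \<open>The vectors \<open>v, A v, A\<^sup>2 v, \<dots>\<close> live in a finite-dimensional real space. A repetition or a linear
dependence among sufficiently many of them is an annihilating polynomial.\<close>

lemma exists_annihilating_poly:
  fixes A :: "complex^'n^'n"
  shows "\<exists>p. p \<noteq> 0 \<and> op_poly A p v = 0"
proof -
  let ?f = "\<lambda>i. (((*v) A) ^^ i) v"
  let ?I = "{..DIM(complex^'n)}"
  show ?thesis
  proof (cases "inj_on ?f ?I")
    case False
    then obtain i j where ij: "?f i = ?f j" "i \<noteq> j" by (auto simp: inj_on_def)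
    have "op_poly A (monom 1 i + monom (-1) j) v = 0"
      using ij by (simp add: op_poly_add op_poly_monom vec.scale_minus_left)
    moreover have "coeff (monom 1 i + monom (-1) j :: complex poly) i \<noteq> 0"
      using ij by simp
    ultimately show ?thesis by (metis coeff_0)
  next
    case True
    then have "card (?f ` ?I) > DIM(complex^'n)" by (simp add: card_image)
    then have "dependent (?f ` ?I)" using dependent_biggerset_general
      by (metis (no_types, lifting) dependent_biggerset finite_atMost finite_imageI)
    then obtain u where u: "\<exists>x\<in>?f ` ?I. u x \<noteq> 0" "(\<Sum>x\<in>?f ` ?I. u x *\<^sub>R x) = 0"
      by (subst (asm) real_vector.dependent_finite) auto
    then obtain k where k: "k \<in> ?I" "u (?f k) \<noteq> 0" by auto
    define p where "p = (\<Sum>i\<in>?I. monom (complex_of_real (u (?f i))) i)"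
    have op_sum: "op_poly A (\<Sum>i\<in>J. g i) v = (\<Sum>i\<in>J. op_poly A (g i) v)" if "finite J" for J :: "nat set" and g
      using that by induction (auto simp: op_poly_add)
    have "op_poly A p v = (\<Sum>i\<in>?I. complex_of_real (u (?f i)) *s ?f i)"
      by (simp add: p_def op_sum op_poly_monom)
    also have "\<dots> = (\<Sum>i\<in>?I. u (?f i) *\<^sub>R ?f i)"
      by (intro sum.cong refl, simp add: vec_eq_iff) (simp add: scaleR_conv_of_real)
    also have "\<dots> = 0" using u(2) unfolding sum.reindex[OF True] by simp
    finally have "op_poly A p v = 0" .
    moreover have "coeff p k = complex_of_real (u (?f k))"
      using k by (simp add: p_def coeff_sum sum.delta del: atMost_Suc if_distrib)
    then have "p \<noteq> 0" using k by auto
    ultimately show ?thesis by blast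
  qed
qed

text \<open>Induction on the degree, splitting off one complex root \<open>\<mu>\<close> of \<open>p\<close>. If \<open>\<mu>\<close> is not an eigenvalue
then \<open>A - \<mu>\<close> is injective and the factor can be cancelled. Otherwise \<open>|\<mu>| < 1\<close>, the orbit of
\<open>u = (A - \<mu>) v\<close> is summable by induction, and \<open>A\<^sup>k\<^sup>+\<^sup>1 v = \<mu> A\<^sup>k v + A\<^sup>k u\<close> is a contraction perturbed
by a summable sequence.\<close>

lemma summable_orbit_of_annihilated:
  fixes A :: "complex^'n^'n"
  assumes ev: "\<And>\<mu> v. v \<noteq> 0 \<Longrightarrow> A *v v = \<mu> *s v \<Longrightarrow> cmod \<mu> < 1"
    and "p \<noteq> 0" "op_poly A p v = 0"
  shows "summable (\<lambda>k. norm ((((*v) A) ^^ k) v))"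
  using assms(2,3)
proof (induction "degree p" arbitrary: p v)
  case 0
  then obtain c where "p = [:c:]" by (metis degree_0_id)
  with 0 have "v = 0" by (simp add: vec.scale_eq_0_iff)
  moreover have "(((*v) A) ^^ k) 0 = 0" for k by (induction k) auto
  ultimately show ?case by simp
next
  case (Suc n)
  have "\<not> constant (poly p)" using Suc.hyps(2) by (simp add: constant_degree)
  then obtain \<mu> where "poly p \<mu> = 0" using fundamental_theorem_of_algebra by blast
  then obtain q where q: "p = [:-\<mu>, 1:] * q" by (metis poly_eq_0_iff_dvd dvdE)
  with Suc.prems have "q \<noteq> 0" by auto
  with q Suc.hyps(2) have n: "n = degree q"
    using degree_mult_eq[of "[:-\<mu>, 1:]" q] by (simp del: mult_pCons_left)
  show ?case
  proof (cases "\<exists>u. u \<noteq> 0 \<and> A *v u = \<mu> *s u")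
    case True
    then have \<mu>: "cmod \<mu> < 1" using ev by auto
    define u where "u = A *v v - \<mu> *s v"
    have "op_poly A q u = 0"
      using Suc.prems(2) unfolding u_def op_poly_commute q op_poly_linear_factor .
    then have u: "summable (\<lambda>k. norm ((((*v) A) ^^ k) u))"
      using Suc.hyps(1)[OF n \<open>q \<noteq> 0\<close>] by simp
    have it: "(((*v) A) ^^ Suc k) v = \<mu> *s (((*v) A) ^^ k) v + (((*v) A) ^^ k) u" for k
    proof (induction k)
      case (Suc k)
      have "(((*v) A) ^^ Suc (Suc k)) v = A *v ((((*v) A) ^^ Suc k) v)" by simp
      also have "\<dots> = A *v (\<mu> *s (((*v) A) ^^ k) v + (((*v) A) ^^ k) u)" by (simp only: Suc)
      also have "\<dots> = \<mu> *s (((*v) A) ^^ Suc k) v + (((*v) A) ^^ Suc k) u"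
        by (simp add: matrix_vector_right_distrib vector_scalar_commute)
      finally show ?case .
    qed (simp add: u_def)
    have nrm: "norm (\<mu> *s x) = cmod \<mu> * norm x" for x :: "complex^'n"
      by (simp add: norm_vec_def norm_mult L2_set_right_distrib)
    show ?thesis
    proof (rule summable_perturbed_contraction[OF _ _ u _ \<mu>])
      fix k show "norm ((((*v) A) ^^ Suc k) v)
        \<le> cmod \<mu> * norm ((((*v) A) ^^ k) v) + norm ((((*v) A) ^^ k) u)"
        unfolding it by (metis nrm norm_triangle_ineq)
    qed auto
  next
    case False
    have "A *v op_poly A q v = \<mu> *s op_poly A q v"
      using Suc.prems(2) unfolding q op_poly_linear_factor by simp
    with False have "op_poly A q v = 0" by blast
    then show ?thesis using Suc.hyps(1)[OF n \<open>q \<noteq> 0\<close>] by simp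
  qed
qed

text \<open>The moduli of the eigenvalues are bounded by the operator norm, so the supremum is a genuine upper bound.\<close>

lemma spectral_radius_eigenvalue_le:
  fixes A :: "real^'n^'n"
  assumes "v \<noteq> 0" "map_matrix complex_of_real A *v v = \<mu> *s v"
  shows "cmod \<mu> \<le> spectral_radius A"
  unfolding spectral_radius_def
proof (rule cSup_upper)
  have "cmod \<mu> \<le> onorm ((*v) (map_matrix complex_of_real A))"
    if "v \<noteq> 0" "map_matrix complex_of_real A *v v = \<mu> *s v" for \<mu> v
  proof -
    have "norm (\<mu> *s v) = cmod \<mu> * norm v"
      by (simp add: norm_vec_def norm_mult L2_set_right_distrib)
    then have "cmod \<mu> * norm v \<le> onorm ((*v) (map_matrix complex_of_real A)) * norm v"
      using onorm[OF matrix_vector_mul_bounded_linear, of "map_matrix complex_of_real A" v] that by simp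
    then show ?thesis using that by simp
  qed
  then show "bdd_above {cmod \<mu> |\<mu>. \<exists>v. v \<noteq> 0 \<and> map_matrix complex_of_real A *v v = \<mu> *s v}"
    by (auto simp: bdd_above_def)
qed (use assms in auto)

lemma summable_powers_of_stable_matrix:
  fixes A :: "real^'n^'n"
  assumes "\<And>\<mu> v. v \<noteq> 0 \<Longrightarrow> map_matrix complex_of_real A *v v = \<mu> *s v \<Longrightarrow> cmod \<mu> < 1"
  shows "summable (\<lambda>k. norm ((((*v) A) ^^ k) v))"
proof -
  let ?C = "map_matrix complex_of_real A"
  let ?c = "\<lambda>v::real^'n. (\<chi> i. complex_of_real (v $ i))"
  have "?C *v ?c v = ?c (A *v v)" for v
    by (simp add: matrix_vector_mult_def vec_eq_iff map_matrix_def)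
  then have "(((*v) ?C) ^^ k) (?c v) = ?c ((((*v) A) ^^ k) v)" for k
    by (induction k) auto
  moreover have "norm (?c x) = norm x" for x by (simp add: norm_vec_def)
  moreover obtain p where "p \<noteq> 0" "op_poly ?C p (?c v) = 0" using exists_annihilating_poly by blast
  ultimately show ?thesis using summable_orbit_of_annihilated[of ?C p "?c v"] assms by simp
qed

section \<open>Norms adapted to a stable periodic linear recursion\<close>

text \<open>The state after \<open>l\<close> steps of the recursion \<open>e \<mapsto> A k e\<close> that starts with the matrix of phase \<open>k\<close>.\<close>

primrec flow :: "(int \<Rightarrow> real^'n^'n) \<Rightarrow> int \<Rightarrow> nat \<Rightarrow> real^'n \<Rightarrow> real^'n" where
  "flow A k 0 e = e"
| "flow A k (Suc l) e = flow A (k + 1) l (A k *v e)"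

lemma flow_add: "flow A k (i + l) e = flow A (k + int i) l (flow A k i e)"
  by (induction i arbitrary: k e) (auto simp: algebra_simps)

lemma flow_linear: "linear (flow A k l)"
proof (induction l arbitrary: k)
  case (Suc l)
  have "flow A k (Suc l) = flow A (k + 1) l \<circ> ((*v) (A k))" by auto
  then show ?case using linear_compose[OF matrix_vector_mul_linear Suc] by metis
qed (simp add: linear_iff)

lemma flow_eq_matrix_chain: "flow A 0 l e = matrix_chain A l *v e"
proof (induction l)
  case (Suc l)
  have "flow A 0 (Suc l) e = A (int l) *v flow A 0 l e"
    using flow_add[of A 0 l 1 e] by simp
  with Suc show ?case by (simp add: matrix_vector_mul_assoc)
qed simp

lemma flow_periodic:
  assumes "\<And>j. A (j + int m) = A j"
  shows "flow A (k + int (q * m)) l = flow A k l"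
proof -
  have A: "A (j + int (q * m)) = A j" for j
  proof (induction q)
    case (Suc q)
    have "A (j + int (Suc q * m)) = A ((j + int (q * m)) + int m)" by (simp add: algebra_simps)
    with Suc assms show ?case by simp
  qed simp
  show ?thesis
  proof (induction l arbitrary: k)
    case (Suc l)
    show ?case using Suc[of "k + 1"] A[of k] by (auto simp: algebra_simps fun_eq_iff)
  qed auto
qed

text \<open>At phase 0 the flow is grouped into periods, each controlled by a power of the monodromy matrix. Since the
flow from phase \<open>k\<close> is, after its first step, a flow from phase \<open>k + 1\<close>, summability propagates backwards
to all negative phases, and periodicity covers the others.\<close>

lemma summable_flow:
  assumes "m > 0" and per: "\<And>j. A (j + int m) = A j"
    and ev: "\<And>\<mu> v. v \<noteq> 0 \<Longrightarrow> map_matrix complex_of_real (matrix_chain A m) *v v = \<mu> *s v \<Longrightarrow> cmod \<mu> < 1"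
  shows "summable (\<lambda>l. norm (flow A k l e))"
proof -
  let ?M = "matrix_chain A m"
  have pow: "flow A 0 (q * m) e = (((*v) ?M) ^^ q) e" for q e
  proof (induction q)
    case (Suc q)
    have "flow A 0 (Suc q * m) e = flow A (0 + int (q * m)) m (flow A 0 (q * m) e)"
      by (simp only: flow_add[symmetric]) (simp add: algebra_simps)
    also have "\<dots> = ?M *v ((((*v) ?M) ^^ q) e)"
      by (simp only: flow_periodic[where A = A and m = m, OF per] Suc) (simp only: flow_eq_matrix_chain)
    finally show ?case by simp
  qed simp
  have zero: "summable (\<lambda>l. norm (flow A 0 l e))" for e
  proof (rule summableI_nonneg_bounded)
    fix n
    define B where "B = (\<Sum>i<m. onorm (flow A 0 i))"
    have sm: "summable (\<lambda>q. norm ((((*v) ?M) ^^ q) e))"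
      by (rule summable_powers_of_stable_matrix) (rule ev)
    have B: "B \<ge> 0" unfolding B_def
      by (intro sum_nonneg onorm_pos_le linear_conv_bounded_linear[THEN iffD1] flow_linear)
    have blk: "(\<Sum>l\<in>{q * m..<q * m + m}. norm (flow A 0 l e)) \<le> B * norm ((((*v) ?M) ^^ q) e)" for q
    proof -
      have "(\<Sum>l\<in>{q * m..<q * m + m}. norm (flow A 0 l e)) = (\<Sum>i<m. norm (flow A 0 (q * m + i) e))"
        using sum.shift_bounds_nat_ivl[of "\<lambda>l. norm (flow A 0 l e)" 0 "q * m" m]
        by (simp add: add.commute lessThan_atLeast0)
      also have "\<dots> = (\<Sum>i<m. norm (flow A 0 i ((((*v) ?M) ^^ q) e)))"
        by (simp only: flow_add flow_periodic[where A = A and m = m, OF per] pow)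
      also have "\<dots> \<le> (\<Sum>i<m. onorm (flow A 0 i) * norm ((((*v) ?M) ^^ q) e))"
        by (intro sum_mono onorm linear_conv_bounded_linear[THEN iffD1] flow_linear)
      finally show ?thesis by (simp add: B_def sum_distrib_right)
    qed
    have "(\<Sum>l<n. norm (flow A 0 l e)) \<le> (\<Sum>l<n * m. norm (flow A 0 l e))"
      using \<open>m > 0\<close> by (intro sum_mono2) auto
    also have "\<dots> = (\<Sum>q<n. \<Sum>l\<in>{q * m..<q * m + m}. norm (flow A 0 l e))"
      by (rule sum.nat_group[symmetric])
    also have "\<dots> \<le> (\<Sum>q<n. B * norm ((((*v) ?M) ^^ q) e))" by (intro sum_mono blk)
    also have "\<dots> = B * (\<Sum>q<n. norm ((((*v) ?M) ^^ q) e))" by (simp add: sum_distrib_left)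
    also have "\<dots> \<le> B * (\<Sum>q. norm ((((*v) ?M) ^^ q) e))"
      by (intro mult_left_mono B sum_le_suminf sm) auto
    finally show "(\<Sum>l<n. norm (flow A 0 l e)) \<le> B * (\<Sum>q. norm ((((*v) ?M) ^^ q) e))" .
  qed simp
  have neg: "summable (\<lambda>l. norm (flow A (- int i) l e))" for i e
  proof (induction i arbitrary: e)
    case (Suc i)
    have "flow A (- int (Suc i)) (Suc l) e = flow A (- int i) l (A (- int (Suc i)) *v e)" for l
      by (simp add: algebra_simps)
    then have "summable (\<lambda>l. norm (flow A (- int (Suc i)) (Suc l) e))" using Suc by simp
    then show ?case using summable_Suc_iff[of "\<lambda>l. norm (flow A (- int (Suc i)) l e)"] by blast
  qed (use zero in simp)
  obtain q i where "k = - int i + int (q * m)"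
  proof
    have "int (nat \<bar>k\<bar> * m) \<ge> \<bar>k\<bar>" using \<open>m > 0\<close> by (simp add: mult_le_cancel_left1)
    then show "k = - int (nat (int (nat \<bar>k\<bar> * m) - k)) + int (nat \<bar>k\<bar> * m)" by linarith
  qed
  then show ?thesis using neg[of i e] by (simp only: flow_periodic[where A = A and m = m, OF per])
qed

lemma periodic_mod:
  fixes f :: "int \<Rightarrow> 'a"
  assumes "\<And>j. f (j + int m) = f j"
  shows "f k = f (k mod int m)"
proof -
  have up: "f (j + int m * int n) = f j" for j n
  proof (induction n)
    case (Suc n)
    have "f (j + int m * int (Suc n)) = f ((j + int m * int n) + int m)" by (simp add: algebra_simps)
    then show ?case using assms Suc by simp
  qed simp
  have k: "k = k mod int m + int m * (k div int m)" by simp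
  show ?thesis
  proof (cases "k div int m \<ge> 0")
    case True
    then show ?thesis using up[of "k mod int m" "nat (k div int m)"] k by simp
  next
    case False
    then have "k mod int m = k + int m * int (nat (- (k div int m)))" using k by (simp add: algebra_simps)
    then show ?thesis using up[of k "nat (- (k div int m))"] by simp
  qed
qed

text \<open>The norm is \<open>N k e = \<Sum>l. |flow A k l e|\<close>. Removing the first term of the series gives
\<open>N (k + 1) (A k e) = N k e - |e|\<close>, and \<open>|e| \<ge> N k e / C\<close> makes this a contraction by
\<open>1 - 1/C\<close>. The constant is uniform in the phase because there are only finitely many phases.\<close>

lemma adapted_norms:
  fixes A :: "int \<Rightarrow> real^'n^'n"
  assumes "m > 0" and per: "\<And>j. A (j + int m) = A j"
    and ev: "\<And>\<mu> v. v \<noteq> 0 \<Longrightarrow> map_matrix complex_of_real (matrix_chain A m) *v v = \<mu> *s v \<Longrightarrow> cmod \<mu> < 1"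
  obtains N C where "C \<ge> (2::real)"
    "\<And>k e. norm e \<le> N k e" "\<And>k e. N k e \<le> C * norm e"
    "\<And>k x y. N k (x + y) \<le> N k x + N k y"
    "\<And>k e. N (k + 1) (A k *v e) \<le> (1 - 1 / C) * N k e"
    "\<And>k e. N (k + int m) e = N k e"
proof -
  define N where "N k e = (\<Sum>l. norm (flow A k l e))" for k e
  have sm: "summable (\<lambda>l. norm (flow A k l e))" for k e
    using assms by (rule summable_flow)
  have split: "N k e = norm e + N (k + 1) (A k *v e)" for k e
    unfolding N_def using suminf_split_head[OF sm, of k e] by simp
  have N0: "N k e \<ge> 0" for k e unfolding N_def by (intro suminf_nonneg sm) auto
  have add: "N k (x + y) \<le> N k x + N k y" for k x y
    unfolding N_def suminf_add[OF sm sm]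
    by (intro suminf_le sm summable_add) (simp add: linear_add[OF flow_linear] norm_triangle_ineq)
  have scale: "N k (c *\<^sub>R x) = \<bar>c\<bar> * N k x" for k c x
    unfolding N_def by (simp add: linear_scale[OF flow_linear] suminf_mult[OF sm])
  have zero: "N k 0 = 0" for k using scale[of k 0 0] by simp
  have sum: "N k (\<Sum>i\<in>I. g i) \<le> (\<Sum>i\<in>I. N k (g i))" if "finite I" for I g k
    using that
  proof induction
    case (insert i I)
    then show ?case using add[of k "g i" "\<Sum>i\<in>I. g i"] by simp
  qed (simp add: zero)
  define c where "c k = (\<Sum>b\<in>Basis. N k b)" for k
  have c0: "c k \<ge> 0" for k unfolding c_def by (intro sum_nonneg N0)
  have bnd: "N k e \<le> c k * norm e" for k e
  proof -
    have "N k e = N k (\<Sum>b\<in>Basis. (e \<bullet> b) *\<^sub>R b)" by (simp add: euclidean_representation)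
    also have "\<dots> \<le> (\<Sum>b\<in>Basis. N k ((e \<bullet> b) *\<^sub>R b))" by (intro sum) simp
    also have "\<dots> \<le> (\<Sum>b\<in>Basis. norm e * N k b)"
      unfolding scale by (intro sum_mono mult_right_mono N0 Basis_le_norm)
    finally show ?thesis by (simp add: c_def sum_distrib_left mult.commute)
  qed
  have perc: "c k = c (k mod int m)" for k
    by (rule periodic_mod) (use flow_periodic[where A = A and m = m, OF per, of _ 1] in \<open>simp add: c_def N_def\<close>)
  define C where "C = 2 + (\<Sum>k\<in>{0..<int m}. c k)"
  have cC: "c k \<le> C" for k
  proof -
    have "c (k mod int m) \<le> (\<Sum>k\<in>{0..<int m}. c k)"
      using \<open>m > 0\<close> by (intro member_le_sum) (auto simp: c0)
    then show ?thesis using perc[of k] by (simp add: C_def)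
  qed
  have C2: "C \<ge> 2" unfolding C_def using c0 by (simp add: sum_nonneg)
  have NC: "N k e \<le> C * norm e" for k e
    using bnd[of k e] mult_right_mono[OF cC[of k], of "norm e"] by simp
  show thesis
  proof (rule that[OF C2 _ NC add])
    show "norm e \<le> N k e" for k e using split[of k e] N0[of "k + 1" "A k *v e"] by simp
    show "N (k + int m) e = N k e" for k e
      using flow_periodic[where A = A and m = m, OF per, of k 1] by (simp add: N_def)
    show "N (k + 1) (A k *v e) \<le> (1 - 1 / C) * N k e" for k e
    proof -
      have "N k e / C \<le> norm e" using NC[of k e] C2 by (simp add: divide_simps mult.commute)
      moreover have "(1 - 1 / C) * N k e = N k e - N k e / C" by (simp add: left_diff_distrib)
      ultimately show ?thesis using split[of k e] by linarith
    qed
  qed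
qed

text \<open>The vector on which a block matrix acts, as opposed to the pair of its two halves.\<close>

definition stack :: "(real^'d) \<times> (real^'d) \<Rightarrow> real^('d + 'd)" where
  "stack p = (\<chi> i. case i of Inl a \<Rightarrow> fst p $ a | Inr a \<Rightarrow> snd p $ a)"

lemma sum_UNIV_Plus: "(\<Sum>i\<in>UNIV. f i) = (\<Sum>a\<in>UNIV. f (Inl a)) + (\<Sum>a\<in>UNIV. f (Inr a))"
  for f :: "'a::finite + 'b::finite \<Rightarrow> 'c::comm_monoid_add"
  by (simp add: UNIV_Plus_UNIV[symmetric] sum.Plus del: UNIV_Plus_UNIV)

lemma block_matrix_stack:
  "block_matrix A B C D *v stack (x, y) = stack (A *v x + B *v y, C *v x + D *v y)"
  by (auto simp: vec_eq_iff matrix_vector_mult_def stack_def block_matrix_def sum_UNIV_Plus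
      split: sum.split)

lemma norm_stack: "norm (stack p) = norm p"
  by (simp add: norm_vec_def L2_set_def sum_UNIV_Plus stack_def norm_prod_def sum_nonneg)

lemma stack_add: "stack (p + q) = stack p + stack q"
  by (auto simp: stack_def vec_eq_iff split: sum.split)

lemma adapted_norms_two_step:
  fixes B :: "int \<Rightarrow> real^'d^'d"
  assumes "m > 0" and per: "\<And>j. B (j + int m) = B j"
    and ev: "\<And>\<mu> v. v \<noteq> 0 \<Longrightarrow> map_matrix complex_of_real
       (matrix_chain (\<lambda>j. block_matrix (B j) (- \<beta> *\<^sub>R mat 1) (mat 1) 0) m) *v v = \<mu> *s v \<Longrightarrow> cmod \<mu> < 1"
  obtains N C where "C \<ge> (2::real)"
    "\<And>k p. norm p \<le> N k p" "\<And>k p. N k p \<le> C * norm p"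
    "\<And>k p q. N k (p + q) \<le> N k p + N k q"
    "\<And>k x y. N (k + 1) (B k *v x - \<beta> *\<^sub>R y, x) \<le> (1 - 1 / C) * N k (x, y)"
    "\<And>k p. N (k + int m) p = N k p"
proof -
  let ?A = "\<lambda>j. block_matrix (B j) (- \<beta> *\<^sub>R mat 1) (mat 1) 0"
  obtain N C where N: "C \<ge> (2::real)"
    "\<And>k e. norm e \<le> N k e" "\<And>k e. N k e \<le> C * norm e"
    "\<And>k x y. N k (x + y) \<le> N k x + N k y"
    "\<And>k e. N (k + 1) (?A k *v e) \<le> (1 - 1 / C) * N k e"
    "\<And>k e. N (k + int m) e = N k e"
  proof (rule adapted_norms[of m ?A, OF \<open>m > 0\<close>])
    show "?A (j + int m) = ?A j" for j by (simp add: per)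
  qed (use ev in blast)+
  define N' where "N' k p = N k (stack p)" for k p
  show thesis
  proof (rule that[of C N'])
    show "C \<ge> 2" by fact
    show "norm p \<le> N' k p" "N' k p \<le> C * norm p" for k p
      using N(2,3)[where e = "stack p"] by (simp_all add: N'_def norm_stack)
    show "N' k (p + q) \<le> N' k p + N' k q" for k p q
      by (simp add: N'_def stack_add N(4))
    show "N' (k + int m) p = N' k p" for k p by (simp add: N'_def N(6))
    have "(- \<beta> *\<^sub>R mat 1) *v y = - \<beta> *\<^sub>R y" for y :: "real^'d"
      by (metis scaleR_matrix_vector_assoc matrix_vector_mul_lid)
    then have "?A k *v stack (x, y) = stack (B k *v x - \<beta> *\<^sub>R y, x)" for k x y
      unfolding block_matrix_stack by simp
    then show "N' (k + 1) (B k *v x - \<beta> *\<^sub>R y, x) \<le> (1 - 1 / C) * N' k (x, y)" for k x y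
      using N(5)[of k "stack (x, y)"] by (simp add: N'_def)
  qed
qed

text \<open>A non-real root comes with its conjugate, so its squared modulus is \<open>\<beta>\<close>. For a real \<open>a\<close> with
\<open>|a| \<ge> 1\<close> the polynomial is positive, since it exceeds \<open>(|a| - 1) (|a| - \<beta>) \<ge> 0\<close>.\<close>

lemma companion_eigenvalue:
  fixes \<mu> :: complex
  assumes "\<mu>\<^sup>2 - of_real \<tau> * \<mu> + of_real \<beta> = 0" and \<beta>: "0 < \<beta>" "\<beta> < 1" and \<tau>: "\<bar>\<tau>\<bar> < 1 + \<beta>"
  shows "cmod \<mu> < 1"
proof -
  define a b where "a = Re \<mu>" and "b = Im \<mu>"
  have re: "a\<^sup>2 - b\<^sup>2 - \<tau> * a + \<beta> = 0" and im: "2 * a * b - \<tau> * b = 0"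
    using assms(1) by (auto simp: complex_eq_iff a_def b_def power2_eq_square)
  have "a\<^sup>2 + b\<^sup>2 < 1"
  proof (cases "b = 0")
    case False
    then have "\<tau> = 2 * a" using im by (auto simp: algebra_simps)
    then show ?thesis using re \<beta> by (simp add: power2_eq_square)
  next
    case True
    have "\<bar>a\<bar> < 1"
    proof (rule ccontr)
      assume "\<not> ?thesis"
      then have a: "\<bar>a\<bar> \<ge> 1" by simp
      have "\<tau> * a \<le> \<bar>\<tau>\<bar> * \<bar>a\<bar>" by (metis abs_ge_self abs_mult)
      also have "\<dots> < (1 + \<beta>) * \<bar>a\<bar>" using \<tau> a by (intro mult_strict_right_mono) auto
      also have "\<dots> \<le> a\<^sup>2 + \<beta>"
      proof -
        have "0 \<le> (\<bar>a\<bar> - 1) * (\<bar>a\<bar> - \<beta>)" using a \<beta> by simp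
        moreover have "\<bar>a\<bar> * \<bar>a\<bar> = a\<^sup>2" by (simp add: power2_eq_square)
        ultimately show ?thesis by (simp add: algebra_simps)
      qed
      finally show False using re True by simp
    qed
    then show ?thesis using True by (simp add: abs_square_less_1)
  qed
  then show ?thesis by (simp add: cmod_def a_def b_def)
qed

lemma adapted_norm_companion:
  assumes \<beta>: "0 < \<beta>" "\<beta> < 1" and \<tau>: "\<bar>\<tau>\<bar> < 1 + \<beta>"
  obtains N C where "C \<ge> (2::real)"
    "\<And>p. norm p \<le> N p" "\<And>p. N p \<le> C * norm p"
    "\<And>p q. N (p + q) \<le> N p + N q"
    "\<And>x y::real^'d. N (\<tau> *\<^sub>R x - \<beta> *\<^sub>R y, x) \<le> (1 - 1 / C) * N (x, y)"
proof -
  let ?B = "\<lambda>j::int. \<tau> *\<^sub>R mat 1 :: real^'d^'d"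
  let ?M = "block_matrix (\<tau> *\<^sub>R mat 1 :: real^'d^'d) (- \<beta> *\<^sub>R mat 1) (mat 1) 0"
  have ev: "cmod \<mu> < 1"
    if v: "v \<noteq> 0" and e: "map_matrix complex_of_real (matrix_chain (\<lambda>j. ?M) 1) *v v = \<mu> *s v" for \<mu> v
  proof -
    have eq: "map_matrix complex_of_real ?M *v v = \<mu> *s v" using e by simp
    have row: "(\<Sum>j\<in>UNIV. complex_of_real (?M $ i $ j) * v $ j) = \<mu> * v $ i" for i
      using arg_cong[OF eq, of "\<lambda>u. u $ i"] by (simp add: matrix_vector_mult_def map_matrix_def)
    have x: "\<tau> * v $ Inl a - \<beta> * v $ Inr a = \<mu> * v $ Inl a" for a
      using row[of "Inl a"]
      by (simp add: block_matrix_def sum_UNIV_Plus mat_def if_distrib if_distribR sum.delta cong: if_cong)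
    have y: "v $ Inl a = \<mu> * v $ Inr a" for a
      using row[of "Inr a"]
      by (simp add: block_matrix_def sum_UNIV_Plus mat_def if_distrib if_distribR sum.delta cong: if_cong)
    obtain i where "v $ i \<noteq> 0" using v by (auto simp: vec_eq_iff)
    then obtain a where a: "v $ Inr a \<noteq> 0" using y by (cases i) auto
    have "(\<mu>\<^sup>2 - of_real \<tau> * \<mu> + of_real \<beta>) * v $ Inr a = 0"
      using x[of a] y[of a] by (simp add: algebra_simps power2_eq_square)
    then show ?thesis using companion_eigenvalue[OF _ \<beta> \<tau>] a by simp
  qed
  have ev': "cmod \<mu> < 1"
    if "v \<noteq> 0" "map_matrix complex_of_real (matrix_chain (\<lambda>j. block_matrix (?B j) (- \<beta> *\<^sub>R mat 1) (mat 1) 0) 1) *v v = \<mu> *s v"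
    for \<mu> v using ev that by blast
  obtain N C where N: "C \<ge> (2::real)"
    "\<And>k p. norm p \<le> N k p" "\<And>k p. N k p \<le> C * norm p"
    "\<And>k p q. N k (p + q) \<le> N k p + N k q"
    "\<And>k x y. N (k + 1) (?B k *v x - \<beta> *\<^sub>R y, x) \<le> (1 - 1 / C) * N k (x, y)"
    "\<And>k p. N (k + int 1) p = N k p"
    by (rule adapted_norms_two_step[of 1 ?B \<beta>, OF _ _ ev']) blast+
  show thesis
  proof (rule that[of C "N 0"])
    show "N 0 (\<tau> *\<^sub>R x - \<beta> *\<^sub>R y, x) \<le> (1 - 1 / C) * N 0 (x, y)" for x y
      using N(5)[of 0 x y] N(6)[of 0] by (simp add: scaleR_matrix_vector_assoc[symmetric])
  qed (use N in blast)+
qed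

section \<open>Gaussian noise\<close>

definition gaussian_density :: "'a::euclidean_space \<Rightarrow> real" where
  "gaussian_density x = (\<Prod>b\<in>Basis. std_normal_density (x \<bullet> b))"

lemma gaussian_density_pos: "0 < gaussian_density x"
  unfolding gaussian_density_def by (intro prod_pos normal_density_pos) simp

lemma gaussian_density_measurable [measurable]: "gaussian_density \<in> borel_measurable borel"
  unfolding gaussian_density_def by measurable

lemma std_gaussian_eq: "std_gaussian = density lborel (\<lambda>x. ennreal (gaussian_density x))"
  by (simp add: std_gaussian_def gaussian_density_def)

lemma sets_std_gaussian [simp, measurable_cong]: "sets std_gaussian = sets borel"
  by (simp add: std_gaussian_eq)

lemma space_std_gaussian [simp]: "space std_gaussian = UNIV"
  by (simp add: std_gaussian_eq)

lemma gaussian_density_lower_bound: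
  fixes x :: "'a::euclidean_space"
  assumes "norm x \<le> \<rho>"
  shows "std_normal_density \<rho> ^ DIM('a) \<le> gaussian_density x"
proof -
  have "std_normal_density \<rho> \<le> std_normal_density (x \<bullet> b)" if "b \<in> Basis" for b
  proof -
    have "\<bar>x \<bullet> b\<bar> \<le> \<rho>" using Basis_le_norm[OF that, of x] assms by simp
    then have "(x \<bullet> b)\<^sup>2 \<le> \<rho>\<^sup>2" by (simp add: abs_le_square_iff[symmetric])
    then show ?thesis by (simp add: std_normal_density_def divide_right_mono)
  qed
  then have "(\<Prod>b\<in>(Basis::'a set). std_normal_density \<rho>) \<le> gaussian_density x"
    unfolding gaussian_density_def by (intro prod_mono) simp
  then show ?thesis by simp
qed

lemma prob_space_std_gaussian: "prob_space (std_gaussian :: 'a::euclidean_space measure)"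
proof
  have "(\<integral>\<^sup>+x. ennreal (gaussian_density x) \<partial>(lborel :: 'a measure)) =
      (\<integral>\<^sup>+x. (\<Prod>b\<in>Basis. ennreal (std_normal_density (x \<bullet> b))) \<partial>(lborel :: 'a measure))"
    by (simp add: gaussian_density_def prod_ennreal)
  also have "\<dots> = (\<Prod>b\<in>(Basis::'a set). (\<integral>\<^sup>+t. ennreal (std_normal_density t) \<partial>lborel))"
    by (rule nn_integral_lborel_prod) simp_all
  also have "\<dots> = 1"
    using prob_space.emeasure_space_1[OF prob_space_normal_density[of 1 0]]
    by (simp add: emeasure_density)
  finally show "emeasure (std_gaussian :: 'a measure) (space std_gaussian) = 1"
    by (simp add: std_gaussian_eq emeasure_density)
qed

text \<open>The weight \<open>exp (t\<^sup>2/4)\<close> turns the standard normal density into \<open>sqrt 2\<close> times the centred normal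
density of variance 2, coordinate by coordinate. This moment gives both the tail bound and the second moment
below.\<close>

lemma gaussian_exp_moment:
  "(\<integral>\<^sup>+x. ennreal (exp ((norm x)\<^sup>2 / 4)) \<partial>(std_gaussian :: 'a::euclidean_space measure))
    = ennreal (sqrt 2 ^ DIM('a))"
proof -
  have one: "std_normal_density t * exp (t\<^sup>2 / 4) = sqrt 2 * normal_density 0 (sqrt 2) t" for t
  proof -
    have "exp (- t\<^sup>2 / 2) * exp (t\<^sup>2 / 4) = exp (- t\<^sup>2 / 4)" by (simp add: exp_add[symmetric])
    then show ?thesis
      by (simp add: std_normal_density_def normal_density_def real_sqrt_mult field_simps)
  qed
  have "(norm x)\<^sup>2 = (\<Sum>b\<in>Basis. (x \<bullet> b)\<^sup>2)" for x :: 'a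
    by (subst power2_norm_eq_inner, subst euclidean_inner) (simp add: power2_eq_square)
  then have "exp ((norm x)\<^sup>2 / 4) = (\<Prod>b\<in>Basis. exp ((x \<bullet> b)\<^sup>2 / 4))" for x :: 'a
    by (simp add: exp_sum[symmetric] sum_divide_distrib)
  then have "gaussian_density x * exp ((norm x)\<^sup>2 / 4)
      = (\<Prod>b\<in>Basis. sqrt 2 * normal_density 0 (sqrt 2) (x \<bullet> b))" for x :: 'a
    by (simp add: gaussian_density_def prod.distrib[symmetric] one)
  then have eq: "ennreal (gaussian_density x) * ennreal (exp ((norm x)\<^sup>2 / 4))
      = (\<Prod>b\<in>Basis. ennreal (sqrt 2 * normal_density 0 (sqrt 2) (x \<bullet> b)))" for x :: 'a
    by (simp add: prod_ennreal ennreal_mult[symmetric] gaussian_density_pos less_imp_le)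
  have "(\<integral>\<^sup>+x. ennreal (exp ((norm x)\<^sup>2 / 4)) \<partial>(std_gaussian :: 'a measure))
      = (\<integral>\<^sup>+x. (\<Prod>b\<in>Basis. ennreal (sqrt 2 * normal_density 0 (sqrt 2) (x \<bullet> b))) \<partial>(lborel :: 'a measure))"
    by (simp add: std_gaussian_eq nn_integral_density eq)
  also have "\<dots> = (\<Prod>b\<in>(Basis::'a set). (\<integral>\<^sup>+t. ennreal (sqrt 2 * normal_density 0 (sqrt 2) t) \<partial>lborel))"
    by (rule nn_integral_lborel_prod) simp_all
  also have "(\<integral>\<^sup>+t. ennreal (sqrt 2 * normal_density 0 (sqrt 2) t) \<partial>lborel) = ennreal (sqrt 2)"
    using prob_space.emeasure_space_1[OF prob_space_normal_density[of "sqrt 2" 0]]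
    by (simp add: emeasure_density ennreal_mult nn_integral_cmult)
  finally show ?thesis by (simp add: ennreal_power)
qed

lemma gaussian_second_moment:
  "(\<integral>\<^sup>+x. ennreal ((norm x)\<^sup>2) \<partial>(std_gaussian :: 'a::euclidean_space measure))
    \<le> ennreal (4 * sqrt 2 ^ DIM('a))"
proof -
  have "(\<integral>\<^sup>+x. ennreal ((norm x)\<^sup>2) \<partial>(std_gaussian :: 'a measure))
    \<le> (\<integral>\<^sup>+x. ennreal 4 * ennreal (exp ((norm x)\<^sup>2 / 4)) \<partial>(std_gaussian :: 'a measure))"
  proof (rule nn_integral_mono)
    fix x :: 'a
    have "(norm x)\<^sup>2 / 4 \<le> exp ((norm x)\<^sup>2 / 4)" using exp_ge_add_one_self[of "(norm x)\<^sup>2 / 4"] by linarith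
    then have "(norm x)\<^sup>2 \<le> 4 * exp ((norm x)\<^sup>2 / 4)" by simp
    then show "ennreal ((norm x)\<^sup>2) \<le> ennreal 4 * ennreal (exp ((norm x)\<^sup>2 / 4))"
      by (subst ennreal_mult[symmetric]) (auto intro: ennreal_leI)
  qed
  also have "\<dots> = ennreal (4 * sqrt 2 ^ DIM('a))"
    by (simp add: nn_integral_cmult gaussian_exp_moment ennreal_mult)
  finally show ?thesis .
qed

lemma gaussian_tail:
  assumes "t \<ge> 0"
  shows "measure (std_gaussian :: 'a::euclidean_space measure) {x. norm x > t}
    \<le> sqrt 2 ^ DIM('a) * exp (- t\<^sup>2 / 4)"
proof -
  interpret prob_space "std_gaussian :: 'a measure" by (rule prob_space_std_gaussian)
  have "emeasure (std_gaussian :: 'a measure) {x. norm x > t}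
      = (\<integral>\<^sup>+x. indicator {x. norm x > t} x \<partial>(std_gaussian :: 'a measure))" by simp
  also have "\<dots> \<le> (\<integral>\<^sup>+x. ennreal (exp (- t\<^sup>2 / 4)) * ennreal (exp ((norm x)\<^sup>2 / 4)) \<partial>(std_gaussian :: 'a measure))"
  proof (rule nn_integral_mono)
    fix x :: 'a
    show "indicator {x. norm x > t} x \<le> ennreal (exp (- t\<^sup>2 / 4)) * ennreal (exp ((norm x)\<^sup>2 / 4))"
    proof (cases "norm x > t")
      case True
      then have "t\<^sup>2 \<le> (norm x)\<^sup>2" using assms by (intro power_mono) auto
      then have "1 \<le> exp (- t\<^sup>2 / 4) * exp ((norm x)\<^sup>2 / 4)" by (simp add: exp_add[symmetric])
      then show ?thesis using True by (simp add: ennreal_mult[symmetric])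
    qed simp
  qed
  also have "\<dots> = ennreal (exp (- t\<^sup>2 / 4) * sqrt 2 ^ DIM('a))"
    by (simp add: nn_integral_cmult gaussian_exp_moment ennreal_mult)
  finally show ?thesis
    by (simp add: emeasure_eq_measure mult.commute)
qed

abbreviation noise :: "('a::euclidean_space \<times> 'a) measure" where
  "noise \<equiv> std_gaussian \<Otimes>\<^sub>M std_gaussian"

lemma sets_noise [simp, measurable_cong]: "sets (noise :: ('a::euclidean_space \<times> 'a) measure) = sets borel"
  by (simp add: borel_prod[symmetric] cong: sets_pair_measure_cong)

lemma space_noise [simp]: "space (noise :: ('a::euclidean_space \<times> 'a) measure) = UNIV"
  by (simp add: space_pair_measure)

lemma prob_space_noise: "prob_space (noise :: ('a::euclidean_space \<times> 'a) measure)"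
proof -
  interpret pair_prob_space "std_gaussian :: 'a measure" "std_gaussian :: 'a measure"
    unfolding pair_prob_space_def pair_sigma_finite_def
    by (simp add: prob_space_std_gaussian prob_space_imp_sigma_finite)
  show ?thesis by unfold_locales
qed

lemma noise_density:
  "(noise :: ('a::euclidean_space \<times> 'a) measure)
    = density lborel (\<lambda>\<xi>. ennreal (gaussian_density (fst \<xi>) * gaussian_density (snd \<xi>)))"
proof -
  have "(noise :: ('a \<times> 'a) measure) = density (lborel \<Otimes>\<^sub>M lborel)
      (\<lambda>(x, y). ennreal (gaussian_density x) * ennreal (gaussian_density y))"
    unfolding std_gaussian_eq
    by (intro pair_measure_density)
      (auto simp: std_gaussian_eq[symmetric] prob_space_std_gaussian prob_space_imp_sigma_finite
        intro: lborel.sigma_finite_measure_axioms)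
  then show ?thesis
    by (simp add: lborel_prod ennreal_mult gaussian_density_pos less_imp_le case_prod_beta')
qed

lemma measurable_noise_kernel:
  fixes f :: "'b::topological_space \<Rightarrow> 'a::euclidean_space \<times> 'a \<Rightarrow> 'c::topological_space"
  assumes f: "case_prod f \<in> borel \<Otimes>\<^sub>M borel \<rightarrow>\<^sub>M borel"
  shows "(\<lambda>z. distr noise borel (f z)) \<in> borel \<rightarrow>\<^sub>M prob_algebra borel"
proof (rule measurable_prob_algebraI)
  fix z :: 'b
  have "f z \<in> borel \<rightarrow>\<^sub>M borel" using measurable_Pair2[OF f, of z] by simp
  then have "f z \<in> noise \<rightarrow>\<^sub>M borel" using measurable_cong_sets[OF sets_noise refl] by blast
  then show "prob_space (distr noise borel (f z))" by (rule prob_space.prob_space_distr[OF prob_space_noise])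
next
  have "(noise :: ('a \<times> 'a) measure) \<in> space (subprob_algebra borel)"
    unfolding space_subprob_algebra using prob_space_noise prob_space_imp_subprob_space sets_noise by blast
  then show "(\<lambda>z. distr noise borel (f z)) \<in> borel \<rightarrow>\<^sub>M subprob_algebra borel"
    by (intro measurable_distr2[where M = borel] f measurable_const)
qed

lemma noise_ball:
  assumes "t \<ge> 0"
  shows "measure (noise :: ('a::euclidean_space \<times> 'a) measure) {\<xi>. norm (fst \<xi>) \<le> t \<and> norm (snd \<xi>) \<le> t}
    \<ge> 1 - 2 * sqrt 2 ^ DIM('a) * exp (- t\<^sup>2 / 4)"
proof -
  interpret G: prob_space "std_gaussian :: 'a measure" by (rule prob_space_std_gaussian)
  interpret N: prob_space "noise :: ('a \<times> 'a) measure" by (rule prob_space_noise)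
  let ?B = "{x::'a. norm x \<le> t}" and ?T = "{x::'a. norm x > t}"
  have "{\<xi>. norm (fst \<xi>) \<le> t \<and> norm (snd \<xi>) \<le> t} = UNIV - (?T \<times> UNIV \<union> UNIV \<times> ?T)" by auto
  moreover have "measure (noise :: ('a \<times> 'a) measure) (?T \<times> UNIV \<union> UNIV \<times> ?T)
      \<le> measure noise (?T \<times> (UNIV::'a set)) + measure noise ((UNIV::'a set) \<times> ?T)"
    by (intro measure_Un_le) (auto intro!: pair_measureI simp del: sets_noise)
  moreover have "measure noise (?T \<times> (UNIV::'a set)) = measure std_gaussian ?T"
    "measure noise ((UNIV::'a set) \<times> ?T) = measure std_gaussian ?T"
    using G.emeasure_space_1 by (simp_all add: measure_def G.emeasure_pair_measure_Times)
  moreover have "?T \<times> UNIV \<union> UNIV \<times> ?T \<in> sets (noise :: ('a \<times> 'a) measure)"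
    by (intro sets.Un) (auto intro!: pair_measureI simp del: sets_noise)
  ultimately show ?thesis
    using gaussian_tail[OF assms, where 'a = 'a] N.prob_compl[of "?T \<times> UNIV \<union> UNIV \<times> ?T"] by simp
qed

section \<open>Invariant laws of kernels with a small set\<close>

text \<open>The kernel is split as \<open>Q z = P z + 1\<^sub>C(z) \<nu>\<close>: from the small set \<open>C\<close> the chain regenerates with
law proportional to \<open>\<nu>\<close>, and \<open>P\<close> is the motion without regeneration. The drift condition bounds
the total \<open>V\<close>-mass of the excursion measure \<open>\<mu> = \<Sum>n. \<nu> P\<^sup>n\<close> by \<open>\<integral> W d\<nu>\<close>.
Conservation of mass then forces \<open>\<mu> C = 1\<close>, so that \<open>\<mu> Q = \<mu>\<close>. Conversely, iterating the splitting
in \<open>\<pi>' = \<pi>' Q\<close> gives \<open>\<pi>' = \<pi>' P\<^sup>n + \<pi>'(C) \<Sum>k<n. \<nu> P\<^sup>k\<close>, and the first term vanishes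
in the limit because the drift makes \<open>P\<^sup>n 1\<close> summable pointwise.\<close>

lemma harris_invariant_law:
  fixes S :: "'a measure" and Q P :: "'a \<Rightarrow> 'a measure" and \<nu> :: "'a measure" and V W :: "'a \<Rightarrow> ennreal"
  assumes Q[measurable]: "Q \<in> S \<rightarrow>\<^sub>M subprob_algebra S"
    and P[measurable]: "P \<in> S \<rightarrow>\<^sub>M subprob_algebra S"
    and Q_prob: "\<And>z. z \<in> space S \<Longrightarrow> emeasure (Q z) (space S) = 1"
    and \<nu>: "subprob_space \<nu>" "sets \<nu> = sets S" "emeasure \<nu> (space S) \<noteq> 0"
    and C[measurable]: "C \<in> sets S"
    and split: "\<And>f z. f \<in> borel_measurable S \<Longrightarrow> z \<in> space S \<Longrightarrow>
      (\<integral>\<^sup>+y. f y \<partial>Q z) = (\<integral>\<^sup>+y. f y \<partial>P z) + indicator C z * (\<integral>\<^sup>+y. f y \<partial>\<nu>)"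
    and V[measurable]: "V \<in> borel_measurable S" and W[measurable]: "W \<in> borel_measurable S"
    and V1: "\<And>z. z \<in> space S \<Longrightarrow> 1 \<le> V z"
    and W_fin: "\<And>z. z \<in> space S \<Longrightarrow> W z < \<infinity>" and \<nu>W: "(\<integral>\<^sup>+z. W z \<partial>\<nu>) < \<infinity>"
    and drift: "\<And>z. z \<in> space S \<Longrightarrow> (\<integral>\<^sup>+y. W y \<partial>P z) + V z \<le> W z"
  shows "\<exists>\<pi>. prob_space \<pi> \<and> sets \<pi> = sets S \<and> \<pi> \<bind> Q = \<pi> \<and> (\<integral>\<^sup>+z. V z \<partial>\<pi>) < \<infinity> \<and>
    (\<forall>\<pi>'. prob_space \<pi>' \<and> sets \<pi>' = sets S \<and> \<pi>' \<bind> Q = \<pi>' \<longrightarrow> \<pi>' = \<pi>)"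
proof -
  note \<nu>(2)[measurable_cong]
  have space_\<nu>: "space \<nu> = space S" using \<nu>(2) by (rule sets_eq_imp_space_eq)
  have S_ne: "space S \<noteq> {}" using \<nu>(3) by auto
  define L where "L f z = (\<integral>\<^sup>+y. f y \<partial>P z)" for f :: "'a \<Rightarrow> ennreal" and z
  have L_meas: "L f \<in> borel_measurable S" if [measurable]: "f \<in> borel_measurable S" for f
    unfolding L_def by measurable
  have Ln_meas[measurable]: "(L ^^ n) f \<in> borel_measurable S" if "f \<in> borel_measurable S" for n f
    using that by (induction n) (auto intro: L_meas)
  have P_space: "space (P z) = space S" "sets (P z) = sets S" if "z \<in> space S" for z
    using measurable_space[OF P that] by (auto simp: space_subprob_algebra dest: sets_eq_imp_space_eq)
  have L_mono: "L f z \<le> L g z" if "\<And>y. y \<in> space S \<Longrightarrow> f y \<le> g y" "z \<in> space S" for f g z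
    unfolding L_def using that P_space by (intro nn_integral_mono) auto

  have sum_le: "(\<Sum>k<n. (L ^^ k) V z) \<le> W z" if "z \<in> space S" for n z
    using that
  proof (induction n arbitrary: z)
    case (Suc n)
    have "(\<Sum>k<Suc n. (L ^^ k) V z) = V z + (\<Sum>k<n. L ((L ^^ k) V) z)"
      by (simp add: sum.lessThan_Suc_shift del: sum.lessThan_Suc)
    also have "(\<Sum>k<n. L ((L ^^ k) V) z) = L (\<lambda>y. \<Sum>k<n. (L ^^ k) V y) z"
      unfolding L_def using Suc.prems P_space
      by (intro nn_integral_sum[symmetric]) (auto simp: L_def[symmetric] cong: measurable_cong_sets)
    also have "\<dots> \<le> L W z" using Suc by (intro L_mono)
    finally show ?case using drift[OF Suc.prems] by (auto simp: L_def add.commute intro: order_trans)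
  qed simp

  define it where "it = (\<lambda>n. ((\<lambda>\<mu>. \<mu> \<bind> P) ^^ n) \<nu>)"
  have it: "sets (it n) = sets S \<and> subprob_space (it n) \<and>
      (\<forall>f\<in>borel_measurable S. (\<integral>\<^sup>+y. f y \<partial>it n) = (\<integral>\<^sup>+y. (L ^^ n) f y \<partial>\<nu>))" for n
  proof (induction n)
    case (Suc n)
    then have [measurable_cong]: "sets (it n) = sets S" and sp: "space (it n) = space S"
      by (auto dest: sets_eq_imp_space_eq)
    have S': "it (Suc n) = it n \<bind> P" by (simp add: it_def)
    have P': "P \<in> it n \<rightarrow>\<^sub>M subprob_algebra S" by measurable
    show ?case unfolding S'
    proof (intro conjI ballI)
      show "sets (it n \<bind> P) = sets S" using P_space sp S_ne by (intro sets_bind) auto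
      show "subprob_space (it n \<bind> P)" using Suc P' by (intro subprob_space_bind[where N = S]) auto
      fix f :: "'a \<Rightarrow> ennreal" assume f: "f \<in> borel_measurable S"
      have "(\<integral>\<^sup>+y. f y \<partial>(it n \<bind> P)) = (\<integral>\<^sup>+z. L f z \<partial>it n)"
        unfolding L_def by (rule nn_integral_bind[OF f P'])
      also have "\<dots> = (\<integral>\<^sup>+y. (L ^^ n) (L f) y \<partial>\<nu>)" using Suc L_meas[OF f] by auto
      finally show "(\<integral>\<^sup>+y. f y \<partial>(it n \<bind> P)) = (\<integral>\<^sup>+y. (L ^^ Suc n) f y \<partial>\<nu>)" by (simp add: funpow_swap1)
    qed
  qed (use \<nu> in \<open>simp add: it_def\<close>)

  define \<mu> where "\<mu> = count_space (UNIV :: nat set) \<bind> it"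
  have it_meas: "it \<in> count_space UNIV \<rightarrow>\<^sub>M subprob_algebra S"
    using it by (auto simp: space_subprob_algebra)
  have sets_\<mu>[measurable_cong]: "sets \<mu> = sets S" unfolding \<mu>_def using it by (intro sets_bind) auto
  then have space_\<mu>: "space \<mu> = space S" by (rule sets_eq_imp_space_eq)
  have \<mu>_int: "(\<integral>\<^sup>+y. f y \<partial>\<mu>) = (\<Sum>k. \<integral>\<^sup>+y. (L ^^ k) f y \<partial>\<nu>)" if f: "f \<in> borel_measurable S" for f
    unfolding \<mu>_def nn_integral_bind[OF f it_meas] using it f by (simp add: nn_integral_count_space_nat)
  have \<mu>_C: "(\<integral>\<^sup>+z. indicator C z * c \<partial>\<mu>) = emeasure \<mu> C * c" for c
    by (simp add: nn_integral_multc)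
  have \<mu>V: "(\<integral>\<^sup>+y. V y \<partial>\<mu>) < \<infinity>"
  proof -
    have "(\<Sum>k<n. \<integral>\<^sup>+y. (L ^^ k) V y \<partial>\<nu>) \<le> (\<integral>\<^sup>+y. W y \<partial>\<nu>)" for n
      by (subst nn_integral_sum[symmetric])
        (auto intro!: nn_integral_mono sum_le simp: space_\<nu>)
    then have "(\<Sum>k. \<integral>\<^sup>+y. (L ^^ k) V y \<partial>\<nu>) \<le> (\<integral>\<^sup>+y. W y \<partial>\<nu>)"
      by (intro suminf_le_const summableI)
    then show ?thesis using \<mu>_int[OF V] \<nu>W by (auto intro: le_less_trans)
  qed
  have \<mu>_fin: "emeasure \<mu> (space S) < \<infinity>"
  proof -
    have "emeasure \<mu> (space S) = (\<integral>\<^sup>+y. 1 \<partial>\<mu>)" by (simp add: space_\<mu>)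
    also have "\<dots> \<le> (\<integral>\<^sup>+y. V y \<partial>\<mu>)" using V1 by (intro nn_integral_mono) (auto simp: space_\<mu>)
    finally show ?thesis using \<mu>V by (auto intro: le_less_trans)
  qed
  have \<mu>_head: "(\<integral>\<^sup>+y. f y \<partial>\<mu>) = (\<integral>\<^sup>+y. f y \<partial>\<nu>) + (\<integral>\<^sup>+z. L f z \<partial>\<mu>)"
    if f[measurable]: "f \<in> borel_measurable S" for f
  proof -
    have "(\<integral>\<^sup>+y. f y \<partial>\<mu>) = (\<integral>\<^sup>+y. (L ^^ 0) f y \<partial>\<nu>) + (\<Sum>k. \<integral>\<^sup>+y. (L ^^ Suc k) f y \<partial>\<nu>)"
      unfolding \<mu>_int[OF f]
      using suminf_offset[of "\<lambda>k. \<integral>\<^sup>+y. (L ^^ k) f y \<partial>\<nu>" 1, OF summableI] by (simp add: add.commute)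
    also have "(\<Sum>k. \<integral>\<^sup>+y. (L ^^ Suc k) f y \<partial>\<nu>) = (\<integral>\<^sup>+z. L f z \<partial>\<mu>)"
      by (subst \<mu>_int[OF L_meas[OF f]]) (simp add: funpow_swap1)
    finally show ?thesis by simp
  qed
  have Q_int: "(\<integral>\<^sup>+z. (\<integral>\<^sup>+y. f y \<partial>Q z) \<partial>\<eta>) = (\<integral>\<^sup>+z. L f z \<partial>\<eta>) + emeasure \<eta> C * (\<integral>\<^sup>+y. f y \<partial>\<nu>)"
    if f: "f \<in> borel_measurable S" and \<eta>[measurable_cong]: "sets \<eta> = sets S" for f \<eta>
  proof -
    have [measurable]: "L f \<in> borel_measurable \<eta>" using L_meas[OF f] by measurable
    have "(\<integral>\<^sup>+z. (\<integral>\<^sup>+y. f y \<partial>Q z) \<partial>\<eta>) = (\<integral>\<^sup>+z. L f z + indicator C z * (\<integral>\<^sup>+y. f y \<partial>\<nu>) \<partial>\<eta>)"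
      using sets_eq_imp_space_eq[OF \<eta>] by (intro nn_integral_cong) (simp add: split[OF f] L_def)
    also have "\<dots> = (\<integral>\<^sup>+z. L f z \<partial>\<eta>) + emeasure \<eta> C * (\<integral>\<^sup>+y. f y \<partial>\<nu>)"
      by (subst nn_integral_add) (auto simp: nn_integral_multc)
    finally show ?thesis .
  qed
  have \<mu>C1: "emeasure \<mu> C = 1"
  proof -
    let ?I = "\<integral>\<^sup>+z. L (\<lambda>_. 1) z \<partial>\<mu>"
    have "(\<integral>\<^sup>+z. (\<integral>\<^sup>+y. 1 \<partial>Q z) \<partial>\<mu>) = (\<integral>\<^sup>+z. 1 \<partial>\<mu>)"
    proof (rule nn_integral_cong)
      fix z assume "z \<in> space \<mu>"
      then have z: "z \<in> space S" by (simp add: space_\<mu>)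
      then have "space (Q z) = space S"
        using measurable_space[OF Q z] by (auto simp: space_subprob_algebra dest: sets_eq_imp_space_eq)
      then show "(\<integral>\<^sup>+y. 1 \<partial>Q z) = (1::ennreal)" using Q_prob[OF z] by simp
    qed
    then have "?I + emeasure \<mu> C * emeasure \<nu> (space S) = ?I + emeasure \<nu> (space S)"
      using Q_int[of "\<lambda>_. 1" \<mu>] \<mu>_head[of "\<lambda>_. 1"] sets_\<mu> by (simp add: space_\<nu> add.commute)
    moreover have "?I < \<infinity>"
      using \<mu>_head[of "\<lambda>_. 1"] \<mu>_fin by (simp add: space_\<mu> less_top[symmetric])
    ultimately have "emeasure \<mu> C * emeasure \<nu> (space S) = 1 * emeasure \<nu> (space S)"
      by (simp add: ennreal_add_left_cancel less_top[symmetric])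
    then have "emeasure \<nu> (space S) * emeasure \<mu> C = emeasure \<nu> (space S) * 1" by (simp add: mult.commute)
    then show ?thesis
      using \<nu>(3) subprob_space.emeasure_space_le_1[OF \<nu>(1)]
      by (subst (asm) ennreal_mult_cancel_left) (auto simp: space_\<nu> top_unique)
  qed
  have \<mu>_inv: "(\<integral>\<^sup>+z. (\<integral>\<^sup>+y. f y \<partial>Q z) \<partial>\<mu>) = (\<integral>\<^sup>+y. f y \<partial>\<mu>)" if "f \<in> borel_measurable S" for f
    using Q_int[OF that sets_\<mu>] \<mu>_head[OF that] \<mu>C1 by (simp add: add.commute)
  have \<mu>_pos: "emeasure \<mu> (space S) \<noteq> 0" using \<mu>C1 emeasure_mono[of C "space S" \<mu>] sets.sets_into_space[OF C]
    by (auto simp: sets_\<mu>)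

  define \<pi> where "\<pi> = scale_measure (inverse (emeasure \<mu> (space S))) \<mu>"
  have sets_\<pi>[measurable_cong]: "sets \<pi> = sets S" by (simp add: \<pi>_def sets_\<mu>)
  have \<pi>_int: "(\<integral>\<^sup>+y. f y \<partial>\<pi>) = inverse (emeasure \<mu> (space S)) * (\<integral>\<^sup>+y. f y \<partial>\<mu>)"
    if "f \<in> borel_measurable S" for f
    unfolding \<pi>_def using that by (intro nn_integral_scale_measure) simp
  have inv_fin: "inverse (emeasure \<mu> (space S)) < \<infinity>" using \<mu>_pos by (simp add: less_top[symmetric])
  have inv: "emeasure \<mu> (space S) * inverse (emeasure \<mu> (space S)) = 1"
    using ennreal_divide_self[OF \<mu>_pos] \<mu>_fin by (simp add: divide_ennreal_def)
  have "prob_space \<pi>"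
  proof
    show "emeasure \<pi> (space \<pi>) = 1"
      using inv by (simp add: \<pi>_def space_scale_measure space_\<mu> mult.commute)
  qed
  moreover have "\<pi> \<bind> Q = \<pi>"
  proof (rule measure_eqI)
    have sp: "space \<pi> \<noteq> {}" using S_ne sets_eq_imp_space_eq[OF sets_\<pi>] by simp
    have Q': "Q \<in> \<pi> \<rightarrow>\<^sub>M subprob_algebra S" by measurable
    show sets: "sets (\<pi> \<bind> Q) = sets \<pi>"
      using sets_bind[of \<pi> Q S] sets_kernel[OF Q'] sp sets_\<pi> by simp
    fix A assume "A \<in> sets (\<pi> \<bind> Q)"
    then have A: "A \<in> sets S" by (simp add: sets sets_\<pi>)
    have QA: "(\<lambda>z. emeasure (Q z) A) \<in> borel_measurable S" using A by measurable
    have "emeasure (\<pi> \<bind> Q) A = (\<integral>\<^sup>+z. emeasure (Q z) A \<partial>\<pi>)" by (rule emeasure_bind[OF sp Q' A])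
    also have "\<dots> = inverse (emeasure \<mu> (space S)) * (\<integral>\<^sup>+z. emeasure (Q z) A \<partial>\<mu>)" by (rule \<pi>_int[OF QA])
    also have "(\<integral>\<^sup>+z. emeasure (Q z) A \<partial>\<mu>) = (\<integral>\<^sup>+z. (\<integral>\<^sup>+y. indicator A y \<partial>Q z) \<partial>\<mu>)"
      using A sets_kernel[OF Q] by (intro nn_integral_cong) (simp add: space_\<mu>)
    also have "\<dots> = (\<integral>\<^sup>+y. indicator A y \<partial>\<mu>)" using A by (intro \<mu>_inv borel_measurable_indicator)
    also have "\<dots> = emeasure \<mu> A" using A by (simp add: sets_\<mu>)
    finally show "emeasure (\<pi> \<bind> Q) A = emeasure \<pi> A" by (simp add: \<pi>_def)
  qed
  moreover have "(\<integral>\<^sup>+z. V z \<partial>\<pi>) < \<infinity>"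
    using \<mu>V inv_fin by (simp add: \<pi>_int ennreal_mult_less_top)
  moreover have "\<pi>' = \<pi>" if \<pi>': "prob_space \<pi>'" "sets \<pi>' = sets S" "\<pi>' \<bind> Q = \<pi>'" for \<pi>'
  proof -
    interpret \<pi>': prob_space \<pi>' by fact
    note \<pi>'(2)[measurable_cong]
    have sp': "space \<pi>' = space S" using \<pi>'(2) by (rule sets_eq_imp_space_eq)
    have Q': "Q \<in> \<pi>' \<rightarrow>\<^sub>M subprob_algebra S" by measurable
    have one: "(\<integral>\<^sup>+y. f y \<partial>\<pi>') = (\<integral>\<^sup>+z. L f z \<partial>\<pi>') + emeasure \<pi>' C * (\<integral>\<^sup>+y. f y \<partial>\<nu>)"
      if f: "f \<in> borel_measurable S" for f
      using nn_integral_bind[OF f Q'] Q_int[OF f \<pi>'(2)] \<pi>'(3) by simp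
    have expand: "(\<integral>\<^sup>+y. f y \<partial>\<pi>') = (\<integral>\<^sup>+z. (L ^^ n) f z \<partial>\<pi>')
        + emeasure \<pi>' C * (\<Sum>k<n. \<integral>\<^sup>+y. (L ^^ k) f y \<partial>\<nu>)"
      if f: "f \<in> borel_measurable S" for f n
    proof (induction n)
      case (Suc n)
      have "(\<integral>\<^sup>+z. (L ^^ n) f z \<partial>\<pi>') = (\<integral>\<^sup>+z. (L ^^ Suc n) f z \<partial>\<pi>') + emeasure \<pi>' C * (\<integral>\<^sup>+y. (L ^^ n) f y \<partial>\<nu>)"
        using one[OF Ln_meas[OF f]] by simp
      then show ?case using Suc by (simp add: distrib_left ac_simps)
    qed simp
    have vanish: "(\<lambda>n. (L ^^ n) (\<lambda>_. 1) z) \<longlonglongrightarrow> 0" if z: "z \<in> space S" for z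
    proof -
      have Ln_le: "(L ^^ k) (\<lambda>_. 1) y \<le> (L ^^ k) V y" if "y \<in> space S" for k y
        using that
      proof (induction k arbitrary: y)
        case (Suc k)
        then show ?case by (auto intro: L_mono)
      qed (use V1 in auto)
      have "(\<Sum>k<n. (L ^^ k) (\<lambda>_. 1) z) \<le> W z" for n
        using sum_le[OF z, of n] Ln_le[OF z] by (meson order_trans sum_mono)
      then have "(\<Sum>k. (L ^^ k) (\<lambda>_. 1) z) \<le> W z" by (intro suminf_le_const summableI)
      then have fin: "(\<Sum>k. (L ^^ k) (\<lambda>_. 1) z) \<noteq> top" using W_fin[OF z] by (auto simp: top_unique)
      define u where "u k = enn2real ((L ^^ k) (\<lambda>_. 1) z)" for k
      have "(L ^^ k) (\<lambda>_. 1) z \<le> (\<Sum>k. (L ^^ k) (\<lambda>_. 1) z)" for k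
        using sum_le_suminf[OF summableI, of "{k}" "\<lambda>k. (L ^^ k) (\<lambda>_. 1) z"] by simp
      then have u: "(L ^^ k) (\<lambda>_. 1) z = ennreal (u k)" for k
        unfolding u_def using fin by (metis ennreal_enn2real less_top neq_top_trans)
      then have "summable u" using fin by (intro summable_suminf_not_top) (auto simp: u_def)
      then have "u \<longlonglongrightarrow> 0" by (rule summable_LIMSEQ_zero)
      then show ?thesis unfolding u by (subst ennreal_tendsto_0_iff) (auto simp: u_def)
    qed
    have L1: "(L ^^ n) (\<lambda>_. 1) z \<le> 1" if "z \<in> space S" for n z
      using that
    proof (induction n arbitrary: z)
      case (Suc n)
      have "L ((L ^^ n) (\<lambda>_. 1)) z \<le> L (\<lambda>_. 1) z" using Suc by (intro L_mono) auto
      also have "\<dots> \<le> 1"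
        using subprob_space.emeasure_space_le_1[OF subprob_space_kernel[OF P Suc.prems]]
        by (simp add: L_def)
      finally show ?case by simp
    qed simp
    have "(\<lambda>n. \<integral>\<^sup>+z. (L ^^ n) (\<lambda>_. 1) z \<partial>\<pi>') \<longlonglongrightarrow> (\<integral>\<^sup>+z. 0 \<partial>\<pi>')"
    proof (rule nn_integral_dominated_convergence[where w = "\<lambda>_. 1"])
      show "AE x in \<pi>'. (\<lambda>n. (L ^^ n) (\<lambda>_. 1) x) \<longlonglongrightarrow> 0" using vanish by (auto simp: sp')
    qed (use L1 in \<open>auto simp: sp' \<pi>'.emeasure_space_1[unfolded sp']\<close>)
    then have lim0: "(\<lambda>n. \<integral>\<^sup>+z. (L ^^ n) (\<lambda>_. 1) z \<partial>\<pi>') \<longlonglongrightarrow> 0" by simp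
    have meas: "emeasure \<pi>' A = emeasure \<pi>' C * emeasure \<mu> A" if A: "A \<in> sets S" for A
    proof -
      let ?f = "indicator A :: 'a \<Rightarrow> ennreal"
      have f: "?f \<in> borel_measurable S" using A by (rule borel_measurable_indicator)
      have Ln_le: "(L ^^ k) ?f y \<le> (L ^^ k) (\<lambda>_. 1) y" if "y \<in> space S" for k y
        using that by (induction k arbitrary: y) (auto intro: L_mono simp: indicator_def)
      have "(\<lambda>n. \<integral>\<^sup>+z. (L ^^ n) ?f z \<partial>\<pi>') \<longlonglongrightarrow> 0"
        by (rule tendsto_sandwich[OF _ _ tendsto_const lim0])
          (auto intro!: always_eventually nn_integral_mono Ln_le simp: sp')
      moreover have "(\<lambda>n. emeasure \<pi>' C * (\<Sum>k<n. \<integral>\<^sup>+y. (L ^^ k) ?f y \<partial>\<nu>)) \<longlonglongrightarrow> emeasure \<pi>' C * emeasure \<mu> A"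
      proof (rule ennreal_tendsto_cmult)
        show "emeasure \<pi>' C < top" by (simp add: \<pi>'.emeasure_finite less_top[symmetric])
        have "emeasure \<mu> A = (\<Sum>k. \<integral>\<^sup>+y. (L ^^ k) ?f y \<partial>\<nu>)" using \<mu>_int[OF f] A by (simp add: sets_\<mu>)
        then show "(\<lambda>n. \<Sum>k<n. \<integral>\<^sup>+y. (L ^^ k) ?f y \<partial>\<nu>) \<longlonglongrightarrow> emeasure \<mu> A"
          by (simp add: summable_LIMSEQ summableI)
      qed
      ultimately have "(\<lambda>n. (\<integral>\<^sup>+z. (L ^^ n) ?f z \<partial>\<pi>') + emeasure \<pi>' C * (\<Sum>k<n. \<integral>\<^sup>+y. (L ^^ k) ?f y \<partial>\<nu>))
          \<longlonglongrightarrow> 0 + emeasure \<pi>' C * emeasure \<mu> A"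
        by (rule tendsto_add)
      then have "(\<lambda>n::nat. \<integral>\<^sup>+y. ?f y \<partial>\<pi>') \<longlonglongrightarrow> 0 + emeasure \<pi>' C * emeasure \<mu> A"
        by (simp only: expand[OF f, symmetric])
      then show ?thesis using A \<pi>'(2) by (simp add: LIMSEQ_const_iff)
    qed
    have "emeasure \<pi>' C * emeasure \<mu> (space S) = 1"
      using meas[of "space S"] \<pi>'.emeasure_space_1 by (simp add: sp')
    then have "inverse (emeasure \<mu> (space S)) = emeasure \<pi>' C * (emeasure \<mu> (space S) * inverse (emeasure \<mu> (space S)))"
      by (simp only: mult.assoc[symmetric]) simp
    then have "emeasure \<pi>' C = inverse (emeasure \<mu> (space S))" by (simp only: inv) simp
    then have C_mass: "emeasure \<pi>' C = inverse (emeasure \<mu> (space S))" .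
    show ?thesis
    proof (rule measure_eqI)
      show "sets \<pi>' = sets \<pi>" by (simp only: \<pi>'(2) sets_\<pi>)
      fix A assume "A \<in> sets \<pi>'"
      then have "A \<in> sets S" by (simp only: \<pi>'(2))
      from meas[OF this] show "emeasure \<pi>' A = emeasure \<pi> A"
        by (simp only: C_mass \<pi>_def emeasure_scale_measure)
    qed
  qed
  ultimately show ?thesis using sets_\<pi> by blast
qed

text \<open>Additive Gaussian noise has a density that is bounded below on bounded sets. Hence from every state with
\<open>V \<le> T\<close> the chain lands in the image of the unit ball with the same minorising law, which is the small
set condition; the threshold \<open>T\<close> is chosen so large that the drift inequality has a strict gain outside.
The moment bound is the drift inequality integrated against the invariant law.\<close>

lemma additive_noise_invariant_law:
  fixes \<Theta> :: "'a::euclidean_space \<times> 'a \<Rightarrow> 'b::topological_space" and m :: "'b \<Rightarrow> 'a \<times> 'a"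
    and V :: "'b \<Rightarrow> real"
  defines "Q \<equiv> \<lambda>z. distr noise borel (\<lambda>\<xi>. \<Theta> (m z + \<xi>))"
  assumes \<Theta>[measurable]: "\<Theta> \<in> borel_measurable borel" and m[measurable]: "m \<in> borel_measurable borel"
    and V[measurable]: "V \<in> borel_measurable borel" and V1: "\<And>z. 1 \<le> V z"
    and a: "0 \<le> a" "a < 1" and K: "0 \<le> K"
    and drift: "\<And>z. (\<integral>\<^sup>+\<xi>. ennreal (V (\<Theta> (m z + \<xi>))) \<partial>noise) \<le> ennreal (a * V z + K)"
    and coercive: "\<And>T. \<exists>\<rho>. \<forall>z. V z \<le> T \<longrightarrow> norm (m z) \<le> \<rho>"
  shows "\<exists>\<pi>. invariant_law Q \<pi> \<and> (\<forall>\<pi>'. invariant_law Q \<pi>' \<longrightarrow> \<pi>' = \<pi>) \<and>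
    (\<integral>\<^sup>+z. ennreal (V z) \<partial>\<pi>) \<le> ennreal (K / (1 - a))"
proof -
  interpret N: prob_space "noise :: ('a \<times> 'a) measure" by (rule prob_space_noise)
  define g :: "'a \<times> 'a \<Rightarrow> real" where "g \<xi> = gaussian_density (fst \<xi>) * gaussian_density (snd \<xi>)" for \<xi>
  have g_pos: "g \<xi> > 0" for \<xi> by (simp add: g_def gaussian_density_pos)
  have g_meas[measurable]: "g \<in> borel_measurable borel"
    unfolding g_def
    by (intro borel_measurable_times measurable_compose[OF _ gaussian_density_measurable]
      borel_measurable_continuous_onI continuous_intros)
  have noise: "(noise :: ('a \<times> 'a) measure) = density lborel (\<lambda>\<xi>. ennreal (g \<xi>))"
    by (simp add: noise_density g_def)
  \<comment> \<open>Any state serves here: making \<open>T\<close> at least \<open>V z0\<close> ensures that the small set is not empty.\<close>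
  define z0 :: 'b where "z0 = undefined"
  define T where "T = max (V z0) (2 * K / (1 - a))"
  obtain \<rho> where \<rho>: "\<And>z. V z \<le> T \<Longrightarrow> norm (m z) \<le> \<rho>" using coercive by blast
  define \<delta> where "\<delta> = std_normal_density (\<rho> + 1) ^ DIM('a) * std_normal_density (\<rho> + 1) ^ DIM('a)"
  have \<delta>_pos: "\<delta> > 0" unfolding \<delta>_def by (simp add: normal_density_pos)
  have g_low: "\<delta> \<le> g \<xi>" if "norm \<xi> \<le> \<rho> + 1" for \<xi>
    unfolding \<delta>_def g_def using that norm_fst_le[of "fst \<xi>" "snd \<xi>"] norm_snd_le[of "snd \<xi>" "fst \<xi>"]
    by (intro mult_mono gaussian_density_lower_bound) (auto intro: less_imp_le gaussian_density_pos)
  define C where "C = {z. V z \<le> T}"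
  have C[measurable]: "C \<in> sets borel" unfolding C_def by measurable
  define B :: "('a \<times> 'a) set" where "B = ball 0 1"
  have B[measurable]: "B \<in> sets borel" by (simp add: B_def)
  \<comment> \<open>The conditional probability that a step from \<open>z\<close> with noise \<open>\<xi>\<close> is declared a regeneration. Under the
    Gaussian law of \<open>\<xi>\<close> the factor \<open>1 / g\<close> makes the regenerated \<open>m z + \<xi>\<close> uniform on \<open>B\<close>.\<close>
  define wt where "wt z \<xi> = indicator C z * (\<delta> * indicator B (m z + \<xi>) / g \<xi>)" for z \<xi>
  have wt0: "wt z \<xi> \<ge> 0" for z \<xi> using \<delta>_pos g_pos[of \<xi>] by (simp add: wt_def)
  have wt1: "wt z \<xi> \<le> 1" for z \<xi>
  proof (cases "z \<in> C \<and> m z + \<xi> \<in> B")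
    case True
    have "norm \<xi> = norm ((m z + \<xi>) - m z)" by simp
    also have "\<dots> \<le> norm (m z + \<xi>) + norm (m z)" by (rule norm_triangle_ineq4)
    also have "\<dots> \<le> \<rho> + 1" using True \<rho>[of z] by (auto simp: C_def B_def)
    finally show ?thesis using g_low[of \<xi>] g_pos[of \<xi>] True by (simp add: wt_def)
  qed (auto simp: wt_def)
  have wt_meas[measurable]: "(\<lambda>(z, \<xi>). wt z \<xi>) \<in> borel_measurable (borel \<Otimes>\<^sub>M borel)"
    unfolding wt_def by measurable
  define P where "P z = distr (density noise (\<lambda>\<xi>. ennreal (1 - wt z \<xi>))) borel (\<lambda>\<xi>. \<Theta> (m z + \<xi>))" for z
  define \<nu> where "\<nu> = distr (density lborel (\<lambda>y. ennreal (\<delta> * indicator B y))) borel \<Theta>"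
  have Q_int: "(\<integral>\<^sup>+y. f y \<partial>Q z) = (\<integral>\<^sup>+\<xi>. f (\<Theta> (m z + \<xi>)) \<partial>noise)"
    if [measurable]: "f \<in> borel_measurable borel" for f z
    unfolding Q_def by (rule nn_integral_distr) measurable
  have P_int: "(\<integral>\<^sup>+y. f y \<partial>P z) = (\<integral>\<^sup>+\<xi>. ennreal (1 - wt z \<xi>) * f (\<Theta> (m z + \<xi>)) \<partial>noise)"
    if [measurable]: "f \<in> borel_measurable borel" for f z
    unfolding P_def by (subst nn_integral_distr, measurable) (subst nn_integral_density, measurable)
  have \<nu>_int: "(\<integral>\<^sup>+y. f y \<partial>\<nu>) = (\<integral>\<^sup>+y. ennreal (\<delta> * indicator B y) * f (\<Theta> y) \<partial>lborel)"
    if [measurable]: "f \<in> borel_measurable borel" for f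
    unfolding \<nu>_def by (subst nn_integral_distr, measurable) (subst nn_integral_density, measurable)
  have split: "(\<integral>\<^sup>+y. f y \<partial>Q z) = (\<integral>\<^sup>+y. f y \<partial>P z) + indicator C z * (\<integral>\<^sup>+y. f y \<partial>\<nu>)"
    if f[measurable]: "f \<in> borel_measurable borel" for f z
  proof -
    have "(\<integral>\<^sup>+y. f y \<partial>Q z) = (\<integral>\<^sup>+\<xi>. ennreal (1 - wt z \<xi>) * f (\<Theta> (m z + \<xi>)) + ennreal (wt z \<xi>) * f (\<Theta> (m z + \<xi>)) \<partial>noise)"
      unfolding Q_int[OF f]
      by (intro nn_integral_cong) (simp add: distrib_right[symmetric] ennreal_plus[symmetric] wt0 wt1 del: ennreal_plus)
    also have "\<dots> = (\<integral>\<^sup>+y. f y \<partial>P z) + (\<integral>\<^sup>+\<xi>. ennreal (wt z \<xi>) * f (\<Theta> (m z + \<xi>)) \<partial>noise)"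
      unfolding P_int[OF f] by (rule nn_integral_add) measurable
    also have "(\<integral>\<^sup>+\<xi>. ennreal (wt z \<xi>) * f (\<Theta> (m z + \<xi>)) \<partial>noise)
        = (\<integral>\<^sup>+\<xi>. ennreal (g \<xi>) * (ennreal (wt z \<xi>) * f (\<Theta> (m z + \<xi>))) \<partial>lborel)"
      unfolding noise by (rule nn_integral_density) measurable
    also have "\<dots> = (\<integral>\<^sup>+\<xi>. indicator C z * (ennreal (\<delta> * indicator B (m z + \<xi>)) * f (\<Theta> (m z + \<xi>))) \<partial>lborel)"
    proof (rule nn_integral_cong)
      fix \<xi>
      have "g \<xi> * wt z \<xi> = indicator C z * (\<delta> * indicator B (m z + \<xi>))"
        using g_pos[of \<xi>] by (simp add: wt_def)
      then have "ennreal (g \<xi>) * ennreal (wt z \<xi>) = indicator C z * ennreal (\<delta> * indicator B (m z + \<xi>))"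
        using g_pos[of \<xi>] wt0 \<delta>_pos by (simp add: ennreal_mult[symmetric] less_imp_le) (simp add: indicator_def)
      then show "ennreal (g \<xi>) * (ennreal (wt z \<xi>) * f (\<Theta> (m z + \<xi>)))
        = indicator C z * (ennreal (\<delta> * indicator B (m z + \<xi>)) * f (\<Theta> (m z + \<xi>)))"
        by (simp add: mult.assoc[symmetric])
    qed
    also have "\<dots> = indicator C z * (\<integral>\<^sup>+\<xi>. ennreal (\<delta> * indicator B (m z + \<xi>)) * f (\<Theta> (m z + \<xi>)) \<partial>lborel)"
      by (rule nn_integral_cmult) measurable
    also have "(\<integral>\<^sup>+\<xi>. ennreal (\<delta> * indicator B (m z + \<xi>)) * f (\<Theta> (m z + \<xi>)) \<partial>lborel)
        = (\<integral>\<^sup>+y. ennreal (\<delta> * indicator B y) * f (\<Theta> y) \<partial>distr lborel borel ((+) (m z)))"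
      by (rule nn_integral_distr[symmetric]) measurable
    also have "\<dots> = (\<integral>\<^sup>+y. f y \<partial>\<nu>)" unfolding \<nu>_int[OF f] lborel_distr_plus ..
    finally show ?thesis .
  qed
  have Q_kernel: "Q \<in> borel \<rightarrow>\<^sub>M subprob_algebra borel"
    unfolding Q_def
    by (intro measurable_prob_algebraD measurable_noise_kernel) measurable
  have Q1: "emeasure (Q z) (space borel) = 1" for z
    unfolding Q_def using N.emeasure_space_1 by (subst emeasure_distr) auto
  have mass: "emeasure (P z) UNIV + indicator C z * emeasure \<nu> UNIV = 1" for z
    using split[of "\<lambda>_. 1" z] Q1[of z] by (simp add: P_def \<nu>_def Q_def)
  have le_sum: "x \<le> c" if "x + y = c" for x y c :: ennreal using that by (auto simp: le_iff_add)
  have P_kernel: "P \<in> borel \<rightarrow>\<^sub>M subprob_algebra borel"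
  proof (rule measurable_subprob_algebra)
    show "subprob_space (P z)" for z
    proof
      have "emeasure (P z) UNIV \<le> 1" using le_sum[OF mass[of z]] .
      then show "emeasure (P z) (space (P z)) \<le> 1" by (simp add: P_def)
      show "space (P z) \<noteq> {}" by (simp add: P_def)
    qed
    show "(\<lambda>z. emeasure (P z) A) \<in> borel_measurable borel" if [measurable]: "A \<in> sets borel" for A
    proof -
      have "emeasure (P z) A = (\<integral>\<^sup>+\<xi>. ennreal (1 - wt z \<xi>) * indicator A (\<Theta> (m z + \<xi>)) \<partial>noise)" for z
        using P_int[of "indicator A" z] that by (simp add: P_def)
      then show ?thesis by simp
    qed
  qed (simp add: P_def)
  have z0: "z0 \<in> C" by (simp add: C_def T_def)
  have \<nu>_le: "emeasure \<nu> UNIV \<le> 1" using mass[of z0] z0 by (intro le_sum[of _ "emeasure (P z0) UNIV"]) (simp add: add.commute)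
  have \<nu>_sub: "subprob_space \<nu>"
    by standard (use \<nu>_le in \<open>auto simp: \<nu>_def\<close>)
  have \<nu>_ne: "emeasure \<nu> UNIV \<noteq> 0"
  proof -
    have "emeasure \<nu> UNIV = (\<integral>\<^sup>+y. ennreal \<delta> * indicator B y \<partial>lborel)"
      using \<nu>_int[of "\<lambda>_. 1"] \<delta>_pos
      by (simp add: \<nu>_def ennreal_mult ennreal_indicator[symmetric] less_imp_le del: ennreal_indicator)
    also have "\<dots> = ennreal \<delta> * emeasure lborel B" by (simp add: nn_integral_cmult)
    also have "\<dots> \<noteq> 0"
      using \<delta>_pos content_ball_pos[of 1 "0 :: 'a \<times> 'a"]
      by (auto simp: B_def measure_def)
    finally show ?thesis .
  qed
  interpret \<nu>: subprob_space \<nu> by (rule \<nu>_sub)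
  define n0 where "n0 = measure \<nu> UNIV"
  have n0: "emeasure \<nu> UNIV = ennreal n0" by (simp add: n0_def \<nu>.emeasure_eq_measure)
  have n0_pos: "n0 > 0" using \<nu>_ne n0 by (simp add: n0_def measure_nonneg zero_less_measure_iff \<nu>.emeasure_eq_measure)
  define \<theta> where "\<theta> = (1 + a) / 2"
  have \<theta>: "0 \<le> \<theta>" "\<theta> < 1" using a by (auto simp: \<theta>_def)
  define L where "L = K / n0"
  have L: "L \<ge> 0" using K n0_pos by (simp add: L_def)
  \<comment> \<open>Removing the regenerations from a step out of \<open>C\<close> lowers the mean of \<open>V + L\<close> by at least \<open>L n0 = K\<close>,
    which compensates the constant in the drift inequality.\<close>
  define W where "W z = (V z + L) / (1 - \<theta>)" for z
  have W[measurable]: "W \<in> borel_measurable borel" unfolding W_def by measurable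
  have V0: "0 \<le> V z" for z using V1[of z] by simp
  have V_drift: "a * V z + K \<le> \<theta> * V z + K * indicator C z" for z
  proof (cases "z \<in> C")
    case True
    have "a * V z \<le> \<theta> * V z" using a V0 by (intro mult_right_mono) (auto simp: \<theta>_def)
    then show ?thesis using True by simp
  next
    case False
    then have "2 * K / (1 - a) \<le> V z" by (simp add: C_def T_def)
    then have "2 * K \<le> (1 - a) * V z" using a by (simp add: field_simps)
    then show ?thesis using False by (simp add: \<theta>_def field_simps)
  qed
  have Q_W: "(\<integral>\<^sup>+y. ennreal (W y) \<partial>Q z) \<le> ennreal ((\<theta> * V z + K * indicator C z + L) / (1 - \<theta>))" for z
  proof -
    have "(\<integral>\<^sup>+y. ennreal (W y) \<partial>Q z) = (\<integral>\<^sup>+y. ennreal (1 / (1 - \<theta>)) * (ennreal (V y) + ennreal L) \<partial>Q z)"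
      using V0 L \<theta> by (intro nn_integral_cong)
        (simp add: W_def ennreal_plus[symmetric] ennreal_mult[symmetric] del: ennreal_plus)
    also have "\<dots> = ennreal (1 / (1 - \<theta>)) * ((\<integral>\<^sup>+y. ennreal (V y) \<partial>Q z) + ennreal L)"
      using Q1[of z] by (subst nn_integral_cmult) (auto simp: Q_def nn_integral_add)
    also have "\<dots> \<le> ennreal (1 / (1 - \<theta>)) * (ennreal (\<theta> * V z + K * indicator C z) + ennreal L)"
      using drift[of z] V_drift[of z] by (intro mult_left_mono add_right_mono)
        (auto simp: Q_int intro: order_trans ennreal_leI)
    also have "\<dots> = ennreal ((\<theta> * V z + K * indicator C z + L) / (1 - \<theta>))"
      using V0 L \<theta> K by (simp add: ennreal_plus[symmetric] ennreal_mult[symmetric] del: ennreal_plus)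
    finally show ?thesis .
  qed
  have W0: "0 \<le> W z" for z using V0 L \<theta> by (simp add: W_def)
  have \<nu>W: "(\<integral>\<^sup>+z. ennreal (W z) \<partial>\<nu>) < \<infinity>"
  proof -
    have "(\<integral>\<^sup>+z. ennreal (W z) \<partial>\<nu>) \<le> (\<integral>\<^sup>+y. ennreal (W y) \<partial>Q z0)"
      using z0 by (subst split) auto
    also have "\<dots> < \<infinity>" using Q_W[of z0] by (auto intro: le_less_trans)
    finally show ?thesis .
  qed
  have P_drift: "(\<integral>\<^sup>+y. ennreal (W y) \<partial>P z) + ennreal (V z) \<le> ennreal (W z)" for z
  proof -
    have bound: "(\<integral>\<^sup>+y. ennreal (W y) \<partial>P z) \<le> ennreal ((\<theta> * V z + L) / (1 - \<theta>))"
    proof (cases "z \<in> C")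
      case False
      then show ?thesis using Q_W[of z] split[of "\<lambda>y. ennreal (W y)" z] by simp
    next
      case True
      have "ennreal (K / (1 - \<theta>)) = ennreal (L / (1 - \<theta>)) * ennreal n0"
        using n0_pos L \<theta> by (simp add: ennreal_mult[symmetric]) (simp add: L_def)
      also have "\<dots> = (\<integral>\<^sup>+y. ennreal (L / (1 - \<theta>)) \<partial>\<nu>)" by (simp add: n0[symmetric] \<nu>_def)
      also have "\<dots> \<le> (\<integral>\<^sup>+y. ennreal (W y) \<partial>\<nu>)"
        using V0 \<theta> by (intro nn_integral_mono ennreal_leI) (auto simp: W_def intro!: divide_right_mono)
      finally have "ennreal (K / (1 - \<theta>)) + (\<integral>\<^sup>+y. ennreal (W y) \<partial>P z)
          \<le> (\<integral>\<^sup>+y. ennreal (W y) \<partial>Q z)"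
        using split[of "\<lambda>y. ennreal (W y)" z] True by (simp add: add.commute add_mono)
      also have "\<dots> \<le> ennreal ((\<theta> * V z + K * indicator C z + L) / (1 - \<theta>))" by (rule Q_W)
      also have "\<dots> = ennreal (K / (1 - \<theta>)) + ennreal ((\<theta> * V z + L) / (1 - \<theta>))"
        using V0 L \<theta> K True by (simp add: ennreal_plus[symmetric] add_divide_distrib del: ennreal_plus)
      finally show ?thesis by (simp add: ennreal_add_left_cancel_le)
    qed
    have "(\<integral>\<^sup>+y. ennreal (W y) \<partial>P z) + ennreal (V z) \<le> ennreal ((\<theta> * V z + L) / (1 - \<theta>)) + ennreal (V z)"
      using bound by (rule add_right_mono)
    also have "\<dots> = ennreal ((\<theta> * V z + L) / (1 - \<theta>) + V z)"
      using V0 L \<theta> by (simp add: ennreal_plus[symmetric] del: ennreal_plus)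
    also have "(\<theta> * V z + L) / (1 - \<theta>) + V z = W z" using \<theta> by (simp add: W_def field_simps)
    finally show ?thesis .
  qed
  obtain \<pi> where \<pi>: "prob_space \<pi>" "sets \<pi> = sets borel" "\<pi> \<bind> Q = \<pi>" "(\<integral>\<^sup>+z. ennreal (V z) \<partial>\<pi>) < \<infinity>"
    "\<And>\<pi>'. prob_space \<pi>' \<Longrightarrow> sets \<pi>' = sets borel \<Longrightarrow> \<pi>' \<bind> Q = \<pi>' \<Longrightarrow> \<pi>' = \<pi>"
  proof -
    have "\<exists>\<pi>. prob_space \<pi> \<and> sets \<pi> = sets borel \<and> \<pi> \<bind> Q = \<pi> \<and> (\<integral>\<^sup>+z. ennreal (V z) \<partial>\<pi>) < \<infinity> \<and>
      (\<forall>\<pi>'. prob_space \<pi>' \<and> sets \<pi>' = sets borel \<and> \<pi>' \<bind> Q = \<pi>' \<longrightarrow> \<pi>' = \<pi>)"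
      by (rule harris_invariant_law[OF Q_kernel P_kernel Q1 \<nu>_sub _ _ C split _ _ _ _ \<nu>W P_drift])
        (use \<nu>_ne V1 in \<open>auto simp: \<nu>_def\<close>)
    then show thesis using that by blast
  qed
  have "(\<integral>\<^sup>+z. ennreal (V z) \<partial>\<pi>) \<le> ennreal (K / (1 - a))"
  proof -
    obtain v where v: "(\<integral>\<^sup>+z. ennreal (V z) \<partial>\<pi>) = ennreal v" "v \<ge> 0"
      using \<pi>(4) by (cases "\<integral>\<^sup>+z. ennreal (V z) \<partial>\<pi>") auto
    note \<pi>(2)[measurable_cong]
    have Q': "Q \<in> \<pi> \<rightarrow>\<^sub>M subprob_algebra borel" using Q_kernel by measurable
    have "ennreal v = (\<integral>\<^sup>+z. (\<integral>\<^sup>+y. ennreal (V y) \<partial>Q z) \<partial>\<pi>)"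
      using nn_integral_bind[OF _ Q', of "\<lambda>y. ennreal (V y)"] \<pi>(3) v by simp
    also have "\<dots> \<le> (\<integral>\<^sup>+z. ennreal a * ennreal (V z) + ennreal K \<partial>\<pi>)"
      using drift a K V0 by (intro nn_integral_mono)
        (simp add: Q_int ennreal_plus[symmetric] ennreal_mult[symmetric] del: ennreal_plus)
    also have "\<dots> = ennreal (a * v + K)"
      using prob_space.emeasure_space_1[OF \<pi>(1)] v a K
      by (simp add: nn_integral_add nn_integral_cmult ennreal_mult)
    finally have "v \<le> a * v + K" using v a K by (simp del: ennreal_plus)
    then have "v \<le> K / (1 - a)" using a by (simp add: field_simps)
    then show ?thesis using v by (simp add: ennreal_leI)
  qed
  then show ?thesis unfolding invariant_law_def using \<pi> by blast
qed

section \<open>The OBABO chain in position coordinates\<close>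

text \<open>Every linear functional on a Euclidean space is the inner product with the vector of its values on the basis.\<close>

lemma GDERIV_sum_partial:
  assumes "f differentiable (at x)"
  shows "GDERIV f x :> (\<Sum>b\<in>Basis. frechet_derivative f (at x) b *\<^sub>R b)"
proof -
  let ?f = "frechet_derivative f (at x)"
  have d: "(f has_derivative ?f) (at x)" using assms by (simp add: frechet_derivative_works)
  then have lin: "linear ?f" by (simp add: has_derivative_linear)
  have "?f k = k \<bullet> (\<Sum>b\<in>Basis. ?f b *\<^sub>R b)" for k
  proof -
    have "?f k = ?f (\<Sum>b\<in>Basis. (k \<bullet> b) *\<^sub>R b)" by (simp add: euclidean_representation)
    also have "\<dots> = (\<Sum>b\<in>Basis. (k \<bullet> b) * ?f b)" by (simp add: linear_sum[OF lin] linear_scale[OF lin])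
    finally show ?thesis by (simp add: inner_sum_right mult.commute)
  qed
  then have "?f = (\<lambda>k. k \<bullet> (\<Sum>b\<in>Basis. ?f b *\<^sub>R b))" by blast
  with d show ?thesis unfolding gderiv_def by simp
qed

lemma grad_eqI:
  assumes "GDERIV f x :> D"
  shows "grad f x = D"
  unfolding grad_def
proof (rule the_equality)
  show "GDERIV f x :> D" by fact
  fix D' assume "GDERIV f x :> D'"
  then have "(\<lambda>k. k \<bullet> D') = (\<lambda>k. k \<bullet> D)"
    using assms unfolding gderiv_def by (rule has_derivative_unique)
  then show "D' = D" by (simp add: fun_eq_iff vector_eq_ldot)
qed

lemma C_infinity_differentiable:
  assumes "C_infinity U"
  shows "U differentiable (at x)"
  using assms unfolding C_infinity_def by (metis Ck.simps(2))

lemma measurable_grad: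
  assumes "C_infinity U"
  shows "grad U \<in> borel_measurable borel"
proof -
  have "continuous_on UNIV (\<lambda>x. frechet_derivative U (at x) v)" for v
    using assms unfolding C_infinity_def by (metis Ck.simps)
  then have "continuous_on UNIV (\<lambda>x. \<Sum>b\<in>Basis. frechet_derivative U (at x) b *\<^sub>R b)"
    by (intro continuous_intros)
  moreover have "grad U = (\<lambda>x. \<Sum>b\<in>Basis. frechet_derivative U (at x) b *\<^sub>R b)"
    by (intro ext grad_eqI GDERIV_sum_partial C_infinity_differentiable assms)
  ultimately have "continuous_on UNIV (grad U)" by (simp only:)
  then show ?thesis by (rule borel_measurable_continuous_onI)
qed

lemma grad_rescale:
  assumes "C_infinity U" "R > 0"
  shows "grad (rescale R U) x = R *\<^sub>R grad U (x /\<^sub>R R)"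
proof (rule grad_eqI)
  have "(U has_derivative (\<lambda>k. k \<bullet> grad U (x /\<^sub>R R))) (at (x /\<^sub>R R))"
    using GDERIV_sum_partial[OF C_infinity_differentiable[OF assms(1)], of "x /\<^sub>R R"]
    by (metis grad_eqI gderiv_def)
  moreover have "((\<lambda>x. x /\<^sub>R R) has_derivative (\<lambda>k. k /\<^sub>R R)) (at x)"
    by (rule has_derivative_scaleR_right[OF has_derivative_ident])
  ultimately have "((\<lambda>x. U (x /\<^sub>R R)) has_derivative (\<lambda>k. (k /\<^sub>R R) \<bullet> grad U (x /\<^sub>R R))) (at x)"
    using has_derivative_compose[of "\<lambda>x. x /\<^sub>R R" "\<lambda>k. k /\<^sub>R R" x UNIV U] by blast
  then have "((\<lambda>x. R\<^sup>2 * U (x /\<^sub>R R)) has_derivative (\<lambda>k. R\<^sup>2 * ((k /\<^sub>R R) \<bullet> grad U (x /\<^sub>R R)))) (at x)"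
    by (rule has_derivative_mult_right)
  moreover have "(\<lambda>k. R\<^sup>2 * ((k /\<^sub>R R) \<bullet> grad U (x /\<^sub>R R))) = (\<lambda>k. k \<bullet> (R *\<^sub>R grad U (x /\<^sub>R R)))"
    using assms(2) by (auto simp: power2_eq_square)
  ultimately show "GDERIV (rescale R U) x :> R *\<^sub>R grad U (x /\<^sub>R R)"
    unfolding gderiv_def rescale_def[abs_def] by simp
qed

locale obabo =
  fixes h \<gamma> r \<beta> \<sigma> s :: real
  assumes h: "h > 0" and \<gamma>: "\<gamma> > 0"
    and r_def: "r = exp (- \<gamma> * h / 2)" and \<beta>_def: "\<beta> = r\<^sup>2" and \<sigma>_def: "\<sigma> = sqrt (1 - \<beta>)"
    and s_def: "s = h\<^sup>2 * (1 + \<beta>) / 2"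
begin

lemma r: "0 < r" "r < 1" using h \<gamma> by (auto simp: r_def)

lemma \<beta>: "0 < \<beta>" "\<beta> < 1" using r by (auto simp: \<beta>_def power_less_one_iff)

lemma \<sigma>: "0 < \<sigma>" using \<beta> by (simp add: \<sigma>_def)

lemma s: "0 < s" using h \<beta> by (simp add: s_def)

text \<open>The position from which a step with vanishing second velocity noise would have reached the state \<open>z\<close>.\<close>

definition prev :: "('a::euclidean_space \<Rightarrow> real) \<Rightarrow> 'a \<times> 'a \<Rightarrow> 'a" where
  "prev U z = fst z - (h / r) *\<^sub>R snd z - (h\<^sup>2 / 2) *\<^sub>R grad U (fst z)"

text \<open>The inverse of \<open>z \<mapsto> (fst z, prev U z)\<close>.\<close>

definition from_positions :: "('a::euclidean_space \<Rightarrow> real) \<Rightarrow> 'a \<times> 'a \<Rightarrow> 'a \<times> 'a" where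
  "from_positions U p = (fst p, r *\<^sub>R ((1 / h) *\<^sub>R (fst p - snd p) - (h / 2) *\<^sub>R grad U (fst p)))"

lemma prev_from_positions [simp]: "prev U (from_positions U p) = snd p"
  using h r by (simp add: prev_def from_positions_def algebra_simps power2_eq_square)

lemma from_positions_prev: "from_positions U (fst z, prev U z) = z"
  using h r by (cases z) (simp add: prev_def from_positions_def algebra_simps power2_eq_square)

lemma fst_from_positions [simp]: "fst (from_positions U p) = fst p"
  by (simp add: from_positions_def)

lemma step_unfold:
  "obabo_step h \<gamma> U (x, v) (\<xi>\<^sub>1, \<xi>\<^sub>2) =
    (let u = r *\<^sub>R v + \<sigma> *\<^sub>R \<xi>\<^sub>1 - (h / 2) *\<^sub>R grad U x; y = x + h *\<^sub>R u
     in (y, r *\<^sub>R (u - (h / 2) *\<^sub>R grad U y) + \<sigma> *\<^sub>R \<xi>\<^sub>2))"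
  by (simp only: obabo_step_def Let_def prod.case r_def[symmetric] \<beta>_def[symmetric] \<sigma>_def[symmetric])

text \<open>The two half kicks and the two damping factors combine: eliminating the velocity in favour of the previous
position leaves a second-order recursion with step size \<open>s\<close>.\<close>

lemma step_position:
  "fst (obabo_step h \<gamma> U z \<xi>) = (1 + \<beta>) *\<^sub>R fst z - \<beta> *\<^sub>R prev U z - s *\<^sub>R grad U (fst z) + (h * \<sigma>) *\<^sub>R fst \<xi>"
proof -
  obtain x v \<xi>\<^sub>1 \<xi>\<^sub>2 where z: "z = (x, v)" "\<xi> = (\<xi>\<^sub>1, \<xi>\<^sub>2)" by (cases z, cases \<xi>)
  have c: "\<beta> * (h / r) = h * r" "\<beta> * (h\<^sup>2 / 2) - s = - (h * (h / 2))"
    using r by (simp_all add: \<beta>_def s_def power2_eq_square field_simps)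
  have "(1 + \<beta>) *\<^sub>R x - \<beta> *\<^sub>R prev U z - s *\<^sub>R grad U x
      = x + (\<beta> * (h / r)) *\<^sub>R v + (\<beta> * (h\<^sup>2 / 2) - s) *\<^sub>R grad U x"
    by (simp add: prev_def z(1) scaleR_diff_right scaleR_left_distrib scaleR_left_diff_distrib)
  also have "\<dots> = x + h *\<^sub>R (r *\<^sub>R v - (h / 2) *\<^sub>R grad U x)"
    unfolding c by (simp add: scaleR_diff_right)
  finally show ?thesis
    by (simp add: z step_unfold Let_def scaleR_diff_right scaleR_add_right)
qed

lemma step_prev: "prev U (obabo_step h \<gamma> U z \<xi>) = fst z - (h * \<sigma> / r) *\<^sub>R snd \<xi>"
proof -
  obtain x v \<xi>\<^sub>1 \<xi>\<^sub>2 where z: "z = (x, v)" "\<xi> = (\<xi>\<^sub>1, \<xi>\<^sub>2)" by (cases z, cases \<xi>)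
  have "prev U (x + h *\<^sub>R u, r *\<^sub>R (u - (h / 2) *\<^sub>R grad U (x + h *\<^sub>R u)) + \<sigma> *\<^sub>R \<xi>\<^sub>2)
      = x - (h * \<sigma> / r) *\<^sub>R \<xi>\<^sub>2" for u
    using r by (simp add: prev_def scaleR_diff_right scaleR_add_right power2_eq_square)
  then show ?thesis by (simp add: z step_unfold Let_def)
qed

text \<open>The argument \<open>\<eta>\<close> consists of the two positions, the current one divided by \<open>h \<sigma>\<close> and the
previous one by \<open>- h \<sigma> / r\<close>, so that the noise of one step is exactly a pair of standard Gaussian
vectors. In these coordinates \<open>mean\<close> is the noiseless step.\<close>

definition recon :: "('a::euclidean_space \<Rightarrow> real) \<Rightarrow> 'a \<times> 'a \<Rightarrow> 'a \<times> 'a" where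
  "recon U \<eta> = from_positions U ((h * \<sigma>) *\<^sub>R fst \<eta>, - (h * \<sigma> / r) *\<^sub>R snd \<eta>)"

definition mean :: "('a::euclidean_space \<Rightarrow> real) \<Rightarrow> 'a \<times> 'a \<Rightarrow> 'a \<times> 'a" where
  "mean U z = ((1 / (h * \<sigma>)) *\<^sub>R ((1 + \<beta>) *\<^sub>R fst z - \<beta> *\<^sub>R prev U z - s *\<^sub>R grad U (fst z)),
     - (r / (h * \<sigma>)) *\<^sub>R fst z)"

lemma step_eq: "obabo_step h \<gamma> U z \<xi> = recon U (mean U z + \<xi>)"
proof -
  have "fst (recon U (mean U z + \<xi>)) = fst (obabo_step h \<gamma> U z \<xi>)"
    using h \<sigma> by (simp add: recon_def mean_def step_position scaleR_add_right)
  moreover have "prev U (recon U (mean U z + \<xi>)) = prev U (obabo_step h \<gamma> U z \<xi>)"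
    using h \<sigma> r by (simp add: recon_def mean_def step_prev scaleR_add_right scaleR_diff_right)
  ultimately show ?thesis by (metis from_positions_prev)
qed

lemma measurable_prev:
  assumes [measurable]: "grad U \<in> borel_measurable borel"
  shows "prev U \<in> borel_measurable borel"
  unfolding prev_def borel_prod[symmetric] by measurable

lemma measurable_recon:
  assumes [measurable]: "grad U \<in> borel_measurable borel"
  shows "recon U \<in> borel_measurable borel"
  unfolding recon_def from_positions_def borel_prod[symmetric] by measurable

lemma measurable_mean:
  assumes [measurable]: "grad U \<in> borel_measurable borel"
  shows "mean U \<in> borel_measurable borel"
  unfolding mean_def prev_def borel_prod[symmetric] by measurable

lemma obabo_kernel_eq: "obabo_kernel h \<gamma> U = (\<lambda>z. distr noise borel (\<lambda>\<xi>. recon U (mean U z + \<xi>)))"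
  by (simp add: obabo_kernel_def fun_eq_iff step_eq[abs_def] step_eq)

end

lemma noise_fst_integral:
  assumes [measurable]: "f \<in> borel_measurable borel"
  shows "(\<integral>\<^sup>+\<xi>. f (fst \<xi>) \<partial>(noise :: ('a::euclidean_space \<times> 'a) measure)) = (\<integral>\<^sup>+x. f x \<partial>std_gaussian)"
    and "(\<integral>\<^sup>+\<xi>. f (snd \<xi>) \<partial>(noise :: ('a::euclidean_space \<times> 'a) measure)) = (\<integral>\<^sup>+x. f x \<partial>std_gaussian)"
proof -
  interpret G: prob_space "std_gaussian :: 'a measure" by (rule prob_space_std_gaussian)
  have "(\<integral>\<^sup>+\<xi>. f (fst \<xi>) \<partial>(noise :: ('a \<times> 'a) measure)) = (\<integral>\<^sup>+x. (\<integral>\<^sup>+y. f (fst (x, y)) \<partial>(std_gaussian :: 'a measure)) \<partial>std_gaussian)"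
    by (rule G.nn_integral_fst[symmetric], rule measurable_compose[OF measurable_fst])
      (use assms measurable_cong_sets[OF sets_std_gaussian refl] in blast)
  then show "(\<integral>\<^sup>+\<xi>. f (fst \<xi>) \<partial>(noise :: ('a \<times> 'a) measure)) = (\<integral>\<^sup>+x. f x \<partial>std_gaussian)"
    using G.emeasure_space_1 by simp
  have "(\<integral>\<^sup>+\<xi>. f (snd \<xi>) \<partial>(noise :: ('a \<times> 'a) measure)) = (\<integral>\<^sup>+x. (\<integral>\<^sup>+y. f (snd (x, y)) \<partial>(std_gaussian :: 'a measure)) \<partial>(std_gaussian :: 'a measure))"
    by (rule G.nn_integral_fst[symmetric], rule measurable_compose[OF measurable_snd])
      (use assms measurable_cong_sets[OF sets_std_gaussian refl] in blast)
  then show "(\<integral>\<^sup>+\<xi>. f (snd \<xi>) \<partial>(noise :: ('a \<times> 'a) measure)) = (\<integral>\<^sup>+x. f x \<partial>std_gaussian)"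
    using G.emeasure_space_1 by simp
qed

section \<open>Second moment of the invariant law\<close>

context obabo
begin

text \<open>With \<open>N\<close> a norm adapted to the companion matrix of \<open>\<mu>\<^sup>2 - \<tau> \<mu> + \<beta>\<close>, \<open>\<tau> = 1 + \<beta> - s \<lambda>\<close>, the function
\<open>V = 1 + N\<^sup>2\<close> of the two positions is a Lyapunov function. The perturbation \<open>\<nabla>U(x) - \<lambda> x\<close> enters
only through its bound \<open>b\<close>, so the drift constant, and with it the second moment, grows like
\<open>1 + b\<^sup>2\<close> with a factor common to all potentials.\<close>

lemma invariant_law_second_moment:
  assumes lam: "0 < lam" "h\<^sup>2 * lam < 4"
  shows "\<exists>D>0. \<forall>(U::real^'d \<Rightarrow> real) b. grad U \<in> borel_measurable borel \<and> 0 \<le> b \<and>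
      (\<forall>x. norm (grad U x - lam *\<^sub>R x) \<le> b) \<longrightarrow>
    (\<exists>\<pi>. invariant_law (obabo_kernel h \<gamma> U) \<pi> \<and>
      (\<forall>\<pi>'. invariant_law (obabo_kernel h \<gamma> U) \<pi>' \<longrightarrow> \<pi>' = \<pi>) \<and>
      (\<integral>\<^sup>+z. ennreal ((norm z)\<^sup>2) \<partial>\<pi>) \<le> ennreal (D * (1 + b\<^sup>2)))"
proof -
  define \<tau> where "\<tau> = 1 + \<beta> - s * lam"
  have "s * lam = (h\<^sup>2 * lam) * (1 + \<beta>) / 2" by (simp add: s_def)
  also have "\<dots> < 4 * (1 + \<beta>) / 2" using lam(2) \<beta> by (intro divide_strict_right_mono mult_strict_right_mono) auto
  finally have \<tau>: "\<bar>\<tau>\<bar> < 1 + \<beta>" using mult_pos_pos[OF s lam(1)] by (auto simp: \<tau>_def)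
  obtain N C where C: "C \<ge> (2::real)"
    and N_low: "\<And>p. norm p \<le> N p" and N_up: "\<And>p. N p \<le> C * norm p"
    and N_add: "\<And>p q. N (p + q) \<le> N p + N q"
    and N_step: "\<And>x y::real^'d. N (\<tau> *\<^sub>R x - \<beta> *\<^sub>R y, x) \<le> (1 - 1 / C) * N (x, y)"
    by (rule adapted_norm_companion[OF \<beta> \<tau>]) (rule that; assumption)
  have N0: "0 \<le> N p" for p using N_low[of p] norm_ge_zero order_trans by blast
  have N_lip: "\<bar>N p - N q\<bar> \<le> C * norm (p - q)" for p q
  proof -
    have "N p \<le> N q + C * norm (p - q)" for p q
      using N_add[of q "p - q"] N_up[of "p - q"] by simp
    from this[of p q] this[of q p] show ?thesis by (simp add: norm_minus_commute)
  qed
  have "C-lipschitz_on UNIV N"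
    using N_lip C by (intro lipschitz_onI) (auto simp: dist_norm)
  then have N_meas[measurable]: "N \<in> borel_measurable borel"
    by (intro borel_measurable_continuous_onI lipschitz_on_continuous_on)
  define q where "q = 1 - 1 / C"
  have q: "0 \<le> q" "q < 1" using C by (auto simp: q_def)
  define e where "e = h * \<sigma> / r"
  have e: "0 < e" "h * \<sigma> \<le> e"
    using h \<sigma> r by (auto simp: e_def field_simps mult_le_cancel_left1)
  define M where "M = 4 * sqrt 2 ^ DIM(real^'d)"
  have M: "M \<ge> 0" by (simp add: M_def)
  define K where "K b = 1 + 3 * C ^ 3 * (s\<^sup>2 * b\<^sup>2 + 2 * e\<^sup>2 * M)" for b
  define E where "E = 2 * r / h + r * h * lam / 2 + r * h / 2"
  have E: "E \<ge> 0" using r h lam by (simp add: E_def)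
  define K1 where "K1 = 1 + 3 * C ^ 3 * (s\<^sup>2 + 2 * e\<^sup>2 * M)"
  define D where "D = 2 * (1 + E)\<^sup>2 * (C * K1 + 1)"
  have K1: "K1 \<ge> 1" using C M by (simp add: K1_def)
  have D: "D > 0" unfolding D_def using E C K1 by (intro mult_pos_pos add_nonneg_pos) auto
  have K_le: "K b \<le> K1 * (1 + b\<^sup>2)" for b
  proof -
    let ?c = "3 * C ^ 3"
    have "0 \<le> ?c * s\<^sup>2" "0 \<le> b\<^sup>2" "0 \<le> ?c * (2 * e\<^sup>2 * M) * b\<^sup>2" using C M by auto
    then show ?thesis by (simp add: K_def K1_def algebra_simps)
  qed
  show ?thesis
  proof (intro exI[of _ D] conjI D allI impI)
    fix U :: "real^'d \<Rightarrow> real" and b :: real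
    assume asm: "grad U \<in> borel_measurable borel \<and> 0 \<le> b \<and> (\<forall>x. norm (grad U x - lam *\<^sub>R x) \<le> b)"
    then have gm[measurable]: "grad U \<in> borel_measurable borel" and b: "0 \<le> b"
      and wb: "\<And>x. norm (grad U x - lam *\<^sub>R x) \<le> b" by auto
    note measurable_prev[OF gm, measurable] measurable_recon[OF gm, measurable] measurable_mean[OF gm, measurable]
    define P where "P z = (fst z, prev U z)" for z
    have P_meas[measurable]: "P \<in> borel_measurable borel"
      unfolding P_def[abs_def] using measurable_prev[OF gm] by (simp add: borel_measurable_Pair borel_measurable_continuous_onI continuous_on_fst)
    define V where "V z = 1 + (N (P z))\<^sup>2" for z
    have V_meas: "V \<in> borel_measurable borel" unfolding V_def[abs_def] by measurable
    have N_noise: "N (P (recon U (mean U z + \<xi>))) \<le> q * N (P z) + C * (s * b + e * norm (fst \<xi>) + e * norm (snd \<xi>))" for z \<xi>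
    proof -
      let ?x = "fst z" and ?y = "prev U z"
      let ?n = "((h * \<sigma>) *\<^sub>R fst \<xi> - s *\<^sub>R (grad U ?x - lam *\<^sub>R ?x), - e *\<^sub>R snd \<xi>)"
      have "P (recon U (mean U z + \<xi>)) = (\<tau> *\<^sub>R ?x - \<beta> *\<^sub>R ?y, ?x) + ?n"
        by (simp add: step_eq[symmetric] P_def step_position step_prev \<tau>_def e_def
            scaleR_left_diff_distrib scaleR_diff_right scaleR_add_left)
      then have "N (P (recon U (mean U z + \<xi>))) \<le> q * N (P z) + C * norm ?n"
        using N_add[of "(\<tau> *\<^sub>R ?x - \<beta> *\<^sub>R ?y, ?x)" ?n] N_step[of ?x ?y] N_up[of ?n]
        by (simp add: q_def P_def)
      also have "norm ?n \<le> norm ((h * \<sigma>) *\<^sub>R fst \<xi> - s *\<^sub>R (grad U ?x - lam *\<^sub>R ?x)) + norm (- e *\<^sub>R snd \<xi>)"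
        by (rule norm_Pair_le)
      also have "\<dots> \<le> (norm ((h * \<sigma>) *\<^sub>R fst \<xi>) + norm (s *\<^sub>R (grad U ?x - lam *\<^sub>R ?x))) + norm (- e *\<^sub>R snd \<xi>)"
        by (intro add_right_mono norm_triangle_ineq4)
      also have "\<dots> \<le> s * b + e * norm (fst \<xi>) + e * norm (snd \<xi>)"
      proof -
        have "norm ((h * \<sigma>) *\<^sub>R fst \<xi>) \<le> e * norm (fst \<xi>)"
          using mult_right_mono[OF e(2) norm_ge_zero, of "fst \<xi>"] h \<sigma> by (simp add: abs_mult)
        moreover have "norm (s *\<^sub>R (grad U ?x - lam *\<^sub>R ?x)) \<le> s * b"
          using wb[of ?x] s by (simp add: mult_left_mono)
        moreover have "norm (- e *\<^sub>R snd \<xi>) = e * norm (snd \<xi>)" using e by simp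
        ultimately show ?thesis by linarith
      qed
      finally show ?thesis using C by (simp add: mult_left_mono)
    qed
    have V_noise: "V (recon U (mean U z + \<xi>)) \<le> (q * V z + (1 + 3 * C ^ 3 * s\<^sup>2 * b\<^sup>2))
        + 3 * C ^ 3 * e\<^sup>2 * (norm (fst \<xi>))\<^sup>2 + 3 * C ^ 3 * e\<^sup>2 * (norm (snd \<xi>))\<^sup>2" for z \<xi>
    proof -
      let ?a = "s * b" and ?b = "e * norm (fst \<xi>)" and ?c = "e * norm (snd \<xi>)" and ?t = "N (P z)"
      define u where "u = C * (?a + ?b + ?c)"
      have u0: "u \<ge> 0" using C s b e by (simp add: u_def)
      have "(N (P (recon U (mean U z + \<xi>))))\<^sup>2 \<le> (q * ?t + u)\<^sup>2"
        using N_noise[of z \<xi>] N0 by (intro power_mono) (auto simp: u_def)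
      \<comment> \<open>Convexity of the square, with weights \<open>q\<close> and \<open>1 - q = 1/C\<close>.\<close>
      also have "\<dots> \<le> q * ?t\<^sup>2 + C * u\<^sup>2"
      proof -
        have "q * ?t\<^sup>2 + C * u\<^sup>2 - (q * ?t + u)\<^sup>2 = (q / C) * (?t - C * u)\<^sup>2"
          using C by (simp add: q_def field_simps power2_eq_square)
        moreover have "0 \<le> (q / C) * (?t - C * u)\<^sup>2" using q C by (intro mult_nonneg_nonneg) auto
        ultimately show ?thesis by linarith
      qed
      also have "u\<^sup>2 \<le> C\<^sup>2 * (3 * (?a\<^sup>2 + ?b\<^sup>2 + ?c\<^sup>2))"
      proof -
        have "0 \<le> (?a - ?b)\<^sup>2 + (?b - ?c)\<^sup>2 + (?a - ?c)\<^sup>2" by simp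
        then have "(?a + ?b + ?c)\<^sup>2 \<le> 3 * (?a\<^sup>2 + ?b\<^sup>2 + ?c\<^sup>2)"
          by (simp add: power2_eq_square algebra_simps)
        then show ?thesis unfolding u_def power_mult_distrib by (intro mult_left_mono) auto
      qed
      finally have "(N (P (recon U (mean U z + \<xi>))))\<^sup>2 \<le> q * ?t\<^sup>2 + C * (C\<^sup>2 * (3 * (?a\<^sup>2 + ?b\<^sup>2 + ?c\<^sup>2)))"
        using C by (simp add: mult_left_mono)
      also have "\<dots> = q * ?t\<^sup>2 + 3 * C ^ 3 * s\<^sup>2 * b\<^sup>2 + 3 * C ^ 3 * e\<^sup>2 * (norm (fst \<xi>))\<^sup>2 + 3 * C ^ 3 * e\<^sup>2 * (norm (snd \<xi>))\<^sup>2"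
        by (simp add: power2_eq_square power3_eq_cube algebra_simps)
      finally show ?thesis using q by (simp add: V_def algebra_simps)
    qed
    have V1: "1 \<le> V z" for z by (simp add: V_def)
    have drift: "(\<integral>\<^sup>+\<xi>. ennreal (V (recon U (mean U z + \<xi>))) \<partial>noise) \<le> ennreal (q * V z + K b)" for z
    proof -
      let ?A = "q * V z + (1 + 3 * C ^ 3 * s\<^sup>2 * b\<^sup>2)" and ?B = "3 * C ^ 3 * e\<^sup>2"
      have A: "0 \<le> ?A" using q V1[of z] C by (intro add_nonneg_nonneg mult_nonneg_nonneg) auto
      have B: "0 \<le> ?B" using C by simp
      interpret NN: prob_space "noise :: ((real^'d) \<times> (real^'d)) measure" by (rule prob_space_noise)
      have m2: "(\<lambda>x::real^'d. ennreal ((norm x)\<^sup>2)) \<in> borel_measurable borel" by measurable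
      have mf: "(\<lambda>\<xi>. ennreal ((norm (fst \<xi>))\<^sup>2)) \<in> borel_measurable (noise :: ((real^'d) \<times> (real^'d)) measure)"
        and ms: "(\<lambda>\<xi>. ennreal ((norm (snd \<xi>))\<^sup>2)) \<in> borel_measurable (noise :: ((real^'d) \<times> (real^'d)) measure)"
        using measurable_compose[OF measurable_fst] measurable_compose[OF measurable_snd] m2
          measurable_cong_sets[OF sets_std_gaussian refl] by blast+
      have "(\<integral>\<^sup>+\<xi>. ennreal (V (recon U (mean U z + \<xi>))) \<partial>noise)
          \<le> (\<integral>\<^sup>+\<xi>. (ennreal ?A + ennreal ?B * ennreal ((norm (fst \<xi>))\<^sup>2)) + ennreal ?B * ennreal ((norm (snd \<xi>))\<^sup>2) \<partial>(noise :: ((real^'d) \<times> (real^'d)) measure))"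
      proof (rule nn_integral_mono)
        fix \<xi> :: "(real^'d) \<times> (real^'d)"
        have "ennreal (V (recon U (mean U z + \<xi>))) \<le> ennreal (?A + ?B * (norm (fst \<xi>))\<^sup>2 + ?B * (norm (snd \<xi>))\<^sup>2)"
          using V_noise[of z \<xi>] by (rule ennreal_leI)
        also have "\<dots> = (ennreal ?A + ennreal ?B * ennreal ((norm (fst \<xi>))\<^sup>2)) + ennreal ?B * ennreal ((norm (snd \<xi>))\<^sup>2)"
          using A B by (simp add: ennreal_plus[symmetric] ennreal_mult[symmetric] del: ennreal_plus)
        finally show "ennreal (V (recon U (mean U z + \<xi>)))
          \<le> (ennreal ?A + ennreal ?B * ennreal ((norm (fst \<xi>))\<^sup>2)) + ennreal ?B * ennreal ((norm (snd \<xi>))\<^sup>2)" .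
      qed
      also have "\<dots> = (ennreal ?A + ennreal ?B * (\<integral>\<^sup>+\<xi>. ennreal ((norm (fst \<xi>))\<^sup>2) \<partial>(noise :: ((real^'d) \<times> (real^'d)) measure)))
          + ennreal ?B * (\<integral>\<^sup>+\<xi>. ennreal ((norm (snd \<xi>))\<^sup>2) \<partial>(noise :: ((real^'d) \<times> (real^'d)) measure))"
        using mf ms NN.emeasure_space_1
        by (subst nn_integral_add, simp, simp, subst nn_integral_add, simp, simp, simp add: nn_integral_cmult)
      also have "\<dots> \<le> (ennreal ?A + ennreal ?B * ennreal M) + ennreal ?B * ennreal M"
        unfolding noise_fst_integral[OF m2] M_def
        by (intro add_mono mult_left_mono gaussian_second_moment) auto
      also have "\<dots> = ennreal (?A + ?B * M + ?B * M)"
        using A B M by (simp add: ennreal_plus[symmetric] ennreal_mult[symmetric] del: ennreal_plus)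
      also have "?A + ?B * M + ?B * M = q * V z + K b" by (simp add: K_def algebra_simps)
      finally show ?thesis .
    qed
    have coercive: "\<exists>\<rho>. \<forall>z. V z \<le> T \<longrightarrow> norm (mean U z) \<le> \<rho>" for T
    proof (intro exI allI impI)
      fix z assume "V z \<le> T"
      then have "(N (P z))\<^sup>2 \<le> T" by (simp add: V_def)
      moreover have "N (P z) \<le> 1 + (N (P z))\<^sup>2"
        using zero_le_power2[of "N (P z) - 1"] N0[of "P z"] by (simp add: power2_eq_square algebra_simps)
      ultimately have n: "N (P z) \<le> 1 + T" by linarith
      have eq: "mean U z = (1 / (h * \<sigma>)) *\<^sub>R ((\<tau> *\<^sub>R fst z - \<beta> *\<^sub>R prev U z, fst z) + (- s *\<^sub>R (grad U (fst z) - lam *\<^sub>R fst z), - (1 + r) *\<^sub>R fst z))"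
        by (simp add: mean_def \<tau>_def scaleR_left_diff_distrib scaleR_diff_right scaleR_add_left scaleR_add_right)
      have "norm ((\<tau> *\<^sub>R fst z - \<beta> *\<^sub>R prev U z, fst z) + (- s *\<^sub>R (grad U (fst z) - lam *\<^sub>R fst z), - (1 + r) *\<^sub>R fst z))
        \<le> norm (\<tau> *\<^sub>R fst z - \<beta> *\<^sub>R prev U z, fst z) + (norm (- s *\<^sub>R (grad U (fst z) - lam *\<^sub>R fst z)) + norm (- (1 + r) *\<^sub>R fst z))"
        by (intro norm_triangle_le add_left_mono norm_Pair_le)
      also have "norm (\<tau> *\<^sub>R fst z - \<beta> *\<^sub>R prev U z, fst z) \<le> 1 + T"
      proof -
        have "norm (\<tau> *\<^sub>R fst z - \<beta> *\<^sub>R prev U z, fst z) \<le> q * N (P z)"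
          using N_low[of "(\<tau> *\<^sub>R fst z - \<beta> *\<^sub>R prev U z, fst z)"] N_step[of "fst z" "prev U z"] by (simp add: q_def P_def)
        also have "\<dots> \<le> N (P z)" using q N0[of "P z"] by (simp add: mult_left_le_one_le)
        finally show ?thesis using n by simp
      qed
      also have "norm (- s *\<^sub>R (grad U (fst z) - lam *\<^sub>R fst z)) \<le> s * b"
        using wb[of "fst z"] s by (simp add: mult_left_mono)
      also have "norm (- (1 + r) *\<^sub>R fst z) \<le> (1 + r) * (1 + T)"
      proof -
        have "norm (fst z) \<le> 1 + T" using norm_fst_le[of "fst z" "prev U z"] N_low[of "P z"] n by (simp add: P_def)
        then have "\<bar>- (1 + r)\<bar> * norm (fst z) \<le> (1 + r) * (1 + T)" using r by (intro mult_mono) auto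
        then show ?thesis by (simp only: norm_scaleR)
      qed
      finally show "norm (mean U z) \<le> (1 / (h * \<sigma>)) * ((1 + T) + (s * b + (1 + r) * (1 + T)))"
        unfolding eq norm_scaleR using h \<sigma> by (intro mult_mono) auto
    qed
    have "K b \<ge> 0" using C M by (simp add: K_def)
    then obtain \<pi> where \<pi>: "invariant_law (obabo_kernel h \<gamma> U) \<pi>"
      "\<forall>\<pi>'. invariant_law (obabo_kernel h \<gamma> U) \<pi>' \<longrightarrow> \<pi>' = \<pi>"
      and \<pi>V: "(\<integral>\<^sup>+z. ennreal (V z) \<partial>\<pi>) \<le> ennreal (K b / (1 - q))"
      using additive_noise_invariant_law[OF measurable_recon[OF gm] measurable_mean[OF gm] V_meas V1 q _ drift coercive]
      unfolding obabo_kernel_eq by blast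
    interpret \<pi>: prob_space \<pi> using \<pi>(1) by (simp add: invariant_law_def)
    have sets_\<pi>[measurable_cong]: "sets \<pi> = sets borel" using \<pi>(1) by (simp add: invariant_law_def)
    have z_le: "(norm z)\<^sup>2 \<le> 2 * (1 + E)\<^sup>2 * (V z + b\<^sup>2)" for z
    proof -
      let ?x = "fst z" and ?y = "prev U z" and ?t = "N (P z)"
      have x: "norm ?x \<le> ?t" and y: "norm ?y \<le> ?t"
        using norm_fst_le[of ?x ?y] norm_snd_le[of ?y ?x] N_low[of "P z"] by (auto simp: P_def)
      have "norm (grad U ?x) \<le> norm (grad U ?x - lam *\<^sub>R ?x) + norm (lam *\<^sub>R ?x)"
        by (metis diff_add_cancel norm_triangle_ineq)
      also have "\<dots> \<le> b + lam * ?t" using wb[of ?x] x lam(1) by (intro add_mono) (auto simp: mult_left_mono)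
      finally have g: "norm (grad U ?x) \<le> b + lam * ?t" .
      have "snd z = r *\<^sub>R ((1 / h) *\<^sub>R (?x - ?y) - (h / 2) *\<^sub>R grad U ?x)"
        using arg_cong[OF from_positions_prev[of U z], of snd] by (simp add: from_positions_def)
      then have "norm (snd z) = r * norm ((1 / h) *\<^sub>R (?x - ?y) - (h / 2) *\<^sub>R grad U ?x)" using r by simp
      also have "\<dots> \<le> r * (norm ((1 / h) *\<^sub>R (?x - ?y)) + norm ((h / 2) *\<^sub>R grad U ?x))"
        using r by (intro mult_left_mono norm_triangle_ineq4) auto
      also have "\<dots> \<le> r * ((1 / h) * (2 * ?t) + (h / 2) * (b + lam * ?t))"
        using r h g norm_triangle_ineq4[of ?x ?y] x y
        by (intro mult_left_mono add_mono) (auto intro!: divide_right_mono mult_left_mono)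
      also have "\<dots> \<le> E * (?t + b)"
      proof -
        have "0 \<le> 2 * r / h * b" "0 \<le> r * h * lam / 2 * b" "0 \<le> r * h / 2 * ?t"
          using r h lam b N0 by auto
        moreover have "r * ((1 / h) * (2 * ?t) + (h / 2) * (b + lam * ?t))
          = 2 * r / h * ?t + r * h / 2 * b + r * h * lam / 2 * ?t" by (simp add: algebra_simps)
        ultimately show ?thesis unfolding E_def by (simp only: distrib_left distrib_right)
      qed
      finally have "norm z \<le> (1 + E) * (?t + b)"
        using norm_Pair_le[of ?x "snd z"] x b by (simp add: algebra_simps)
      then have "(norm z)\<^sup>2 \<le> (1 + E)\<^sup>2 * (?t + b)\<^sup>2"
        unfolding power_mult_distrib[symmetric] by (intro power_mono) auto
      also have "(?t + b)\<^sup>2 \<le> 2 * (V z + b\<^sup>2)"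
        using zero_le_power2[of "?t - b"] by (simp add: V_def power2_eq_square algebra_simps)
      finally have "(norm z)\<^sup>2 \<le> (1 + E)\<^sup>2 * (2 * (V z + b\<^sup>2))" by (simp add: mult_left_mono)
      then show ?thesis by (simp only: mult_ac)
    qed
    have "(\<integral>\<^sup>+z. ennreal ((norm z)\<^sup>2) \<partial>\<pi>) \<le> (\<integral>\<^sup>+z. ennreal (2 * (1 + E)\<^sup>2) * (ennreal (V z) + ennreal (b\<^sup>2)) \<partial>\<pi>)"
    proof (rule nn_integral_mono)
      fix z
      have "0 \<le> V z" using V1[of z] by simp
      then show "ennreal ((norm z)\<^sup>2) \<le> ennreal (2 * (1 + E)\<^sup>2) * (ennreal (V z) + ennreal (b\<^sup>2))"
        using z_le[of z] by (simp add: ennreal_plus[symmetric] ennreal_mult[symmetric] ennreal_leI del: ennreal_plus)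
    qed
    also have "\<dots> = ennreal (2 * (1 + E)\<^sup>2) * ((\<integral>\<^sup>+z. ennreal (V z) \<partial>\<pi>) + ennreal (b\<^sup>2))"
      using V_meas \<pi>.emeasure_space_1 by (simp add: nn_integral_cmult nn_integral_add)
    also have "\<dots> \<le> ennreal (2 * (1 + E)\<^sup>2) * (ennreal (K b / (1 - q)) + ennreal (b\<^sup>2))"
      by (intro mult_left_mono add_right_mono \<pi>V) simp
    also have "\<dots> = ennreal (2 * (1 + E)\<^sup>2 * (K b / (1 - q) + b\<^sup>2))"
      using \<open>K b \<ge> 0\<close> q by (simp add: ennreal_plus[symmetric] ennreal_mult[symmetric] del: ennreal_plus)
    also have "2 * (1 + E)\<^sup>2 * (K b / (1 - q) + b\<^sup>2) \<le> D * (1 + b\<^sup>2)"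
    proof -
      have "K b / (1 - q) = C * K b" by (simp add: q_def)
      also have "\<dots> \<le> C * (K1 * (1 + b\<^sup>2))" using K_le C by (intro mult_left_mono) auto
      finally have "K b / (1 - q) + b\<^sup>2 \<le> (C * K1 + 1) * (1 + b\<^sup>2)" by (simp add: algebra_simps)
      then show ?thesis unfolding D_def mult.assoc by (intro mult_left_mono) auto
    qed
    finally have "(\<integral>\<^sup>+z. ennreal ((norm z)\<^sup>2) \<partial>\<pi>) \<le> ennreal (D * (1 + b\<^sup>2))" by (simp add: ennreal_leI)
    with \<pi> show "\<exists>\<pi>. invariant_law (obabo_kernel h \<gamma> U) \<pi> \<and>
      (\<forall>\<pi>'. invariant_law (obabo_kernel h \<gamma> U) \<pi>' \<longrightarrow> \<pi>' = \<pi>) \<and>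
      (\<integral>\<^sup>+z. ennreal ((norm z)\<^sup>2) \<partial>\<pi>) \<le> ennreal (D * (1 + b\<^sup>2))" by blast
  qed
qed

end

section \<open>Sets that move with the chain, and distances to the invariant law\<close>

text \<open>The only coupling of a Dirac mass with \<open>\<pi>\<close> is the product, realised as the law of \<open>(z, y)\<close> for
\<open>y\<close> drawn from \<open>\<pi>\<close>.\<close>

lemma W2_return_le:
  fixes \<pi> :: "'z::{metric_space, second_countable_topology} measure"
  assumes \<pi>: "prob_space \<pi>" "sets \<pi> = sets borel"
    and bound: "(\<integral>\<^sup>+y. ennreal ((dist z y)\<^sup>2) \<partial>\<pi>) \<le> ennreal (B\<^sup>2)" and B: "0 \<le> B"
  shows "W2 (return borel z) \<pi> \<le> ennreal B"
proof -
  note \<pi>(2)[measurable_cong]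
  define \<Gamma> where "\<Gamma> = distr \<pi> (borel \<Otimes>\<^sub>M borel) (\<lambda>y. (z, y))"
  have m: "(\<lambda>y. (z, y)) \<in> \<pi> \<rightarrow>\<^sub>M borel \<Otimes>\<^sub>M borel" by measurable
  have "\<Gamma> \<in> couplings (return borel z) \<pi>"
    unfolding couplings_def
  proof (intro CollectI conjI)
    show "prob_space \<Gamma>" unfolding \<Gamma>_def by (rule prob_space.prob_space_distr[OF \<pi>(1) m])
    have "distr \<Gamma> borel fst = distr \<pi> borel (\<lambda>y. z)"
      unfolding \<Gamma>_def by (subst distr_distr) (auto simp: o_def)
    also have "\<dots> = return borel z"
      using prob_space.distr_const[OF \<pi>(1), of z borel] by simp
    finally show "distr \<Gamma> borel fst = return borel z" .
    have "distr \<Gamma> borel snd = distr \<pi> borel (\<lambda>y. y)"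
      unfolding \<Gamma>_def by (subst distr_distr) (auto simp: o_def)
    also have "\<dots> = \<pi>" using \<pi>(2) by (intro distr_id2) simp
    finally show "distr \<Gamma> borel snd = \<pi>" .
  qed (simp add: \<Gamma>_def)
  then have "(INF \<Gamma>\<in>couplings (return borel z) \<pi>. \<integral>\<^sup>+p. ennreal ((dist (fst p) (snd p))\<^sup>2) \<partial>\<Gamma>)
      \<le> (\<integral>\<^sup>+p. ennreal ((dist (fst p) (snd p))\<^sup>2) \<partial>\<Gamma>)"
    by (rule INF_lower)
  also have "\<dots> = (\<integral>\<^sup>+y. ennreal ((dist z y)\<^sup>2) \<partial>\<pi>)"
    unfolding \<Gamma>_def by (subst nn_integral_distr[OF m]) auto
  also note bound
  finally have c: "(INF \<Gamma>\<in>couplings (return borel z) \<pi>. \<integral>\<^sup>+p. ennreal ((dist (fst p) (snd p))\<^sup>2) \<partial>\<Gamma>) \<le> ennreal (B\<^sup>2)"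
    (is "?c \<le> _") .
  have fin: "?c \<noteq> \<infinity>" using neq_top_trans[OF ennreal_neq_top c] by (simp only: infinity_ennreal_def not_False_eq_True)
  have "enn2real ?c \<le> B\<^sup>2" using enn2real_mono[OF c] by simp
  then have "sqrt (enn2real ?c) \<le> B" using B by (metis real_sqrt_le_mono real_sqrt_abs abs_of_nonneg)
  moreover have "W2 (return borel z) \<pi> = ennreal (sqrt (enn2real ?c))"
    unfolding W2_def Let_def by (rule if_not_P[OF fin])
  ultimately show ?thesis by (simp only: ennreal_leI)
qed

lemma law_after_prob:
  assumes Q: "Q \<in> borel \<rightarrow>\<^sub>M prob_algebra borel" and \<mu>: "prob_space \<mu>" "sets \<mu> = sets borel"
  shows "prob_space (law_after Q n \<mu>) \<and> sets (law_after Q n \<mu>) = sets borel"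
proof (induction n)
  case (Suc n)
  have "law_after Q n \<mu> \<in> space (prob_algebra borel)" using Suc by (simp add: space_prob_algebra)
  then show ?case
    using prob_space_bind'[of "law_after Q n \<mu>" borel Q borel] sets_bind'[of "law_after Q n \<mu>" borel Q borel] Q
    by (simp add: law_after_def)
qed (use \<mu> in \<open>simp add: law_after_def\<close>)

lemma law_after_invariant: "invariant_law Q \<pi> \<Longrightarrow> law_after Q n \<pi> = \<pi>"
  by (induction n) (auto simp: law_after_def invariant_law_def)

text \<open>A Markov-chain form of tracking a trajectory: each step loses at most the fraction \<open>p\<close> of the mass that
still follows the moving set. Dirac masses and the invariant law will both serve as initial laws.\<close>

lemma moving_set_probability:
  fixes A :: "nat \<Rightarrow> 'z::topological_space set"
  assumes Q: "Q \<in> borel \<rightarrow>\<^sub>M prob_algebra borel" and \<mu>: "prob_space \<mu>" "sets \<mu> = sets borel"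
    and A: "\<And>k. A k \<in> sets borel" and p: "p \<le> 1"
    and stay: "\<And>k z. z \<in> A k \<Longrightarrow> 1 - p \<le> measure (Q z) (A (Suc k))"
  shows "(1 - p) ^ n * measure \<mu> (A k) \<le> measure (law_after Q n \<mu>) (A (k + n))"
proof (induction n)
  case (Suc n)
  let ?\<mu> = "law_after Q n \<mu>"
  have ps: "prob_space ?\<mu>" "sets ?\<mu> = sets borel" using law_after_prob[OF Q \<mu>] by auto
  interpret prob_space ?\<mu> by fact
  note ps(2)[measurable_cong]
  have Q': "Q \<in> ?\<mu> \<rightarrow>\<^sub>M subprob_algebra borel"
    using measurable_prob_algebraD[OF Q] by measurable
  have S: "law_after Q (Suc n) \<mu> = ?\<mu> \<bind> Q" by (simp add: law_after_def)
  have sp: "space ?\<mu> = UNIV" using sets_eq_imp_space_eq[OF ps(2)] by simp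
  interpret S: prob_space "law_after Q (Suc n) \<mu>" using law_after_prob[OF Q \<mu>, of "Suc n"] by auto
  have "ennreal ((1 - p) * measure ?\<mu> (A (k + n))) = (\<integral>\<^sup>+z. ennreal (1 - p) * indicator (A (k + n)) z \<partial>?\<mu>)"
    using A p by (simp add: nn_integral_cmult emeasure_eq_measure ennreal_mult ps(2))
  also have "\<dots> \<le> (\<integral>\<^sup>+z. emeasure (Q z) (A (Suc (k + n))) \<partial>?\<mu>)"
  proof (rule nn_integral_mono)
    fix z
    have "prob_space (Q z)" using measurable_space[OF Q, of z] by (simp add: space_prob_algebra)
    then interpret Q: prob_space "Q z" .
    show "ennreal (1 - p) * indicator (A (k + n)) z \<le> emeasure (Q z) (A (Suc (k + n)))"
      using stay[of z "k + n"] by (auto simp: indicator_def Q.emeasure_eq_measure ennreal_leI)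
  qed
  also have "\<dots> = emeasure (law_after Q (Suc n) \<mu>) (A (Suc (k + n)))"
    unfolding S using A by (intro emeasure_bind[symmetric, OF _ Q']) (auto simp: sp)
  also have "\<dots> = ennreal (measure (law_after Q (Suc n) \<mu>) (A (Suc (k + n))))" by (rule S.emeasure_eq_measure)
  finally have "(1 - p) * measure ?\<mu> (A (k + n)) \<le> measure (law_after Q (Suc n) \<mu>) (A (k + Suc n))" by simp
  moreover have "(1 - p) * ((1 - p) ^ n * measure \<mu> (A k)) \<le> (1 - p) * measure ?\<mu> (A (k + n))"
    using Suc p by (intro mult_left_mono) auto
  ultimately show ?case by (simp add: mult.assoc)
qed (simp add: law_after_def)

lemma measure_diff_le_tv_dist:
  assumes "prob_space \<mu>" "prob_space \<nu>" "A \<in> sets borel"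
  shows "\<bar>measure \<mu> A - measure \<nu> A\<bar> \<le> tv_dist \<mu> \<nu>"
  unfolding tv_dist_def
proof (rule cSUP_upper[OF assms(3)])
  have "\<bar>measure \<mu> A - measure \<nu> A\<bar> \<le> 1" for A
    using prob_space.prob_le_1[OF assms(1), of A] prob_space.prob_le_1[OF assms(2), of A]
      measure_nonneg[of \<mu> A] measure_nonneg[of \<nu> A] unfolding abs_le_iff by linarith
  then show "bdd_above ((\<lambda>A. \<bar>measure \<mu> A - measure \<nu> A\<bar>) ` sets borel)" by (auto simp: bdd_above_def)
qed

text \<open>If a start is close to \<open>\<pi>\<close> at an admissible time \<open>n\<close>, then \<open>\<pi>\<close> has mass at least
\<open>59/64 - 3/8 = 35/64\<close> on its set at time \<open>n\<close>, because \<open>n p \<le> 5/64\<close>. By invariance \<open>\<pi>\<close> can be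
run further along the moving set, at the cost of another factor \<open>59/64\<close>, until both sets are compared at
the same time. They are disjoint, but \<open>2 (59/64) (35/64) > 1\<close>.\<close>

lemma one_of_two_starts_is_far:
  fixes A A' :: "nat \<Rightarrow> 'z::topological_space set"
  assumes Q: "Q \<in> borel \<rightarrow>\<^sub>M prob_algebra borel" and \<pi>: "invariant_law Q \<pi>"
    and A: "\<And>k. A k \<in> sets borel" "\<And>k. A' k \<in> sets borel" and disj: "\<And>k. A k \<inter> A' k = {}"
    and z: "z \<in> A 0" "z' \<in> A' 0" and p: "0 \<le> p" "p \<le> 1"
    and stay: "\<And>k z. z \<in> A k \<Longrightarrow> 1 - p \<le> measure (Q z) (A (Suc k))"
      "\<And>k z. z \<in> A' k \<Longrightarrow> 1 - p \<le> measure (Q z) (A' (Suc k))"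
    and small: "\<And>n. I n \<Longrightarrow> real n * p \<le> 5 / 64"
  shows "(\<forall>n. I n \<longrightarrow> 3 / 8 \<le> tv_dist (law_after Q n (return borel z)) \<pi>) \<or>
    (\<forall>n. I n \<longrightarrow> 3 / 8 \<le> tv_dist (law_after Q n (return borel z')) \<pi>)"
proof (rule ccontr)
  interpret \<pi>: prob_space \<pi> using \<pi> by (simp add: invariant_law_def)
  have sets_\<pi>: "sets \<pi> = sets borel" using \<pi> by (simp add: invariant_law_def)
  have pow: "59 / 64 \<le> (1 - p) ^ k" if "k \<le> n" "I n" for k n
  proof -
    have "real k * p \<le> real n * p" using that p by (intro mult_right_mono) auto
    also have "\<dots> \<le> 5 / 64" using small that by blast
    finally have "59 / 64 \<le> 1 + real k * (- p)" by simp
    also have "\<dots> \<le> (1 + (- p)) ^ k" using p by (intro Bernoulli_inequality) simp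
    finally show ?thesis by simp
  qed
  have hit: "35 / 64 < measure \<pi> (B n)"
    if B: "\<And>k. B k \<in> sets borel" "y \<in> B 0" "\<And>k z. z \<in> B k \<Longrightarrow> 1 - p \<le> measure (Q z) (B (Suc k))"
      and n: "I n" and tv: "tv_dist (law_after Q n (return borel y)) \<pi> < 3 / 8" for B y n
  proof -
    have r: "prob_space (return borel y)" "sets (return borel y) = sets borel"
      by (auto intro: prob_space_return)
    have "(1 - p) ^ n * measure (return borel y) (B 0) \<le> measure (law_after Q n (return borel y)) (B (0 + n))"
      by (rule moving_set_probability[where A = B]) (use Q r B p in auto)
    then have "59 / 64 \<le> measure (law_after Q n (return borel y)) (B n)"
      using pow[OF order_refl n] B(1,2) by (simp add: measure_return)
    then show ?thesis
      using measure_diff_le_tv_dist[of "law_after Q n (return borel y)" \<pi> "B n"] tv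
        law_after_prob[OF Q r] B(1) \<pi>.prob_space_axioms by (simp add: abs_le_iff)
  qed
  have keep: "59 / 64 * measure \<pi> (B k) \<le> measure \<pi> (B n)"
    if B: "\<And>k. B k \<in> sets borel" "\<And>k z. z \<in> B k \<Longrightarrow> 1 - p \<le> measure (Q z) (B (Suc k))"
      and n: "k \<le> n" "I n" for B k n
  proof -
    have "(1 - p) ^ (n - k) * measure \<pi> (B k) \<le> measure (law_after Q (n - k) \<pi>) (B (k + (n - k)))"
      by (rule moving_set_probability[where A = B]) (use Q \<pi>.prob_space_axioms sets_\<pi> B p in auto)
    moreover have "59 / 64 * measure \<pi> (B k) \<le> (1 - p) ^ (n - k) * measure \<pi> (B k)"
      using pow[of "n - k" n] n by (intro mult_right_mono) auto
    ultimately show ?thesis using n by (simp add: law_after_invariant[OF \<pi>])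
  qed
  assume "\<not> ?thesis"
  then obtain n n' where n: "I n" "tv_dist (law_after Q n (return borel z)) \<pi> < 3 / 8"
    and n': "I n'" "tv_dist (law_after Q n' (return borel z')) \<pi> < 3 / 8" by (auto simp: not_le)
  define N where "N = max n n'"
  have N: "I N" using n n' by (auto simp: N_def max_def)
  have "59 / 64 * (35 / 64) < measure \<pi> (A N)"
    using hit[of A, OF A(1) z(1) stay(1) n] keep[of A, OF A(1) stay(1) _ N, of n] by (simp add: N_def)
  moreover have "59 / 64 * (35 / 64) < measure \<pi> (A' N)"
    using hit[of A', OF A(2) z(2) stay(2) n'] keep[of A', OF A(2) stay(2) _ N, of n'] by (simp add: N_def)
  moreover have "measure \<pi> (A N) + measure \<pi> (A' N) \<le> 1"
    using \<pi>.finite_measure_Union[of "A N" "A' N"] A disj sets_\<pi> \<pi>.prob_le_1[of "A N \<union> A' N"] by simp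
  ultimately show False by simp
qed

text \<open>For small \<open>R\<close> only \<open>p R \<le> 1\<close> is available. Both bounds are combined by raising
\<open>K exp (- \<alpha> R\<^sup>2)\<close> to a power \<open>\<theta>\<close> so small that \<open>K powr \<theta> \<le> 5/4\<close>.\<close>

lemma exponentially_many_rare_events:
  fixes p :: "real \<Rightarrow> real"
  assumes K: "K > 1" and \<alpha>: "\<alpha> > 0"
    and p: "\<And>R. R \<ge> 1 \<Longrightarrow> 0 \<le> p R \<and> p R \<le> 1 \<and> p R \<le> K * exp (- \<alpha> * R\<^sup>2)"
  shows "\<exists>c>0. \<forall>R\<ge>1. \<forall>n::nat. int n \<le> \<lfloor>exp (c * R\<^sup>2) / 16\<rfloor> \<longrightarrow> real n * p R \<le> 5 / 64"
proof -
  define \<theta> where "\<theta> = min 1 (ln (5 / 4) / ln K)"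
  have lnK: "ln K > 0" using K by simp
  have \<theta>: "0 < \<theta>" "\<theta> \<le> 1" using lnK by (auto simp: \<theta>_def)
  have \<theta>K: "\<theta> * ln K \<le> ln (5 / 4)"
  proof -
    have "\<theta> \<le> ln (5 / 4) / ln K" by (simp add: \<theta>_def)
    then show ?thesis using lnK by (simp add: field_simps)
  qed
  show ?thesis
  proof (intro exI[of _ "\<alpha> * \<theta>"] conjI allI impI)
    show "\<alpha> * \<theta> > 0" using \<alpha> \<theta> by simp
    fix R :: real and n :: nat
    assume R: "R \<ge> 1" and n: "int n \<le> \<lfloor>exp (\<alpha> * \<theta> * R\<^sup>2) / 16\<rfloor>"
    let ?y = "ln K - \<alpha> * R\<^sup>2"
    have "exp ?y = exp (ln K) * exp (- \<alpha> * R\<^sup>2)" by (simp add: exp_add[symmetric])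
    then have y: "p R \<le> exp ?y" using p[OF R] K by simp
    have "p R \<le> exp (\<theta> * ?y)"
    proof (cases "?y \<ge> 0")
      case True
      then have "1 \<le> exp (\<theta> * ?y)" using \<theta> by simp
      then show ?thesis using p[OF R] by linarith
    next
      case False
      then have "?y \<le> \<theta> * ?y" using \<theta> mult_right_mono_neg[of \<theta> 1 ?y] by simp
      then show ?thesis using y by (meson exp_le_cancel_iff order_trans)
    qed
    also have "\<theta> * ?y \<le> ln (5 / 4) - \<alpha> * \<theta> * R\<^sup>2" using \<theta>K by (simp add: algebra_simps)
    then have "exp (\<theta> * ?y) \<le> exp (ln (5 / 4) - \<alpha> * \<theta> * R\<^sup>2)" by simp
    also have "\<dots> = exp (ln (5 / 4)) * exp (- (\<alpha> * \<theta> * R\<^sup>2))"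
      by (simp only: exp_add[symmetric] diff_conv_add_uminus)
    also have "exp (ln (5 / 4)) = (5 / 4 :: real)" by (rule exp_ln) simp
    finally have pR: "p R \<le> 5 / 4 * exp (- (\<alpha> * \<theta> * R\<^sup>2))" .
    have "real n \<le> exp (\<alpha> * \<theta> * R\<^sup>2) / 16" using n by linarith
    then have "real n * p R \<le> exp (\<alpha> * \<theta> * R\<^sup>2) / 16 * (5 / 4 * exp (- (\<alpha> * \<theta> * R\<^sup>2)))"
      using pR p[OF R] by (intro mult_mono) auto
    also have "\<dots> = 5 / 64 * (exp (\<alpha> * \<theta> * R\<^sup>2) * exp (- (\<alpha> * \<theta> * R\<^sup>2)))" by (simp only: times_divide_eq_left times_divide_eq_right)
    also have "\<dots> = 5 / 64" by (simp only: exp_add[symmetric]) simp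
    finally show "real n * p R \<le> 5 / 64" .
  qed
qed

section \<open>Tubes around the periodic orbit\<close>

context obabo
begin

lemma measurable_obabo_kernel:
  assumes "grad U \<in> borel_measurable borel"
  shows "obabo_kernel h \<gamma> U \<in> borel \<rightarrow>\<^sub>M prob_algebra borel"
proof -
  note measurable_recon[OF assms, measurable] measurable_mean[OF assms, measurable]
  show ?thesis unfolding obabo_kernel_eq by (rule measurable_noise_kernel) measurable
qed

lemma measure_obabo_kernel:
  fixes U :: "'a::euclidean_space \<Rightarrow> real"
  assumes "grad U \<in> borel_measurable borel" "A \<in> sets borel" "B \<in> sets borel"
    and "\<And>\<xi>. \<xi> \<in> B \<Longrightarrow> obabo_step h \<gamma> U z \<xi> \<in> A"
  shows "measure noise B \<le> measure (obabo_kernel h \<gamma> U z) A"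
proof -
  interpret prob_space "noise :: ('a \<times> 'a) measure" by (rule prob_space_noise)
  note measurable_recon[OF assms(1), measurable] measurable_mean[OF assms(1), measurable]
  have m: "(\<lambda>\<xi>. recon U (mean U z + \<xi>)) \<in> noise \<rightarrow>\<^sub>M borel" by measurable
  have "measure noise B \<le> measure noise ((\<lambda>\<xi>. recon U (mean U z + \<xi>)) -` A \<inter> space noise)"
    using assms(4) measurable_sets[OF m assms(2)]
    by (intro finite_measure_mono) (auto simp: step_eq)
  then show ?thesis unfolding obabo_kernel_eq using assms(2) by (subst measure_distr[OF m]) auto
qed

text \<open>The displacement of a state from the pair of consecutive orbit points \<open>a\<close> (current) and \<open>b\<close>
(previous), in units of \<open>R\<close>.\<close>

definition deviation :: "('a::euclidean_space \<Rightarrow> real) \<Rightarrow> real \<Rightarrow> 'a \<Rightarrow> 'a \<Rightarrow> 'a \<times> 'a \<Rightarrow> 'a \<times> 'a" where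
  "deviation U R a b z = (fst z /\<^sub>R R - a, prev U z /\<^sub>R R - b)"

text \<open>Where the gradient is affine around the orbit point \<open>a\<close>, the displacement obeys the linear recursion of
hypothesis (b) exactly, with noise divided by \<open>R\<close>.\<close>

lemma deviation_step:
  fixes U :: "real^'d \<Rightarrow> real"
  assumes R: "R > 0" and u: "deviation U R a b z = (u, u')"
    and g: "grad U (fst z) = R *\<^sub>R (g + H *v u)"
  shows "deviation U R ((1 + \<beta>) *\<^sub>R a - \<beta> *\<^sub>R b - s *\<^sub>R g) a (obabo_step h \<gamma> U z \<xi>)
    = (((1 + \<beta>) *\<^sub>R mat 1 - s *\<^sub>R H) *v u - \<beta> *\<^sub>R u', u)
      + ((h * \<sigma> / R) *\<^sub>R fst \<xi>, - (h * \<sigma> / r / R) *\<^sub>R snd \<xi>)"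
proof -
  have x: "fst z /\<^sub>R R = a + u" and y: "prev U z /\<^sub>R R = b + u'"
    using u by (auto simp: deviation_def)
  have gR: "grad U (fst z) /\<^sub>R R = g + H *v u" using g R by simp
  have B: "((1 + \<beta>) *\<^sub>R mat 1 - s *\<^sub>R H) *v u = (1 + \<beta>) *\<^sub>R u - s *\<^sub>R (H *v u)"
    by (simp add: matrix_vector_mult_diff_rdistrib scaleR_matrix_vector_assoc[symmetric])
  have "fst (obabo_step h \<gamma> U z \<xi>) /\<^sub>R R
      = (1 + \<beta>) *\<^sub>R (fst z /\<^sub>R R) - \<beta> *\<^sub>R (prev U z /\<^sub>R R) - s *\<^sub>R (grad U (fst z) /\<^sub>R R) + (h * \<sigma> / R) *\<^sub>R fst \<xi>"
    by (simp add: step_position scaleR_diff_right scaleR_add_right mult.commute divide_inverse)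
  also have "\<dots> = (1 + \<beta>) *\<^sub>R (a + u) - \<beta> *\<^sub>R (b + u') - s *\<^sub>R (g + H *v u) + (h * \<sigma> / R) *\<^sub>R fst \<xi>"
    by (simp only: x y gR)
  also have "\<dots> = ((1 + \<beta>) *\<^sub>R a - \<beta> *\<^sub>R b - s *\<^sub>R g)
      + (((1 + \<beta>) *\<^sub>R u - s *\<^sub>R (H *v u)) - \<beta> *\<^sub>R u' + (h * \<sigma> / R) *\<^sub>R fst \<xi>)"
    by (simp add: scaleR_add_right)
  finally have 1: "fst (obabo_step h \<gamma> U z \<xi>) /\<^sub>R R = \<dots>" .
  have "prev U (obabo_step h \<gamma> U z \<xi>) /\<^sub>R R = fst z /\<^sub>R R - (h * \<sigma> / r / R) *\<^sub>R snd \<xi>"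
    by (simp add: step_prev scaleR_diff_right divide_inverse mult_ac)
  then have 2: "prev U (obabo_step h \<gamma> U z \<xi>) /\<^sub>R R = a + u - (h * \<sigma> / r / R) *\<^sub>R snd \<xi>" by (simp only: x)
  show ?thesis unfolding deviation_def 1 2 B by simp
qed

end

theorem theorem4p5:
  fixes \<kappa> h \<gamma> r \<beta> s r\<^sub>0 lam b :: real
    and m :: nat
    and U :: "real^'d \<Rightarrow> real"
    and xo :: "int \<Rightarrow> real^'d"
    and H :: "int \<Rightarrow> real^'d^'d"
    and w :: "real^'d \<Rightarrow> real^'d"
    and z :: "real \<Rightarrow> int \<Rightarrow> (real^'d) \<times> (real^'d)"
  assumes "\<kappa> > 1" and "h > 0" and "\<gamma> > 0" and "h < 2 / sqrt \<kappa>"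
    and r: "r = exp (- \<gamma> * h / 2)"
    and beta: "\<beta> = exp (- \<gamma> * h)"
    and s: "s = h\<^sup>2 * (1 + \<beta>) / 2"
    and dim: "CARD('d) \<in> {1, 2}"
    and "m \<ge> 2"
    and U: "U \<in> potentials \<kappa>"
    and xo_periodic: "\<And>j. xo (j + int m) = xo j"
    and xo_distinct: "inj_on xo {0..<int m}"
    and H_periodic: "\<And>j. H (j + int m) = H j"
    and H_symmetric: "\<And>j. transpose (H j) = H j"
    and "r\<^sub>0 > 0"
    and orbit: "\<And>j. xo (j + 1) =
                  (1 + \<beta>) *\<^sub>R xo j - \<beta> *\<^sub>R xo (j - 1) - s *\<^sub>R grad U (xo j)"
    and affine: "\<And>j u. norm u \<le> r\<^sub>0 \<Longrightarrow> grad U (xo j + u) = grad U (xo j) + H j *v u"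
    and stable: "spectral_radius (matrix_chain (\<lambda>j.
                   block_matrix ((1 + \<beta>) *\<^sub>R mat 1 - s *\<^sub>R H j) (- \<beta> *\<^sub>R mat 1) (mat 1) 0) m) < 1"
    and "lam \<in> {1..\<kappa>}" and "b > 0"
    and grad_U: "\<And>x. grad U x = lam *\<^sub>R x + w x"
    and w_bound: "\<And>x. norm (w x) \<le> b"
    and z: "\<And>R i. z R i = (R *\<^sub>R xo i,
              r *\<^sub>R ((R / h) *\<^sub>R (xo i - xo (i - 1)) - (h / 2) *\<^sub>R grad (rescale R U) (R *\<^sub>R xo i)))"
  shows "\<exists>c\<^sub>0>0. \<exists>C\<^sub>0>0. \<forall>R>0. \<exists>\<pi>.
           invariant_law (obabo_kernel h \<gamma> (rescale R U)) \<pi> \<and>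
           (\<forall>\<pi>'. invariant_law (obabo_kernel h \<gamma> (rescale R U)) \<pi>' \<longrightarrow> \<pi>' = \<pi>) \<and>
           (R \<ge> 1 \<longrightarrow> (\<forall>j. \<exists>i\<in>{j, j + 1}.
              W2 (return borel (z R i)) \<pi> \<le> ennreal (C\<^sub>0 * (1 + R)) \<and>
              (\<forall>n::nat. int n \<le> \<lfloor>exp (c\<^sub>0 * R\<^sup>2) / 16\<rfloor> \<longrightarrow>
                 tv_dist (law_after (obabo_kernel h \<gamma> (rescale R U)) n (return borel (z R i))) \<pi> \<ge> 3 / 8)))"
proof -
  define \<sigma> where "\<sigma> = sqrt (1 - \<beta>)"
  interpret obabo h \<gamma> r \<beta> \<sigma> s
    by unfold_locales
      (use \<open>h > 0\<close> \<open>\<gamma> > 0\<close> in \<open>auto simp: r beta s \<sigma>_def exp_double[symmetric]\<close>)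
  have U_smooth: "C_infinity U" using U by (simp add: potentials_def)
  note grad_meas = measurable_grad[OF U_smooth]
  have gradR: "grad (rescale R U) x = R *\<^sub>R grad U (x /\<^sub>R R)" if "R > 0" for R x
    using grad_rescale[OF U_smooth that] .
  have gradR_meas: "grad (rescale R U) \<in> borel_measurable borel" if "R > 0" for R
  proof -
    have "(\<lambda>x. R *\<^sub>R grad U (x /\<^sub>R R)) \<in> borel_measurable borel" using grad_meas by measurable
    then show ?thesis using gradR[OF that] by (simp add: ext cong: measurable_cong)
  qed

  have lam: "0 < lam" "h\<^sup>2 * lam < 4"
  proof -
    show "0 < lam" using \<open>lam \<in> {1..\<kappa>}\<close> by simp
    have "h * sqrt \<kappa> < 2" using \<open>h < 2 / sqrt \<kappa>\<close> \<open>\<kappa> > 1\<close> by (simp add: field_simps)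
    then have "(h * sqrt \<kappa>)\<^sup>2 < 2\<^sup>2" using \<open>h > 0\<close> \<open>\<kappa> > 1\<close> by (intro power_strict_mono) auto
    then have "h\<^sup>2 * \<kappa> < 4" using \<open>\<kappa> > 1\<close> by (simp add: power_mult_distrib)
    moreover have "h\<^sup>2 * lam \<le> h\<^sup>2 * \<kappa>" using \<open>lam \<in> {1..\<kappa>}\<close> by (intro mult_left_mono) auto
    ultimately show "h\<^sup>2 * lam < 4" by simp
  qed
  obtain D where D: "D > 0" and inv: "\<And>(U::real^'d \<Rightarrow> real) b. grad U \<in> borel_measurable borel \<Longrightarrow> 0 \<le> b \<Longrightarrow>
      (\<And>x. norm (grad U x - lam *\<^sub>R x) \<le> b) \<Longrightarrow>
    \<exists>\<pi>. invariant_law (obabo_kernel h \<gamma> U) \<pi> \<and>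
      (\<forall>\<pi>'. invariant_law (obabo_kernel h \<gamma> U) \<pi>' \<longrightarrow> \<pi>' = \<pi>) \<and>
      (\<integral>\<^sup>+z. ennreal ((norm z)\<^sup>2) \<partial>\<pi>) \<le> ennreal (D * (1 + b\<^sup>2))"
    using invariant_law_second_moment[OF lam, where 'd = 'd] by metis
  have wR: "norm (grad (rescale R U) x - lam *\<^sub>R x) \<le> R * b" if "R > 0" for R x
  proof -
    have "R * (lam * inverse R) = lam" using that by simp
    then have "grad (rescale R U) x - lam *\<^sub>R x = R *\<^sub>R w (x /\<^sub>R R)"
      using that by (simp add: gradR grad_U scaleR_add_right)
    then show ?thesis using w_bound[of "x /\<^sub>R R"] that by simp
  qed

  define B where "B j = (1 + \<beta>) *\<^sub>R mat 1 - s *\<^sub>R H j" for j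
  obtain N C where C: "C \<ge> (2::real)"
    and N_low: "\<And>k p. norm p \<le> N k p" and N_up: "\<And>k p. N k p \<le> C * norm p"
    and N_add: "\<And>k p q. N k (p + q) \<le> N k p + N k q"
    and N_step: "\<And>k x y. N (k + 1) (B k *v x - \<beta> *\<^sub>R y, x) \<le> (1 - 1 / C) * N k (x, y)"
  proof (rule adapted_norms_two_step[of m B \<beta>])
    show "m > 0" using \<open>m \<ge> 2\<close> by simp
    show "B (j + int m) = B j" for j by (simp add: B_def H_periodic)
    show "cmod \<mu> < 1" if "v \<noteq> 0" "map_matrix complex_of_real
       (matrix_chain (\<lambda>j. block_matrix (B j) (- \<beta> *\<^sub>R mat 1) (mat 1) 0) m) *v v = \<mu> *s v" for \<mu> v
      using spectral_radius_eigenvalue_le[OF that] stable unfolding B_def by linarith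
  qed (rule that; assumption)
  have N_zero: "N k 0 = 0" for k using N_up[of k 0] N_low[of 0 k] by simp
  have N_meas: "N k \<in> borel_measurable borel" for k
  proof -
    have le: "N k p \<le> N k q + C * norm (p - q)" for p q
      using N_add[of k q "p - q"] N_up[of k "p - q"] by simp
    have "\<bar>N k p - N k q\<bar> \<le> C * norm (p - q)" for p q
      using le[of p q] le[of q p] by (simp add: norm_minus_commute)
    then have "C-lipschitz_on UNIV (N k)"
      using C by (intro lipschitz_onI) (auto simp: dist_norm)
    then show ?thesis by (intro borel_measurable_continuous_onI lipschitz_on_continuous_on)
  qed

  have neighbours: "xo k \<noteq> xo (k + 1)" for k
  proof
    assume eq: "xo k = xo (k + 1)"
    have "xo (k mod int m) = xo ((k + 1) mod int m)"
      using eq periodic_mod[of xo m, OF xo_periodic] by metis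
    then have "k mod int m = (k + 1) mod int m"
      using xo_distinct \<open>m \<ge> 2\<close> by (auto simp: inj_on_def)
    then have "int m dvd 1" by (metis add_diff_cancel_left' mod_eq_dvd_iff)
    then show False using \<open>m \<ge> 2\<close> by simp
  qed
  define \<epsilon> where "\<epsilon> = Min ((\<lambda>k. dist (xo k) (xo (k + 1))) ` {0..<int m})"
  have \<epsilon>: "\<epsilon> > 0" unfolding \<epsilon>_def using \<open>m \<ge> 2\<close> neighbours by (subst Min_gr_iff) auto
  have \<epsilon>_le: "\<epsilon> \<le> dist (xo k) (xo (k + 1))" for k
  proof -
    have "dist (xo k) (xo (k + 1)) = dist (xo (k mod int m)) (xo (k mod int m + 1))"
      using periodic_mod[of "\<lambda>k. dist (xo k) (xo (k + 1))" m] xo_periodic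
      by (metis (no_types, lifting) add.assoc add.commute)
    then show ?thesis unfolding \<epsilon>_def using \<open>m \<ge> 2\<close> by simp
  qed
  \<comment> \<open>Radius \<open>r\<^sub>0\<close> keeps the tube in the region where the gradient is affine. Two tubes of radius \<open>\<epsilon>/3\<close>
    around points at distance \<open>\<epsilon>\<close> are disjoint.\<close>
  define \<rho> where "\<rho> = min r\<^sub>0 (\<epsilon> / 3)"
  have \<rho>: "\<rho> > 0" "\<rho> \<le> r\<^sub>0" "\<rho> \<le> \<epsilon> / 3" using \<open>r\<^sub>0 > 0\<close> \<epsilon> by (auto simp: \<rho>_def)
  define e where "e = h * \<sigma> / r"
  have e: "0 < e" "h * \<sigma> \<le> e"
    using h \<sigma> obabo.r[OF obabo_axioms] by (auto simp: e_def field_simps mult_le_cancel_left1)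
  \<comment> \<open>Noise vectors of norm at most \<open>t R\<close> displace the rescaled positions by at most \<open>2 e t\<close>, hence raise the
    adapted norm by at most \<open>2 C e t = \<rho> / C\<close>, exactly what the contraction by \<open>1 - 1/C\<close> gives back.\<close>
  define t where "t = \<rho> / (2 * e * C\<^sup>2)"
  have t: "t > 0" using \<rho> e C by (simp add: t_def)

  define T where "T R k = {y. N k (deviation (rescale R U) R (xo k) (xo (k - 1)) y) \<le> \<rho>}" for R k
  have T_meas: "T R k \<in> sets borel" if "R > 0" for R k
  proof -
    have "deviation (rescale R U) R (xo k) (xo (k - 1)) \<in> borel_measurable borel"
      using measurable_prev[OF gradR_meas[OF that]] unfolding deviation_def borel_prod[symmetric] by measurable
    then show ?thesis unfolding T_def using N_meas[of k] by measurable
  qed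
  have T_position: "norm (fst y /\<^sub>R R - xo k) \<le> \<rho>" if "y \<in> T R k" for y R k
    using that N_low[of "deviation (rescale R U) R (xo k) (xo (k - 1)) y" k]
      norm_fst_le[of "fst y /\<^sub>R R - xo k" "prev (rescale R U) y /\<^sub>R R - xo (k - 1)"]
    unfolding T_def deviation_def by simp
  have T_disjoint: "T R k \<inter> T R (k + 1) = {}" for R k
  proof (rule ccontr)
    assume "\<not> ?thesis"
    then obtain y where "y \<in> T R k" "y \<in> T R (k + 1)" by auto
    then have "dist (xo k) (xo (k + 1)) \<le> 2 * \<rho>"
      using T_position[of y R k] T_position[of y R "k + 1"]
        dist_triangle[of "xo k" "xo (k + 1)" "fst y /\<^sub>R R"] by (simp add: dist_norm norm_minus_commute)
    then show False using \<epsilon>_le[of k] \<rho> by simp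
  qed
  define G where "G R = {\<xi> :: (real^'d) \<times> (real^'d). norm (fst \<xi>) \<le> t * R \<and> norm (snd \<xi>) \<le> t * R}" for R
  have G_meas: "G R \<in> sets borel" for R
    unfolding G_def
    by (intro borel_closed closed_Collect_conj closed_Collect_le continuous_intros)
  have T_step: "obabo_step h \<gamma> (rescale R U) y \<xi> \<in> T R (k + 1)"
    if R: "R > 0" and y: "y \<in> T R k" and \<xi>: "\<xi> \<in> G R" for R y k \<xi>
  proof -
    define u where "u = fst y /\<^sub>R R - xo k"
    define u' where "u' = prev (rescale R U) y /\<^sub>R R - xo (k - 1)"
    let ?n = "((h * \<sigma> / R) *\<^sub>R fst \<xi>, - (e / R) *\<^sub>R snd \<xi>)"
    have "norm u \<le> r\<^sub>0" using T_position[OF y] \<rho> by (simp add: u_def)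
    then have "grad (rescale R U) (fst y) = R *\<^sub>R (grad U (xo k) + H k *v u)"
      using affine[of u k] by (simp add: gradR[OF R] u_def)
    then have dev: "deviation (rescale R U) R (xo (k + 1)) (xo (k + 1 - 1)) (obabo_step h \<gamma> (rescale R U) y \<xi>)
        = (B k *v u - \<beta> *\<^sub>R u', u) + ?n"
      using deviation_step[OF R, of "rescale R U" "xo k" "xo (k - 1)" y u u' "grad U (xo k)" "H k" \<xi>]
      by (simp add: orbit[of k] u_def u'_def deviation_def B_def e_def)
    have "norm ?n \<le> norm ((h * \<sigma> / R) *\<^sub>R fst \<xi>) + norm (- (e / R) *\<^sub>R snd \<xi>)" by (rule norm_Pair_le)
    also have "\<dots> \<le> e * t + e * t"
    proof (rule add_mono)
      have "norm ((h * \<sigma> / R) *\<^sub>R fst \<xi>) = (h * \<sigma> / R) * norm (fst \<xi>)" using h \<sigma> R by simp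
      also have "\<dots> \<le> (e / R) * (t * R)"
        using \<xi> e h \<sigma> R by (intro mult_mono divide_right_mono) (auto simp: G_def)
      finally show "norm ((h * \<sigma> / R) *\<^sub>R fst \<xi>) \<le> e * t" using R by simp
      have "norm (- (e / R) *\<^sub>R snd \<xi>) = (e / R) * norm (snd \<xi>)" using e R by simp
      also have "\<dots> \<le> (e / R) * (t * R)"
        using \<xi> e R by (intro mult_left_mono) (auto simp: G_def)
      finally show "norm (- (e / R) *\<^sub>R snd \<xi>) \<le> e * t" using R by simp
    qed
    finally have n: "C * norm ?n \<le> \<rho> / C"
    proof -
      assume "norm ?n \<le> e * t + e * t"
      then have "C * norm ?n \<le> C * (e * t + e * t)" using C by (intro mult_left_mono) auto
      also have "\<dots> = \<rho> / C" using C e by (simp add: t_def power2_eq_square)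
      finally show ?thesis .
    qed
    have "N (k + 1) ((B k *v u - \<beta> *\<^sub>R u', u) + ?n) \<le> N (k + 1) (B k *v u - \<beta> *\<^sub>R u', u) + N (k + 1) ?n"
      by (rule N_add)
    also have "\<dots> \<le> (1 - 1 / C) * N k (u, u') + \<rho> / C"
      using N_step[of k u u'] N_up[of "k + 1" ?n] n by linarith
    also have "(1 - 1 / C) * N k (u, u') \<le> (1 - 1 / C) * \<rho>"
      using y C by (intro mult_left_mono) (auto simp: T_def deviation_def u_def u'_def)
    finally show ?thesis unfolding T_def mem_Collect_eq dev by (simp add: left_diff_distrib)
  qed
  have start: "z R i \<in> T R i" if "R > 0" for R i
  proof -
    have "z R i = from_positions (rescale R U) (R *\<^sub>R xo i, R *\<^sub>R xo (i - 1))"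
      by (simp add: z from_positions_def scaleR_diff_right)
    then have "deviation (rescale R U) R (xo i) (xo (i - 1)) (z R i) = 0"
      using that by (simp add: deviation_def zero_prod_def)
    then show ?thesis using \<rho> by (simp add: T_def N_zero)
  qed

  define p where "p R = 1 - measure noise (G R)" for R
  have p: "0 \<le> p R \<and> p R \<le> 1 \<and> p R \<le> (2 * sqrt 2 ^ DIM(real^'d)) * exp (- (t\<^sup>2 / 4) * R\<^sup>2)" if "R \<ge> 1" for R
  proof -
    have "t * R \<ge> 0" using t that by simp
    from noise_ball[OF this, where 'a = "real^'d"] show ?thesis
      using prob_space.prob_le_1[OF prob_space_noise, of "G R"]
      by (simp add: p_def G_def power_mult_distrib)
  qed
  have "1 < 2 * sqrt 2 ^ DIM(real^'d)"
    using one_le_power[of "sqrt 2" "DIM(real^'d)"] real_sqrt_ge_one[of 2] by linarith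
  then obtain c where c: "c > 0" and
    rare: "\<And>R n. R \<ge> 1 \<Longrightarrow> int n \<le> \<lfloor>exp (c * R\<^sup>2) / 16\<rfloor> \<Longrightarrow> real n * p R \<le> 5 / 64"
    using exponentially_many_rare_events[of "2 * sqrt 2 ^ DIM(real^'d)" "t\<^sup>2 / 4" p] p t by (metis zero_less_divide_iff zero_less_numeral zero_less_power)

  \<comment> \<open>The starting states are \<open>R\<close> times these points, which form a finite set by periodicity.\<close>
  define \<zeta> where "\<zeta> i = (xo i, r *\<^sub>R ((1 / h) *\<^sub>R (xo i - xo (i - 1)) - (h / 2) *\<^sub>R grad U (xo i)))" for i
  define Z where "Z = (\<Sum>i\<in>{0..<int m}. norm (\<zeta> i))"
  have \<zeta>_le: "norm (\<zeta> i) \<le> Z" for i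
  proof -
    have "\<zeta> (j + int m) = \<zeta> j" for j
      using xo_periodic[of "j - 1"] by (simp add: \<zeta>_def xo_periodic algebra_simps)
    then have "\<zeta> i = \<zeta> (i mod int m)" by (rule periodic_mod)
    then show ?thesis using member_le_sum[of "i mod int m" "{0..<int m}" "\<lambda>i. norm (\<zeta> i)"] \<open>m \<ge> 2\<close>
      by (simp add: Z_def)
  qed
  have z_norm: "norm (z R i) \<le> R * Z" if "R > 0" for R i
  proof -
    have "z R i = R *\<^sub>R \<zeta> i"
      using that by (simp add: z \<zeta>_def gradR scaleR_diff_right mult_ac)
    then show ?thesis using \<zeta>_le[of i] that by simp
  qed
  define C0 where "C0 = sqrt (2 * Z\<^sup>2 + 2 * D * (1 + b\<^sup>2))"
  have C0: "C0 > 0" unfolding C0_def using D by (intro real_sqrt_gt_zero add_nonneg_pos mult_pos_pos) (use \<open>b > 0\<close> in \<open>auto simp: add_pos_nonneg\<close>)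
  show ?thesis
  proof (rule exI[of _ c], intro conjI c, rule exI[of _ C0], intro conjI C0 allI impI)
    fix R :: real assume R: "R > 0"
    let ?Q = "obabo_kernel h \<gamma> (rescale R U)"
    obtain \<pi> where \<pi>: "invariant_law ?Q \<pi>" "\<forall>\<pi>'. invariant_law ?Q \<pi>' \<longrightarrow> \<pi>' = \<pi>"
      and \<pi>2: "(\<integral>\<^sup>+y. ennreal ((norm y)\<^sup>2) \<partial>\<pi>) \<le> ennreal (D * (1 + (R * b)\<^sup>2))"
    proof -
      have "0 \<le> R * b" using R \<open>b > 0\<close> by simp
      from inv[OF gradR_meas[OF R] this wR[OF R]] show thesis using that by blast
    qed
    have \<pi>_prob: "prob_space \<pi>" and \<pi>_sets: "sets \<pi> = sets borel" using \<pi>(1) by (auto simp: invariant_law_def)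
    interpret \<pi>: prob_space \<pi> by (rule \<pi>_prob)
    note \<pi>_sets[measurable_cong]
    have W2: "W2 (return borel (z R i)) \<pi> \<le> ennreal (C0 * (1 + R))" for i
    proof (rule W2_return_le[OF \<pi>_prob \<pi>_sets])
      have "(\<integral>\<^sup>+y. ennreal ((dist (z R i) y)\<^sup>2) \<partial>\<pi>)
          \<le> (\<integral>\<^sup>+y. ennreal (2 * (R * Z)\<^sup>2) + ennreal 2 * ennreal ((norm y)\<^sup>2) \<partial>\<pi>)"
      proof (rule nn_integral_mono)
        fix y
        have "dist (z R i) y \<le> R * Z + norm y"
          using norm_triangle_ineq4[of "z R i" y] z_norm[OF R, of i] by (simp add: dist_norm)
        then have "(dist (z R i) y)\<^sup>2 \<le> (R * Z + norm y)\<^sup>2" by (intro power_mono) auto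
        also have "\<dots> \<le> 2 * (R * Z)\<^sup>2 + 2 * (norm y)\<^sup>2"
          using zero_le_power2[of "R * Z - norm y"] by (simp add: power2_eq_square algebra_simps)
        finally show "ennreal ((dist (z R i) y)\<^sup>2) \<le> ennreal (2 * (R * Z)\<^sup>2) + ennreal 2 * ennreal ((norm y)\<^sup>2)"
          by (subst ennreal_mult[symmetric], simp, simp, subst ennreal_plus[symmetric], simp, simp)
            (rule ennreal_leI)
      qed
      also have "\<dots> = ennreal (2 * (R * Z)\<^sup>2) + ennreal 2 * (\<integral>\<^sup>+y. ennreal ((norm y)\<^sup>2) \<partial>\<pi>)"
        using \<pi>.emeasure_space_1 by (subst nn_integral_add, simp, measurable) (simp add: nn_integral_cmult)
      also have "\<dots> \<le> ennreal (2 * (R * Z)\<^sup>2) + ennreal 2 * ennreal (D * (1 + (R * b)\<^sup>2))"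
        by (intro add_left_mono mult_left_mono \<pi>2) simp
      also have "\<dots> = ennreal (2 * (R * Z)\<^sup>2 + 2 * (D * (1 + (R * b)\<^sup>2)))"
        using D by (subst ennreal_mult[symmetric], simp, simp, subst ennreal_plus[symmetric], simp, simp) simp
      also have "\<dots> \<le> ennreal ((C0 * (1 + R))\<^sup>2)"
      proof (rule ennreal_leI)
        have "C0\<^sup>2 = 2 * Z\<^sup>2 + 2 * D * (1 + b\<^sup>2)" unfolding C0_def using D by (intro real_sqrt_pow2) simp
        then have sq: "(C0 * (1 + R))\<^sup>2 = (2 * Z\<^sup>2 + 2 * D * (1 + b\<^sup>2)) * (1 + R)\<^sup>2"
          by (simp only: power_mult_distrib)
        have "(C0 * (1 + R))\<^sup>2 - (2 * (R * Z)\<^sup>2 + 2 * (D * (1 + (R * b)\<^sup>2)))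
            = 2 * Z\<^sup>2 * (1 + 2 * R) + 2 * D * (2 * R + R\<^sup>2 + b\<^sup>2 * (1 + 2 * R))"
          unfolding sq by (simp add: power2_eq_square algebra_simps)
        moreover have "0 \<le> \<dots>" using D R by simp
        ultimately show "2 * (R * Z)\<^sup>2 + 2 * (D * (1 + (R * b)\<^sup>2)) \<le> (C0 * (1 + R))\<^sup>2" by linarith
      qed
      finally show "(\<integral>\<^sup>+y. ennreal ((dist (z R i) y)\<^sup>2) \<partial>\<pi>) \<le> ennreal ((C0 * (1 + R))\<^sup>2)" .
    qed (use C0 R in simp)
    have far: "\<exists>i\<in>{j, j + 1}. \<forall>n::nat. int n \<le> \<lfloor>exp (c * R\<^sup>2) / 16\<rfloor> \<longrightarrow>
        3 / 8 \<le> tv_dist (law_after ?Q n (return borel (z R i))) \<pi>" if R1: "R \<ge> 1" for j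
    proof -
      have stay: "1 - p R \<le> measure (?Q y) (T R (k + 1))" if "y \<in> T R k" for y k
        using measure_obabo_kernel[OF gradR_meas[OF R] T_meas[OF R] G_meas T_step[OF R that]]
        by (simp add: p_def)
      have "(\<forall>n::nat. int n \<le> \<lfloor>exp (c * R\<^sup>2) / 16\<rfloor> \<longrightarrow> 3 / 8 \<le> tv_dist (law_after ?Q n (return borel (z R j))) \<pi>) \<or>
        (\<forall>n::nat. int n \<le> \<lfloor>exp (c * R\<^sup>2) / 16\<rfloor> \<longrightarrow> 3 / 8 \<le> tv_dist (law_after ?Q n (return borel (z R (j + 1)))) \<pi>)"
      proof (rule one_of_two_starts_is_far[where A = "\<lambda>k. T R (j + int k)" and A' = "\<lambda>k. T R (j + 1 + int k)" and p = "p R"])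
        show "?Q \<in> borel \<rightarrow>\<^sub>M prob_algebra borel" by (rule measurable_obabo_kernel[OF gradR_meas[OF R]])
        show "T R (j + int k) \<inter> T R (j + 1 + int k) = {}" for k
          using T_disjoint[of R "j + int k"] by (simp add: add_ac)
        show "1 - p R \<le> measure (?Q y) (T R (j + int (Suc k)))" if "y \<in> T R (j + int k)" for k y
          using stay[OF that] by (simp add: add_ac)
        show "1 - p R \<le> measure (?Q y) (T R (j + 1 + int (Suc k)))" if "y \<in> T R (j + 1 + int k)" for k y
          using stay[OF that] by (simp add: add_ac)
        show "real n * p R \<le> 5 / 64" if "int n \<le> \<lfloor>exp (c * R\<^sup>2) / 16\<rfloor>" for n by (rule rare[OF R1 that])
      qed (use \<pi>(1) T_meas[OF R] start[OF R] p[OF R1] in auto)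
      then show ?thesis by blast
    qed
    show "\<exists>\<pi>. invariant_law ?Q \<pi> \<and> (\<forall>\<pi>'. invariant_law ?Q \<pi>' \<longrightarrow> \<pi>' = \<pi>) \<and>
       (R \<ge> 1 \<longrightarrow> (\<forall>j. \<exists>i\<in>{j, j + 1}. W2 (return borel (z R i)) \<pi> \<le> ennreal (C0 * (1 + R)) \<and>
          (\<forall>n::nat. int n \<le> \<lfloor>exp (c * R\<^sup>2) / 16\<rfloor> \<longrightarrow> tv_dist (law_after ?Q n (return borel (z R i))) \<pi> \<ge> 3 / 8)))"
    proof (intro exI[of _ \<pi>] conjI impI allI)
      fix j assume "R \<ge> 1"
      from far[OF this, of j] W2 show "\<exists>i\<in>{j, j + 1}. W2 (return borel (z R i)) \<pi> \<le> ennreal (C0 * (1 + R)) \<and>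
          (\<forall>n::nat. int n \<le> \<lfloor>exp (c * R\<^sup>2) / 16\<rfloor> \<longrightarrow> tv_dist (law_after ?Q n (return borel (z R i))) \<pi> \<ge> 3 / 8)"
        by blast
    qed (use \<pi> in blast)+
  qed
qed

end
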